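(* Let $\mathcal{O}\subset\mathbb{R}^d$, $d\ge1$, be a bounded domain with boundary of class $C^2$, let $p\in[2,\infty)$ if $1\le d\le4$ and $p\in\big[2,\frac{2d-4}{d-4}\big)$ if $d\ge5$, and let $\alpha\in(\frac12,1)$. If $u_0\in D(A^\alpha)\cap\mathcal{M}$ and $u$ is a global strong solution of $$\frac{\partial u}{\partial t}=\Delta u-|u|^{p-2}u+\big(\|\nabla u\|_{L^2(\mathcal{O})}^2+\|u\|_{L^p(\mathcal{O})}^p\big)u,\qquad u|_{\partial\mathcal{O}}=0,\qquad u(0)=u_0,$$ then the orbit $\{u(t):t\ge0\}$ is bounded in $D(A^\alpha)$.
   Context: $A=-\Delta$ is the Dirichlet Laplacian on $L^2(\mathcal{O})$ with domain $D(A)=H^2(\mathcal{O})\cap H_0^1(\mathcal{O})$; $A^s$ are its fractional powers, $D(A^s)$ normed by $\|A^s\cdot\|_{L^2(\mathcal{O})}$. $\mathcal{M}=\{v\in L^2(\mathcal{O}):\|v\|_{L^2(\mathcal{O})}=1\}$. Strong solution on $[0,T]$: a function $u\in W^{1,\infty}([0,T];L^2(\mathcal{O}))\cap C([0,T];D(A)\cap\mathcal{M})\cap L^2(0,T;D(A^{3/2}))$ such that the equation holds in $L^2(0,T;L^2(\mathcal{O}))$ and $u(0)=u_0$ in $L^2(\mathcal{O})$. A global strong solution is a function on $[0,\infty)$ whose restriction to $[0,T]$ is a strong solution for every $T>0$. *)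

theory Defs
  imports "HOL-Analysis.Analysis"
begin

text \<open>
  Elements of the function spaces over a domain \<open>\<Omega>\<close> are represented by functions on the whole
  Euclidean space; only their restriction to \<open>\<Omega>\<close>, up to Lebesgue null sets, matters. All functions
  are real-valued.
\<close>

section \<open>Classical smoothness\<close>

primrec Ck_on :: "nat \<Rightarrow> 'a::euclidean_space set \<Rightarrow> ('a \<Rightarrow> real) \<Rightarrow> bool" where
  "Ck_on 0 S f \<longleftrightarrow> continuous_on S f"
| "Ck_on (Suc k) S f \<longleftrightarrow>
     (\<exists>D. (\<forall>x\<in>S. (f has_derivative (\<lambda>h. \<Sum>b\<in>Basis. (h \<bullet> b) * D b x)) (at x)) \<and>
          (\<forall>b\<in>Basis. Ck_on k S (D b)))"

definition test_function :: "'a::euclidean_space set \<Rightarrow> ('a \<Rightarrow> real) \<Rightarrow> bool" where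
  "test_function \<Omega> \<psi> \<longleftrightarrow>
     (\<forall>k. Ck_on k UNIV \<psi>) \<and> (\<exists>K. compact K \<and> K \<subseteq> \<Omega> \<and> (\<forall>x. x \<notin> K \<longrightarrow> \<psi> x = 0))"

text \<open>
  Near each boundary point, \<open>\<Omega>\<close> lies strictly on one side of the graph of a \<open>C\<^sup>2\<close> function over a
  hyperplane with unit normal \<open>n\<close>. The vector \<open>y - (y \<bullet> n) *\<^sub>R n\<close> collects the remaining
  \<open>d - 1\<close> coordinates of \<open>y\<close>, so only the values of \<open>\<gamma>\<close> on the hyperplane are used.
\<close>

definition C2_boundary :: "'a::euclidean_space set \<Rightarrow> bool" where
  "C2_boundary \<Omega> \<longleftrightarrow>
     (\<forall>z\<in>frontier \<Omega>. \<exists>r>0. \<exists>n \<gamma>. norm n = 1 \<and> Ck_on 2 UNIV \<gamma> \<and>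
        \<Omega> \<inter> ball z r = {y \<in> ball z r. y \<bullet> n > \<gamma> (y - (y \<bullet> n) *\<^sub>R n)})"

section \<open>Lebesgue and Sobolev spaces\<close>

definition L2 :: "'a::euclidean_space set \<Rightarrow> ('a \<Rightarrow> real) set" where
  "L2 \<Omega> = {f \<in> borel_measurable (lebesgue_on \<Omega>). integrable (lebesgue_on \<Omega>) (\<lambda>x. (f x)\<^sup>2)}"

definition L2_inner :: "'a::euclidean_space set \<Rightarrow> ('a \<Rightarrow> real) \<Rightarrow> ('a \<Rightarrow> real) \<Rightarrow> real" where
  "L2_inner \<Omega> f g = (LINT x|lebesgue_on \<Omega>. f x * g x)"

definition L2_norm :: "'a::euclidean_space set \<Rightarrow> ('a \<Rightarrow> real) \<Rightarrow> real" where
  "L2_norm \<Omega> f = sqrt (LINT x|lebesgue_on \<Omega>. (f x)\<^sup>2)"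

definition Lp_norm :: "'a::euclidean_space set \<Rightarrow> real \<Rightarrow> ('a \<Rightarrow> real) \<Rightarrow> real" where
  "Lp_norm \<Omega> p f = (LINT x|lebesgue_on \<Omega>. \<bar>f x\<bar> powr p) powr (1 / p)"

definition unit_sphere :: "'a::euclidean_space set \<Rightarrow> ('a \<Rightarrow> real) set" where
  "unit_sphere \<Omega> = {v \<in> L2 \<Omega>. L2_norm \<Omega> v = 1}"

definition has_weak_partial ::
  "'a::euclidean_space set \<Rightarrow> 'a \<Rightarrow> ('a \<Rightarrow> real) \<Rightarrow> ('a \<Rightarrow> real) \<Rightarrow> bool" where
  "has_weak_partial \<Omega> b f g \<longleftrightarrow>
     (\<forall>\<psi>. test_function \<Omega> \<psi> \<longrightarrow>
        (LINT x|lebesgue_on \<Omega>. f x * frechet_derivative \<psi> (at x) b)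
          = - (LINT x|lebesgue_on \<Omega>. g x * \<psi> x))"

definition H1 :: "'a::euclidean_space set \<Rightarrow> ('a \<Rightarrow> real) set" where
  "H1 \<Omega> = {f \<in> L2 \<Omega>. \<forall>b\<in>Basis. \<exists>g\<in>L2 \<Omega>. has_weak_partial \<Omega> b f g}"

text \<open>A representative of the weak derivative, which is unique almost everywhere on \<open>\<Omega>\<close>.\<close>

definition weak_partial ::
  "'a::euclidean_space set \<Rightarrow> 'a \<Rightarrow> ('a \<Rightarrow> real) \<Rightarrow> 'a \<Rightarrow> real" where
  "weak_partial \<Omega> b f = (SOME g. g \<in> L2 \<Omega> \<and> has_weak_partial \<Omega> b f g)"

definition H2 :: "'a::euclidean_space set \<Rightarrow> ('a \<Rightarrow> real) set" where
  "H2 \<Omega> = {f \<in> H1 \<Omega>. \<forall>b\<in>Basis. weak_partial \<Omega> b f \<in> H1 \<Omega>}"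

definition grad_norm :: "'a::euclidean_space set \<Rightarrow> ('a \<Rightarrow> real) \<Rightarrow> real" where
  "grad_norm \<Omega> f = sqrt (\<Sum>b\<in>Basis. (L2_norm \<Omega> (weak_partial \<Omega> b f))\<^sup>2)"

definition H1_norm :: "'a::euclidean_space set \<Rightarrow> ('a \<Rightarrow> real) \<Rightarrow> real" where
  "H1_norm \<Omega> f = sqrt ((L2_norm \<Omega> f)\<^sup>2 + (grad_norm \<Omega> f)\<^sup>2)"

definition H10 :: "'a::euclidean_space set \<Rightarrow> ('a \<Rightarrow> real) set" where
  "H10 \<Omega> = {f \<in> H1 \<Omega>. \<exists>\<psi>. (\<forall>n. test_function \<Omega> (\<psi> n)) \<and>
              (\<lambda>n::nat. H1_norm \<Omega> (\<lambda>x. \<psi> n x - f x)) \<longlonglongrightarrow> 0}"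

section \<open>The Dirichlet Laplacian and its fractional powers\<close>

definition laplacian :: "'a::euclidean_space set \<Rightarrow> ('a \<Rightarrow> real) \<Rightarrow> 'a \<Rightarrow> real" where
  "laplacian \<Omega> f x = (\<Sum>b\<in>Basis. weak_partial \<Omega> b (weak_partial \<Omega> b f) x)"

definition dom_A :: "'a::euclidean_space set \<Rightarrow> ('a \<Rightarrow> real) set" where
  "dom_A \<Omega> = H2 \<Omega> \<inter> H10 \<Omega>"

definition op_A :: "'a::euclidean_space set \<Rightarrow> ('a \<Rightarrow> real) \<Rightarrow> 'a \<Rightarrow> real" where
  "op_A \<Omega> f x = - laplacian \<Omega> f x"

definition eigenbasis_A ::
  "'a::euclidean_space set \<Rightarrow> (nat \<Rightarrow> 'a \<Rightarrow> real) \<Rightarrow> (nat \<Rightarrow> real) \<Rightarrow> bool" where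
  "eigenbasis_A \<Omega> e \<mu> \<longleftrightarrow>
     (\<forall>k. e k \<in> dom_A \<Omega> \<and> (AE x in lebesgue_on \<Omega>. op_A \<Omega> (e k) x = \<mu> k * e k x)) \<and>
     (\<forall>j k. L2_inner \<Omega> (e j) (e k) = (if j = k then 1 else 0)) \<and>
     (\<forall>f\<in>L2 \<Omega>. (\<forall>k. L2_inner \<Omega> f (e k) = 0) \<longrightarrow> (AE x in lebesgue_on \<Omega>. f x = 0))"

text \<open>
  \<open>A\<close> is positive and self-adjoint with compact resolvent, so an orthonormal basis of
  eigenfunctions exists, with eigenvalues \<open>\<mu> k > 0\<close>, and \<open>A\<^sup>s v = \<Sum>k. \<mu> k powr s * \<langle>v, e k\<rangle> * e k\<close> on
  the set of those \<open>v\<close> for which the series converges in \<open>L\<^sup>2\<close>. The relation below says that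
  \<open>w\<close> is the sum of this series, by way of its coefficients. It does not depend on the
  choice of the eigenbasis, and \<open>w\<close> is unique almost everywhere on \<open>\<Omega>\<close>.
\<close>

definition is_frac_A ::
  "'a::euclidean_space set \<Rightarrow> real \<Rightarrow> ('a \<Rightarrow> real) \<Rightarrow> ('a \<Rightarrow> real) \<Rightarrow> bool" where
  "is_frac_A \<Omega> s v w \<longleftrightarrow> v \<in> L2 \<Omega> \<and> w \<in> L2 \<Omega> \<and>
     (\<exists>e \<mu>. eigenbasis_A \<Omega> e \<mu> \<and>
        (\<forall>k. L2_inner \<Omega> w (e k) = \<mu> k powr s * L2_inner \<Omega> v (e k)))"

definition dom_frac_A :: "'a::euclidean_space set \<Rightarrow> real \<Rightarrow> ('a \<Rightarrow> real) set" where
  "dom_frac_A \<Omega> s = {v. \<exists>w. is_frac_A \<Omega> s v w}"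

definition frac_A :: "'a::euclidean_space set \<Rightarrow> real \<Rightarrow> ('a \<Rightarrow> real) \<Rightarrow> 'a \<Rightarrow> real" where
  "frac_A \<Omega> s v = (SOME w. is_frac_A \<Omega> s v w)"

definition norm_frac_A :: "'a::euclidean_space set \<Rightarrow> real \<Rightarrow> ('a \<Rightarrow> real) \<Rightarrow> real" where
  "norm_frac_A \<Omega> s v = L2_norm \<Omega> (frac_A \<Omega> s v)"

section \<open>Spaces of vector-valued functions of time\<close>

text \<open>
  The spaces \<open>L\<^sup>2(\<Omega>)\<close> and \<open>D(A\<^sup>s)\<close> depend on \<open>\<Omega>\<close> and are therefore not types, so that
  the type-based Bochner integral does not apply. Its construction through simple functions is
  repeated here for a set \<open>X\<close> of functions with (semi)norm \<open>N\<close> and a bounded time interval \<open>J\<close>.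
\<close>

definition simple_into ::
  "real set \<Rightarrow> ('a \<Rightarrow> real) set \<Rightarrow> (real \<Rightarrow> 'a \<Rightarrow> real) \<Rightarrow> bool" where
  "simple_into J X s \<longleftrightarrow> simple_function (lebesgue_on J) s \<and> s ` J \<subseteq> X"

definition strongly_measurable ::
  "real set \<Rightarrow> ('a \<Rightarrow> real) set \<Rightarrow> (('a \<Rightarrow> real) \<Rightarrow> real) \<Rightarrow> (real \<Rightarrow> 'a \<Rightarrow> real) \<Rightarrow> bool" where
  "strongly_measurable J X N f \<longleftrightarrow>
     (AE t in lebesgue_on J. f t \<in> X) \<and>
     (\<exists>s. (\<forall>n::nat. simple_into J X (s n)) \<and>
          (AE t in lebesgue_on J. (\<lambda>n. N (\<lambda>x. f t x - s n t x)) \<longlonglongrightarrow> 0))"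

definition has_Bochner_integral ::
  "real set \<Rightarrow> ('a \<Rightarrow> real) set \<Rightarrow> (('a \<Rightarrow> real) \<Rightarrow> real) \<Rightarrow> (real \<Rightarrow> 'a \<Rightarrow> real) \<Rightarrow> ('a \<Rightarrow> real) \<Rightarrow> bool"
  where
  "has_Bochner_integral J X N f I \<longleftrightarrow>
     strongly_measurable J X N f \<and> I \<in> X \<and>
     (\<exists>s. (\<forall>n::nat. simple_into J X (s n)) \<and>
          (\<lambda>n. \<integral>\<^sup>+ t. ennreal (N (\<lambda>x. f t x - s n t x)) \<partial>lebesgue_on J) \<longlonglongrightarrow> 0 \<and>
          (\<lambda>n. N (\<lambda>x. I x - (\<Sum>v\<in>s n ` J. measure lebesgue {t\<in>J. s n t = v} * v x)))
            \<longlonglongrightarrow> 0)"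

definition time_Linf ::
  "real set \<Rightarrow> ('a \<Rightarrow> real) set \<Rightarrow> (('a \<Rightarrow> real) \<Rightarrow> real) \<Rightarrow> (real \<Rightarrow> 'a \<Rightarrow> real) set" where
  "time_Linf J X N =
     {f. strongly_measurable J X N f \<and> (\<exists>C. AE t in lebesgue_on J. N (f t) \<le> C)}"

definition time_L2 ::
  "real set \<Rightarrow> ('a \<Rightarrow> real) set \<Rightarrow> (('a \<Rightarrow> real) \<Rightarrow> real) \<Rightarrow> (real \<Rightarrow> 'a \<Rightarrow> real) set" where
  "time_L2 J X N =
     {f. strongly_measurable J X N f \<and> integrable (lebesgue_on J) (\<lambda>t. (N (f t))\<^sup>2)}"

definition time_C ::
  "real set \<Rightarrow> ('a \<Rightarrow> real) set \<Rightarrow> (('a \<Rightarrow> real) \<Rightarrow> real) \<Rightarrow> (real \<Rightarrow> 'a \<Rightarrow> real) set" where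
  "time_C J X N =
     {f. \<forall>t\<in>J. f t \<in> X \<and> ((\<lambda>s. N (\<lambda>x. f s x - f t x)) \<longlongrightarrow> 0) (at t within J)}"

definition has_weak_time_derivative ::
  "real \<Rightarrow> ('a \<Rightarrow> real) set \<Rightarrow> (('a \<Rightarrow> real) \<Rightarrow> real) \<Rightarrow>
    (real \<Rightarrow> 'a \<Rightarrow> real) \<Rightarrow> (real \<Rightarrow> 'a \<Rightarrow> real) \<Rightarrow> bool" where
  "has_weak_time_derivative T X N f g \<longleftrightarrow>
     (\<forall>\<phi>. test_function {0<..<T} \<phi> \<longrightarrow>
        (\<exists>I. has_Bochner_integral {0..T} X N (\<lambda>t x. deriv \<phi> t * f t x) I \<and>
             has_Bochner_integral {0..T} X N (\<lambda>t x. \<phi> t * g t x) (\<lambda>x. - I x)))"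

section \<open>Strong solutions\<close>

definition rhs :: "'a::euclidean_space set \<Rightarrow> real \<Rightarrow> ('a \<Rightarrow> real) \<Rightarrow> 'a \<Rightarrow> real" where
  "rhs \<Omega> p v x =
     laplacian \<Omega> v x - \<bar>v x\<bar> powr (p - 2) * v x
       + ((grad_norm \<Omega> v)\<^sup>2 + (Lp_norm \<Omega> p v) powr p) * v x"

text \<open>
  \<open>u'\<close> is the time derivative of \<open>u\<close>, so its first two properties and \<open>u \<in> L\<^sup>\<infinity>\<close> amount to
  \<open>u \<in> W\<^sup>1\<^sup>,\<^sup>\<infinity>([0,T]; L\<^sup>2(\<Omega>))\<close>; the next two say that the equation is an equality of elements of
  \<open>L\<^sup>2(0,T; L\<^sup>2(\<Omega>))\<close>. The boundary condition is contained in \<open>u t \<in> dom_A \<Omega>\<close>.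
\<close>

definition strong_solution ::
  "'a::euclidean_space set \<Rightarrow> real \<Rightarrow> ('a \<Rightarrow> real) \<Rightarrow> real \<Rightarrow> (real \<Rightarrow> 'a \<Rightarrow> real) \<Rightarrow> bool" where
  "strong_solution \<Omega> p u0 T u \<longleftrightarrow>
     u \<in> time_Linf {0..T} (L2 \<Omega>) (L2_norm \<Omega>) \<and>
     (\<exists>u'. u' \<in> time_Linf {0..T} (L2 \<Omega>) (L2_norm \<Omega>) \<and>
           has_weak_time_derivative T (L2 \<Omega>) (L2_norm \<Omega>) u u' \<and>
           (\<lambda>t. rhs \<Omega> p (u t)) \<in> time_L2 {0..T} (L2 \<Omega>) (L2_norm \<Omega>) \<and>
           (AE t in lebesgue_on {0..T}. AE x in lebesgue_on \<Omega>. u' t x = rhs \<Omega> p (u t) x)) \<and>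
     u \<in> time_C {0..T} (dom_A \<Omega>) (\<lambda>v. L2_norm \<Omega> (op_A \<Omega> v)) \<and>
     (\<forall>t\<in>{0..T}. u t \<in> unit_sphere \<Omega>) \<and>
     u \<in> time_L2 {0..T} (dom_frac_A \<Omega> (3/2)) (norm_frac_A \<Omega> (3/2)) \<and>
     (AE x in lebesgue_on \<Omega>. u 0 x = u0 x)"

definition global_strong_solution ::
  "'a::euclidean_space set \<Rightarrow> real \<Rightarrow> ('a \<Rightarrow> real) \<Rightarrow> (real \<Rightarrow> 'a \<Rightarrow> real) \<Rightarrow> bool" where
  "global_strong_solution \<Omega> p u0 u \<longleftrightarrow> (\<forall>T>0. strong_solution \<Omega> p u0 T u)"

end

theory Submission
  imports Defs
begin

text \<open>
  The equation is the gradient flow of the convex energy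
  \<open>E v = 1/2 |grad v|\<^sup>2 + 1/p |v|\<^sub>p\<^sup>p\<close>, projected to the unit sphere: \<open>u' = - E'(u) + \<lambda> u\<close> with
  \<open>\<lambda> = |grad u|\<^sup>2 + |u|\<^sub>p\<^sup>p\<close>, and \<open>\<lambda> \<le> p E(u)\<close> as \<open>p \<ge> 2\<close>. The proof shows that the orbit is bounded
  already in \<open>D(A)\<close>; then \<open>D(A\<^sup>\<alpha>)\<close> follows by comparing spectral coefficients (\<open>frac_A_bound\<close>).

  Two elements of the unit sphere satisfy \<open>\<langle>v, w - v\<rangle> = - |w - v|\<^sup>2 / 2\<close>. Together with the subgradient
  inequality for \<open>E\<close> this turns the equation into an evolution variational inequality
  (\<open>rhs_evi\<close>): for almost all \<open>s\<close> and \<open>t\<close>,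
  \<open>1/2 d/dt |u t - u s|\<^sup>2 \<le> E(u s) - E(u t) + p/2 E(u t) |u t - u s|\<^sup>2\<close>.
  Everything about the dynamics is drawn from this one inequality between real functions, in the
  locale \<open>evi\<close>:

    \<^item> \<open>E(u)\<close> does not increase, so \<open>\<lambda> \<le> \<Lambda>\<close> for a constant \<open>\<Lambda>\<close>;
    \<^item> taking \<open>s\<close> as the initial time, \<open>|u (t + h) - u t|\<^sup>2 \<le> 4 h (E(u t) - E(u (t + h)))\<close>;
    \<^item> letting \<open>t\<close> and \<open>t + h\<close> advance together, the energies cancel, and \<open>|u (t + h) - u t|\<^sup>2\<close> grows
      at most like \<open>exp (2 \<Lambda> t)\<close>.

  The third estimate bounds the square of the displacement at time \<open>b\<close> by the one at each earlier
  time \<open>b - k h\<close> within a unit of time; summing the second estimate over these times telescopes.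
  The result is \<open>|u (b + h) - u b| \<le> V h\<close> with \<open>V\<close> independent of \<open>b\<close> (\<open>speed_bound\<close>).

  Finally the equation is tested with \<open>A u\<close>. Since \<open>\<langle>|u|\<^sup>p\<^sup>-\<^sup>2 u, A u\<rangle> \<ge> 0\<close> (\<open>op_A_power_nonneg\<close>),
  \<open>|A u|\<^sup>2 \<le> \<langle>\<lambda> u - u', A u\<rangle> \<le> (\<Lambda> + V) |A u|\<close>. Because \<open>u\<close> is continuous into \<open>D(A)\<close>, this bound on
  time averages holds at every time (\<open>Au_bounded_late\<close>), and a compact initial interval is harmless.

  The analytic facts behind these steps are proved first: the fundamental lemma, which makes weak
  derivatives unique almost everywhere; the Green formula and the Poincare inequality for
  \<open>H\<^sup>1\<^sub>0\<close>; the Riesz--Fischer theorem; and the passage from the weak time derivative to the identity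
  \<open>\<langle>u b - u a, g\<rangle> = \<integral> \<langle>u', g\<rangle>\<close> over \<open>{a..b}\<close>.
\<close>

section \<open>Smooth functions and a flat family\<close>

lemma Ck_on_Suc_imp: "Ck_on (Suc k) UNIV f \<Longrightarrow> Ck_on k UNIV f"
proof (induction k arbitrary: f)
  case 0
  then show ?case
    by (auto simp: continuous_on_eq_continuous_at intro: has_derivative_continuous)
next
  case (Suc k)
  from Suc.prems obtain D where
    D: "\<forall>x. (f has_derivative (\<lambda>h. \<Sum>b\<in>Basis. (h \<bullet> b) * D b x)) (at x)"
       "\<forall>b\<in>Basis. Ck_on (Suc k) UNIV (D b)"
    unfolding Ck_on.simps(2)[of "Suc k"] by auto
  show ?case
    unfolding Ck_on.simps(2) using D Suc.IH by (intro exI[of _ D]) auto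
qed

lemma Ck_on_const: "Ck_on k UNIV (\<lambda>x. c)"
proof (induction k arbitrary: c)
  case (Suc k)
  show ?case
    unfolding Ck_on.simps(2) using Suc.IH by (intro exI[of _ "\<lambda>b x. 0"]) auto
qed auto

lemma Ck_on_inner: "Ck_on k UNIV (\<lambda>x::'a::euclidean_space. x \<bullet> c)"
proof (cases k)
  case (Suc n)
  have "((\<lambda>x. x \<bullet> c) has_derivative (\<lambda>h. \<Sum>b\<in>Basis. (h \<bullet> b) * (b \<bullet> c))) (at x)" for x :: 'a
  proof -
    have "(\<lambda>h::'a. \<Sum>b\<in>Basis. (h \<bullet> b) * (b \<bullet> c)) = (\<lambda>h. h \<bullet> c)"
      by (intro ext) (subst (3) euclidean_inner, simp add: inner_commute)
    then show ?thesis by (auto intro!: derivative_eq_intros)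
  qed
  then show ?thesis
    unfolding Suc Ck_on.simps(2)
    by (intro exI[of _ "\<lambda>b x. b \<bullet> c"]) (auto intro: Ck_on_const)
qed (auto intro!: continuous_intros)

lemma Ck_on_add:
  "Ck_on k UNIV f \<Longrightarrow> Ck_on k UNIV g \<Longrightarrow> Ck_on k UNIV (\<lambda>x. f x + g x)"
proof (induction k arbitrary: f g)
  case 0
  then show ?case by (auto intro: continuous_on_add continuous_on_mult)
next
  case (Suc k)
  obtain D where
    D: "\<forall>x. (f has_derivative (\<lambda>h. \<Sum>b\<in>Basis. (h \<bullet> b) * D b x)) (at x)"
       "\<forall>b\<in>Basis. Ck_on k UNIV (D b)"
    using Suc.prems(1) unfolding Ck_on.simps(2) by auto
  obtain E where
    E: "\<forall>x. (g has_derivative (\<lambda>h. \<Sum>b\<in>Basis. (h \<bullet> b) * E b x)) (at x)"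
       "\<forall>b\<in>Basis. Ck_on k UNIV (E b)"
    using Suc.prems(2) unfolding Ck_on.simps(2) by auto
  show ?case
    unfolding Ck_on.simps(2)
    using has_derivative_add[OF D(1)[rule_format] E(1)[rule_format]] Suc.IH[OF D(2)[rule_format] E(2)[rule_format]]
    by (intro exI[of _ "\<lambda>b x. D b x + E b x"]) (auto simp: distrib_left sum.distrib)
qed

lemma Ck_on_mult:
  "Ck_on k UNIV f \<Longrightarrow> Ck_on k UNIV g \<Longrightarrow> Ck_on k UNIV (\<lambda>x. f x * g x)"
proof (induction k arbitrary: f g)
  case 0
  then show ?case by (auto intro: continuous_on_add continuous_on_mult)
next
  case (Suc k)
  obtain D where
    D: "\<forall>x. (f has_derivative (\<lambda>h. \<Sum>b\<in>Basis. (h \<bullet> b) * D b x)) (at x)"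
       "\<forall>b\<in>Basis. Ck_on k UNIV (D b)"
    using Suc.prems(1) unfolding Ck_on.simps(2) by auto
  obtain E where
    E: "\<forall>x. (g has_derivative (\<lambda>h. \<Sum>b\<in>Basis. (h \<bullet> b) * E b x)) (at x)"
       "\<forall>b\<in>Basis. Ck_on k UNIV (E b)"
    using Suc.prems(2) unfolding Ck_on.simps(2) by auto
  have fg: "Ck_on k UNIV f" "Ck_on k UNIV g"
    using Suc.prems by (blast intro: Ck_on_Suc_imp)+
  have "((\<lambda>x. f x * g x) has_derivative
      (\<lambda>h. \<Sum>b\<in>Basis. (h \<bullet> b) * (f x * E b x + D b x * g x))) (at x)" for x
    using has_derivative_mult[OF D(1)[rule_format, of x] E(1)[rule_format, of x]]
    by (rule has_derivative_eq_rhs)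
       (auto simp: fun_eq_iff distrib_left sum.distrib sum_distrib_left sum_distrib_right
             intro!: arg_cong2[of _ _ _ _ "(+)"] sum.cong)
  then show ?case
    unfolding Ck_on.simps(2)
    using Ck_on_add[OF Suc.IH[OF fg(1) E(2)[rule_format]] Suc.IH[OF D(2)[rule_format] fg(2)]]
    by (intro exI[of _ "\<lambda>b x. f x * E b x + D b x * g x"]) auto
qed

lemma Ck_on_cmult: "Ck_on k UNIV f \<Longrightarrow> Ck_on k UNIV (\<lambda>x. c * f x)"
  by (intro Ck_on_mult Ck_on_const)

lemma Ck_on_diff:
  "Ck_on k UNIV f \<Longrightarrow> Ck_on k UNIV g \<Longrightarrow> Ck_on k UNIV (\<lambda>x. f x - g x)"
  using Ck_on_add[OF _ Ck_on_cmult[of k g "-1"]] by simp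

lemma Ck_on_prod:
  "finite A \<Longrightarrow> (\<And>i. i \<in> A \<Longrightarrow> Ck_on k UNIV (f i)) \<Longrightarrow> Ck_on k UNIV (\<lambda>x. \<Prod>i\<in>A. f i x)"
  by (induction A rule: finite_induct) (auto intro: Ck_on_const Ck_on_mult)

text \<open>
  For \<open>n = 0\<close> this is the classical function \<open>exp (- 1 / x)\<close>, extended by zero. The powers of
  \<open>1 / x\<close> are there because the derivative of \<open>flat n\<close> is a linear combination of \<open>flat (n + 1)\<close> and
  \<open>flat (n + 2)\<close>: the family is closed under differentiation.
\<close>

definition flat :: "nat \<Rightarrow> real \<Rightarrow> real" where
  "flat n x = (if x \<le> 0 then 0 else (1 / x) ^ n * exp (- (1 / x)))"

lemma flat_tendsto_0: "(flat n \<longlongrightarrow> 0) (at_right 0)"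
proof -
  have "(((\<lambda>y::real. y ^ n / exp y) \<circ> (\<lambda>x. 1 / x)) \<longlongrightarrow> 0) (at_right 0)"
    unfolding o_def
    by (rule filterlim_compose[OF tendsto_power_div_exp_0])
       (simp add: filterlim_inverse_at_top_right flip: inverse_eq_divide)
  moreover have "\<forall>\<^sub>F x in at_right 0. ((\<lambda>y::real. y ^ n / exp y) \<circ> (\<lambda>x. 1 / x)) x = flat n x"
    by (rule eventually_at_rightI[of 0 1]) (auto simp: flat_def exp_minus field_simps)
  ultimately show ?thesis by (rule Lim_transform_eventually)
qed

lemma flat_deriv:
  "(flat n has_real_derivative (flat (n + 2) x - real n * flat (n + 1) x)) (at x)"
proof -
  consider "x < 0" | "x = 0" | "x > 0" by linarith
  then show ?thesis
  proof cases
    case 1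
    have "((\<lambda>x. 0) has_real_derivative 0) (at x)" by simp
    then have "(flat n has_real_derivative 0) (at x)"
      by (rule has_field_derivative_transform_within[where d = "- x"])
         (use 1 in \<open>auto simp: flat_def dist_real_def\<close>)
    then show ?thesis using 1 by (simp add: flat_def)
  next
    case 2
    have "((\<lambda>h. (flat n (0 + h) - flat n 0) / h) \<longlongrightarrow> 0) (at 0)"
    proof (rule filterlim_split_at)
      have "\<forall>\<^sub>F h in at_left 0. (flat n (0 + h) - flat n 0) / h = 0"
        by (rule eventually_at_leftI[of "-1"]) (auto simp: flat_def)
      then show "((\<lambda>h. (flat n (0 + h) - flat n 0) / h) \<longlongrightarrow> 0) (at_left 0)"
        by (rule tendsto_eventually)
    next
      have "\<forall>\<^sub>F h in at_right 0. flat (n + 1) h = (flat n (0 + h) - flat n 0) / h"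
        by (rule eventually_at_rightI[of 0 1]) (auto simp: flat_def)
      then show "((\<lambda>h. (flat n (0 + h) - flat n 0) / h) \<longlongrightarrow> 0) (at_right 0)"
        using flat_tendsto_0 by (rule Lim_transform_eventually[rotated])
    qed
    then show ?thesis using 2 by (simp add: DERIV_def flat_def)
  next
    case 3
    have pow: "((\<lambda>x. (1 / x) ^ n) has_real_derivative - real n * (1 / x) ^ (n + 1)) (at x)"
    proof -
      have "((\<lambda>x. 1 / x) has_real_derivative - ((1 / x) ^ 2)) (at x)"
        using 3 by (auto intro!: derivative_eq_intros simp: power2_eq_square)
      from DERIV_power[OF this, of n] show ?thesis
        by (rule DERIV_cong) (cases n, simp_all add: power2_eq_square algebra_simps
          add_divide_distrib diff_divide_distrib)
    qed
    have ex: "((\<lambda>x. exp (- (1 / x))) has_real_derivative exp (- (1 / x)) * (1 / x) ^ 2) (at x)"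
      using 3 by (auto intro!: derivative_eq_intros simp: power2_eq_square)
    have "((\<lambda>x. (1 / x) ^ n * exp (- (1 / x))) has_real_derivative
        (flat (n + 2) x - real n * flat (n + 1) x)) (at x)"
      using DERIV_mult[OF pow ex] 3
      by (rule_tac DERIV_cong) (auto simp: flat_def power_add power2_eq_square algebra_simps)
    then show ?thesis
      by (rule has_field_derivative_transform_within[where d = x])
         (use 3 in \<open>auto simp: flat_def dist_real_def\<close>)
  qed
qed

lemma flat_continuous: "continuous_on S (flat n)"
  using flat_deriv by (auto simp: continuous_on_eq_continuous_at intro!: continuous_at_imp_continuous_on DERIV_isCont)

text \<open>
  The induction on the order of differentiability runs over all members of the family at once, as
  each derivative raises the index.
\<close>

lemma Ck_on_flat:
  assumes "\<And>k. Ck_on k UNIV f"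
  shows "Ck_on k UNIV (\<lambda>x. flat n (f x))"
proof (induction k arbitrary: n)
  case 0
  show ?case
    using assms[of 0] flat_continuous by (auto intro: continuous_on_compose2[of UNIV "flat n"])
next
  case (Suc k)
  obtain D where
    D: "\<forall>x. (f has_derivative (\<lambda>h. \<Sum>b\<in>Basis. (h \<bullet> b) * D b x)) (at x)"
       "\<forall>b\<in>Basis. Ck_on k UNIV (D b)"
    using assms[of "Suc k"] unfolding Ck_on.simps(2) by auto
  let ?g = "\<lambda>x. flat (n + 2) (f x) - real n * flat (n + 1) (f x)"
  have "((\<lambda>x. flat n (f x)) has_derivative (\<lambda>h. \<Sum>b\<in>Basis. (h \<bullet> b) * (?g x * D b x))) (at x)"
    for x
    using DERIV_compose_FDERIV[OF flat_deriv D(1)[rule_format, of x], of n]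
    by (rule has_derivative_eq_rhs) (auto simp: fun_eq_iff sum_distrib_left sum_distrib_right mult_ac)
  moreover have "Ck_on k UNIV ?g"
    by (intro Ck_on_diff Ck_on_cmult Suc.IH)
  ultimately show ?case
    unfolding Ck_on.simps(2) using D(2)
    by (intro exI[of _ "\<lambda>b x. ?g x * D b x"]) (auto intro!: Ck_on_mult)
qed

lemma flat_nonneg: "0 \<le> flat n x"
  by (simp add: flat_def)

lemma flat_0_le_1: "flat 0 x \<le> 1"
  by (simp add: flat_def)

text \<open>
  \<open>flat 2\<close> is the derivative of \<open>flat 0\<close>. With \<open>y = 1 / x\<close> the claim is \<open>y\<^sup>2 \<le> 2 exp y\<close>, the second
  Taylor term.
\<close>

lemma flat_2_le: "flat 2 x \<le> 2"
proof (cases "x \<le> 0")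
  case False
  define y where "y = 1 / x"
  have "1 + y + y\<^sup>2 / 2 \<le> exp y"
    by (rule exp_lower_Taylor_quadratic) (use False in \<open>simp add: y_def\<close>)
  then have "y\<^sup>2 \<le> 2 * exp y"
    using False zero_le_divide_1_iff[of x] unfolding y_def[symmetric] by linarith
  then have "y\<^sup>2 * exp (- y) \<le> 2" by (simp add: exp_minus field_simps)
  then show ?thesis using False by (simp add: flat_def y_def)
qed (simp add: flat_def)

text \<open>
  Smooth, bounded and increasing approximations of the Heaviside function. They serve twice: to
  build test functions that approximate indicators, and to truncate at the levels of a Sobolev
  function.
\<close>

lemma flat_0_scaled_tendsto:
  "(\<lambda>m. flat 0 (real m * y)) \<longlonglongrightarrow> (if y > 0 then 1 else 0)"
proof (cases "y > 0")
  case True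
  have "(\<lambda>m. exp (- (1 / (real m * y)))) \<longlonglongrightarrow> exp (- 0)"
    using True
    by (intro tendsto_exp tendsto_minus tendsto_divide_0[OF tendsto_const]
        filterlim_at_top_imp_at_infinity
        filterlim_at_top_mult_tendsto_pos[OF tendsto_const True filterlim_real_sequentially])
  moreover have "\<forall>\<^sub>F m in sequentially. exp (- (1 / (real m * y))) = flat 0 (real m * y)"
    using eventually_gt_at_top[of 0] by eventually_elim (use True in \<open>auto simp: flat_def mult_le_0_iff\<close>)
  ultimately have "(\<lambda>m. flat 0 (real m * y)) \<longlonglongrightarrow> exp (- 0)"
    by (rule Lim_transform_eventually)
  then show ?thesis using True by simp
next
  case False
  then have "flat 0 (real m * y) = 0" for m
    by (simp add: flat_def mult_le_0_iff)
  then show ?thesis using False by simp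
qed

section \<open>The Hilbert space of square integrable functions\<close>

locale bounded_open =
  fixes \<Omega> :: "'a::euclidean_space set"
  assumes open_dom: "open \<Omega>" and bounded_dom: "bounded \<Omega>"
begin

abbreviation "ip \<equiv> L2_inner \<Omega>"
abbreviation "nrm \<equiv> L2_norm \<Omega>"
abbreviation "wp \<equiv> weak_partial \<Omega>"
abbreviation "opA \<equiv> op_A \<Omega>"
abbreviation "leb \<equiv> lebesgue_on \<Omega>"

lemma meas_dom [measurable, simp]: "\<Omega> \<in> sets lebesgue"
  using open_dom by (simp add: borel_open)

lemma lmeas_dom: "\<Omega> \<in> lmeasurable"
  using bounded_dom by (simp add: bounded_set_imp_lmeasurable)

lemma finite_measure_dom: "finite_measure (leb)"
  using lmeas_dom by (rule finite_measure_lebesgue_on)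

lemma integrable_const_dom: "integrable (leb) (\<lambda>x. c::real)"
  using finite_measure_dom finite_measure.integrable_const by blast

lemma L2_measurable: "f \<in> L2 \<Omega> \<Longrightarrow> f \<in> borel_measurable (leb)"
  by (simp add: L2_def)

lemma L2_square: "f \<in> L2 \<Omega> \<Longrightarrow> integrable (leb) (\<lambda>x. (f x)\<^sup>2)"
  by (simp add: L2_def)

lemma L2_mult_integrable:
  assumes "f \<in> L2 \<Omega>" "g \<in> L2 \<Omega>"
  shows "integrable (leb) (\<lambda>x. f x * g x)"
proof (rule Bochner_Integration.integrable_bound)
  show "integrable (leb) (\<lambda>x. (f x)\<^sup>2 + (g x)\<^sup>2)"
    using assms by (intro Bochner_Integration.integrable_add L2_square)
  have "\<bar>a * b\<bar> \<le> a\<^sup>2 + b\<^sup>2" for a b :: real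
  proof -
    have "2 * (\<bar>a\<bar> * \<bar>b\<bar>) \<le> a\<^sup>2 + b\<^sup>2"
      using sum_squares_bound[of "\<bar>a\<bar>" "\<bar>b\<bar>"] by (simp add: mult.assoc)
    moreover have "0 \<le> \<bar>a\<bar> * \<bar>b\<bar>" by simp
    ultimately show ?thesis unfolding abs_mult by linarith
  qed
  then show "AE x in leb. norm (f x * g x) \<le> norm ((f x)\<^sup>2 + (g x)\<^sup>2)"
    by auto
  show "(\<lambda>x. f x * g x) \<in> borel_measurable (leb)"
    using assms by (intro borel_measurable_times L2_measurable)
qed

lemma L2_of_bounded:
  assumes "f \<in> borel_measurable (leb)" "\<And>x. x \<in> \<Omega> \<Longrightarrow> \<bar>f x\<bar> \<le> B"
  shows "f \<in> L2 \<Omega>"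
proof -
  have "integrable (leb) (\<lambda>x. (f x)\<^sup>2)"
  proof (rule Bochner_Integration.integrable_bound[OF integrable_const_dom[of "B\<^sup>2"]])
    show "AE x in leb. norm ((f x)\<^sup>2) \<le> norm (B\<^sup>2)"
      using assms(2) by (auto intro!: AE_I2 simp: abs_le_square_iff[symmetric] intro: order_trans[OF _ abs_ge_self])
  qed (use assms(1) in measurable)
  then show ?thesis using assms(1) by (simp add: L2_def)
qed

lemma L2_one: "(\<lambda>x. 1) \<in> L2 \<Omega>"
  by (rule L2_of_bounded[of _ 1]) auto

lemma L2_add:
  assumes "f \<in> L2 \<Omega>" "g \<in> L2 \<Omega>" shows "(\<lambda>x. f x + g x) \<in> L2 \<Omega>"
proof -
  have "integrable (leb) (\<lambda>x. (f x)\<^sup>2 + 2 * (f x * g x) + (g x)\<^sup>2)"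
    using assms by (intro Bochner_Integration.integrable_add L2_square integrable_mult_right L2_mult_integrable)
  moreover have "(\<lambda>x. (f x)\<^sup>2 + 2 * (f x * g x) + (g x)\<^sup>2) = (\<lambda>x. (f x + g x)\<^sup>2)"
    by (simp add: power2_sum algebra_simps)
  ultimately show ?thesis
    using assms by (auto simp: L2_def)
qed

lemma L2_cmult:
  assumes "f \<in> L2 \<Omega>" shows "(\<lambda>x. c * f x) \<in> L2 \<Omega>"
  using assms by (auto simp: L2_def power_mult_distrib)

lemma L2_diff:
  assumes "f \<in> L2 \<Omega>" "g \<in> L2 \<Omega>" shows "(\<lambda>x. f x - g x) \<in> L2 \<Omega>"
  using L2_add[OF assms(1) L2_cmult[OF assms(2), of "-1"]] by simp

lemma L2_uminus:
  assumes "f \<in> L2 \<Omega>" shows "(\<lambda>x. - f x) \<in> L2 \<Omega>"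
  using L2_cmult[OF assms, of "-1"] by simp

lemma L2_zero: "(\<lambda>x. 0) \<in> L2 \<Omega>"
  by (simp add: L2_def)

lemma L2_sum:
  "(\<And>i. i \<in> A \<Longrightarrow> f i \<in> L2 \<Omega>) \<Longrightarrow> (\<lambda>x. \<Sum>i\<in>A. f i x) \<in> L2 \<Omega>"
  by (induction A rule: infinite_finite_induct) (auto simp: L2_zero intro: L2_add)

lemma L2_inner_commute: "ip f g = ip g f"
  by (simp add: L2_inner_def mult.commute)

lemma L2_inner_add:
  assumes "f \<in> L2 \<Omega>" "g \<in> L2 \<Omega>" "h \<in> L2 \<Omega>"
  shows "ip (\<lambda>x. f x + g x) h = ip f h + ip g h"
  using assms by (simp add: L2_inner_def distrib_right L2_mult_integrable)

lemma L2_inner_cmult: "ip (\<lambda>x. c * f x) h = c * ip f h"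
  by (simp add: L2_inner_def mult.assoc)

lemma L2_inner_uminus: "ip (\<lambda>x. - f x) h = - ip f h"
  by (simp add: L2_inner_def)

lemma L2_inner_diff:
  assumes "f \<in> L2 \<Omega>" "g \<in> L2 \<Omega>" "h \<in> L2 \<Omega>"
  shows "ip (\<lambda>x. f x - g x) h = ip f h - ip g h"
  using assms by (simp add: L2_inner_def left_diff_distrib L2_mult_integrable)

lemma L2_inner_diff_right:
  assumes "f \<in> L2 \<Omega>" "g \<in> L2 \<Omega>" "h \<in> L2 \<Omega>"
  shows "ip h (\<lambda>x. f x - g x) = ip h f - ip h g"
  using L2_inner_diff[OF assms] by (simp add: L2_inner_commute)

lemma L2_inner_add_right:
  assumes "f \<in> L2 \<Omega>" "g \<in> L2 \<Omega>" "h \<in> L2 \<Omega>"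
  shows "ip h (\<lambda>x. f x + g x) = ip h f + ip h g"
  using L2_inner_add[OF assms] by (simp add: L2_inner_commute)

lemma L2_inner_cmult_right: "ip h (\<lambda>x. c * f x) = c * ip h f"
  using L2_inner_cmult[of c f h] by (simp add: L2_inner_commute)

lemma L2_inner_sum:
  assumes "\<And>i. i \<in> A \<Longrightarrow> f i \<in> L2 \<Omega>" "h \<in> L2 \<Omega>"
  shows "ip (\<lambda>x. \<Sum>i\<in>A. f i x) h = (\<Sum>i\<in>A. ip (f i) h)"
  unfolding L2_inner_def sum_distrib_right
  using assms by (intro Bochner_Integration.integral_sum L2_mult_integrable) auto

lemma L2_inner_cong_AE:
  assumes "AE x in leb. f x = g x" "f \<in> L2 \<Omega>" "g \<in> L2 \<Omega>" "h \<in> L2 \<Omega>"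
  shows "ip f h = ip g h"
  unfolding L2_inner_def
  using assms(1) assms(2-4)[THEN L2_measurable] by (intro integral_cong_AE) auto

lemma L2_inner_self_nonneg: "0 \<le> ip f f"
  by (simp add: L2_inner_def)

lemma L2_norm_eq: "nrm f = sqrt (ip f f)"
  by (simp add: L2_norm_def L2_inner_def power2_eq_square)

lemma L2_norm_sq: "(nrm f)\<^sup>2 = ip f f"
  by (simp add: L2_norm_eq L2_inner_self_nonneg)

lemma L2_norm_nonneg [simp]: "0 \<le> nrm f"
  by (simp add: L2_norm_eq L2_inner_self_nonneg)

lemma L2_norm_cong_AE:
  assumes "AE x in leb. f x = g x" "f \<in> L2 \<Omega>" "g \<in> L2 \<Omega>"
  shows "nrm f = nrm g"
  using L2_inner_cong_AE[OF assms(1-3,2)] L2_inner_cong_AE[OF assms(1-3,3)]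
  by (simp add: L2_norm_eq L2_inner_commute)

lemma L2_Cauchy_Schwarz_sq:
  assumes "f \<in> L2 \<Omega>" "g \<in> L2 \<Omega>"
  shows "(ip f g)\<^sup>2 \<le> ip f f * ip g g"
proof -
  let ?a = "ip f g" and ?b = "ip g g" and ?c = "ip f f"
  have q: "0 \<le> ?c - 2 * t * ?a + t\<^sup>2 * ?b" for t
  proof -
    have tg: "(\<lambda>x. t * g x) \<in> L2 \<Omega>" by (rule L2_cmult[OF assms(2)])
    have "0 \<le> ip (\<lambda>x. f x - t * g x) (\<lambda>x. f x - t * g x)"
      by (rule L2_inner_self_nonneg)
    also have "\<dots> = ?c - 2 * t * ?a + t\<^sup>2 * ?b"
      using assms tg L2_diff[OF assms(1) tg]
      by (simp add: L2_inner_diff L2_inner_diff_right L2_inner_cmult L2_inner_cmult_right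
          L2_inner_commute[of g f] power2_eq_square algebra_simps)
    finally show ?thesis .
  qed
  show ?thesis
  proof (cases "?b = 0")
    case True
    have "?a = 0"
    proof (rule ccontr)
      assume "?a \<noteq> 0"
      then show False using q[of "(?c + 1) / ?a"] True L2_inner_self_nonneg[of f] by simp
    qed
    then show ?thesis using True by simp
  next
    case False
    then have "?b > 0" using L2_inner_self_nonneg[of g] by simp
    then show ?thesis
      using q[of "?a / ?b"] by (simp add: power2_eq_square field_simps)
  qed
qed

lemma L2_Cauchy_Schwarz:
  assumes "f \<in> L2 \<Omega>" "g \<in> L2 \<Omega>"
  shows "\<bar>ip f g\<bar> \<le> nrm f * nrm g"
  using real_sqrt_le_mono[OF L2_Cauchy_Schwarz_sq[OF assms]]
  by (simp add: L2_norm_eq real_sqrt_mult)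

lemma L2_norm_add_sq:
  assumes "f \<in> L2 \<Omega>" "g \<in> L2 \<Omega>"
  shows "(nrm (\<lambda>x. f x + g x))\<^sup>2 = (nrm f)\<^sup>2 + 2 * ip f g + (nrm g)\<^sup>2"
  using assms L2_add[OF assms]
  by (simp add: L2_norm_sq L2_inner_add L2_inner_add_right L2_inner_commute[of g f])

lemma L2_norm_diff_sq:
  assumes "f \<in> L2 \<Omega>" "g \<in> L2 \<Omega>"
  shows "(nrm (\<lambda>x. f x - g x))\<^sup>2 = (nrm f)\<^sup>2 - 2 * ip f g + (nrm g)\<^sup>2"
  using assms L2_diff[OF assms]
  by (simp add: L2_norm_sq L2_inner_diff L2_inner_diff_right L2_inner_commute[of g f])

lemma L2_norm_triangle:
  assumes "f \<in> L2 \<Omega>" "g \<in> L2 \<Omega>"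
  shows "nrm (\<lambda>x. f x + g x) \<le> nrm f + nrm g"
proof (rule power2_le_imp_le)
  show "(nrm (\<lambda>x. f x + g x))\<^sup>2 \<le> (nrm f + nrm g)\<^sup>2"
    using L2_Cauchy_Schwarz[OF assms] by (simp add: L2_norm_add_sq[OF assms] power2_sum)
qed simp

lemma L2_norm_cmult: "nrm (\<lambda>x. c * f x) = \<bar>c\<bar> * nrm f"
  by (simp add: L2_norm_def power_mult_distrib real_sqrt_mult)

lemma L2_norm_minus_commute: "nrm (\<lambda>x. f x - g x) = nrm (\<lambda>x. g x - f x)"
  by (simp add: L2_norm_def power2_commute)

lemma L2_norm_triangle_diff:
  assumes "f \<in> L2 \<Omega>" "g \<in> L2 \<Omega>"
  shows "\<bar>nrm f - nrm g\<bar> \<le> nrm (\<lambda>x. f x - g x)"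
  using L2_norm_triangle[OF L2_diff[OF assms] assms(2)]
    L2_norm_triangle[OF L2_diff[OF assms(2,1)] assms(1)] L2_norm_minus_commute[of f g]
  by (simp add: abs_le_iff)

lemma L2_inner_tendsto:
  assumes "\<And>n. f n \<in> L2 \<Omega>" "F \<in> L2 \<Omega>" "g \<in> L2 \<Omega>"
    and "((\<lambda>n. nrm (\<lambda>x. f n x - F x)) \<longlongrightarrow> 0) Q"
  shows "((\<lambda>n. ip (f n) g) \<longlongrightarrow> ip F g) Q"
proof (rule LIM_zero_cancel, rule Lim_null_comparison)
  show "\<forall>\<^sub>F n in Q. norm (ip (f n) g - ip F g)
      \<le> nrm (\<lambda>x. f n x - F x) * nrm g"
    using L2_Cauchy_Schwarz[OF L2_diff[OF assms(1,2)] assms(3)] assms(1-3)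
    by (simp add: L2_inner_diff)
  show "((\<lambda>n. nrm (\<lambda>x. f n x - F x) * nrm g) \<longlongrightarrow> 0) Q"
    using tendsto_mult_right[OF assms(4), of "nrm g"] by simp
qed

text \<open>
  The squares of the differences converge to zero in \<open>L\<^sup>1\<close>, hence almost everywhere along a
  subsequence.
\<close>

lemma L2_norm_AE_subseq:
  assumes "\<And>n. f n \<in> L2 \<Omega>" "F \<in> L2 \<Omega>"
    and lim: "(\<lambda>n::nat. nrm (\<lambda>x. f n x - F x)) \<longlonglongrightarrow> 0"
  obtains r :: "nat \<Rightarrow> nat" where "strict_mono r" "AE x in leb. (\<lambda>n. f (r n) x) \<longlonglongrightarrow> F x"
proof -
  let ?g = "\<lambda>n x. (f n x - F x)\<^sup>2"
  have "(\<lambda>n. (nrm (\<lambda>x. f n x - F x))\<^sup>2) \<longlonglongrightarrow> 0"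
    using tendsto_power[OF lim, of 2] by simp
  then have *: "(\<lambda>n. LINT x|leb. norm (?g n x)) \<longlonglongrightarrow> 0"
    by (simp add: L2_norm_sq L2_inner_def flip: power2_eq_square)
  have "integrable (leb) (?g n)" for n
    using assms by (intro L2_square L2_diff)
  from tendsto_L1_AE_subseq[OF this *] obtain r where
    r: "strict_mono r" "AE x in leb. (\<lambda>n. ?g (r n) x) \<longlonglongrightarrow> 0" by blast
  have "AE x in leb. (\<lambda>n. f (r n) x) \<longlonglongrightarrow> F x"
    using r(2)
  proof eventually_elim
    case (elim x)
    then have "(\<lambda>n. sqrt ((f (r n) x - F x)\<^sup>2)) \<longlonglongrightarrow> sqrt 0" by (rule tendsto_real_sqrt)
    then show ?case by (simp add: tendsto_rabs_zero_iff LIM_zero_iff)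
  qed
  then show ?thesis using r(1) that by blast
qed

text \<open>
  Along a subsequence with increments of norm at most \<open>2\<^sup>-\<^sup>i\<close> the increments are summable in \<open>L\<^sup>1\<close>,
  because the domain has finite measure; hence their sum converges absolutely at almost every
  point. Fatou's lemma transfers the Cauchy estimate to the pointwise limit.
\<close>

lemma L2_complete:
  assumes f: "\<And>n. f n \<in> L2 \<Omega>"
    and cau: "\<And>e. e > 0 \<Longrightarrow> \<exists>N. \<forall>m\<ge>N. \<forall>n\<ge>N. nrm (\<lambda>x. f m x - f n x) < e"
  obtains F where "F \<in> L2 \<Omega>" "(\<lambda>n. nrm (\<lambda>x. f n x - F x)) \<longlonglongrightarrow> 0"
proof -
  have "\<exists>N. \<forall>m\<ge>N. \<forall>n\<ge>N. nrm (\<lambda>x. f m x - f n x) < (1/2)^i" for i :: nat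
    by (rule cau) simp
  then obtain N where N: "\<And>i m n. m \<ge> N i \<Longrightarrow> n \<ge> N i \<Longrightarrow> nrm (\<lambda>x. f m x - f n x) < (1/2)^i"
    by metis
  \<comment> \<open>the sum of the thresholds dominates each of them and is increasing\<close>
  define r where "r i = (\<Sum>j\<le>i. N j)" for i
  have rN: "r i \<ge> N i" "r (Suc i) \<ge> N i" for i
    by (auto simp: r_def intro: member_le_sum trans_le_add1)
  have rmono: "r i \<le> r j" if "i \<le> j" for i j
    using that unfolding r_def by (intro sum_mono2) auto
  define d where "d i x = f (r (Suc i)) x - f (r i) x" for i x
  have dL2: "d i \<in> L2 \<Omega>" for i unfolding d_def by (intro L2_diff f)
  have absL2: "(\<lambda>x. \<bar>d i x\<bar>) \<in> L2 \<Omega>" for i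
    using dL2[of i] by (auto simp: L2_def)
  have dint: "integrable (leb) (d i)" for i
    using L2_mult_integrable[OF dL2 L2_one] by simp
  have dle: "(LINT x|leb. norm (d i x)) \<le> (1/2)^i * nrm (\<lambda>x. 1)" for i
  proof -
    have "(LINT x|leb. norm (d i x)) = ip (\<lambda>x. \<bar>d i x\<bar>) (\<lambda>x. 1)"
      by (simp add: L2_inner_def)
    also have "\<dots> \<le> nrm (\<lambda>x. \<bar>d i x\<bar>) * nrm (\<lambda>x. 1)"
      using L2_Cauchy_Schwarz[OF absL2 L2_one, of i] by linarith
    also have "nrm (\<lambda>x. \<bar>d i x\<bar>) = nrm (d i)" by (simp add: L2_norm_def)
    also have "nrm (d i) \<le> (1/2)^i"
      using N[OF rN(2) rN(1), of i] by (simp add: d_def[abs_def])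
    finally show ?thesis by (simp add: mult_right_mono)
  qed
  have "AE x in leb. summable (\<lambda>i. norm (d i x))"
  proof -
    have "(\<integral>\<^sup>+x. (\<Sum>i. ennreal (norm (d i x))) \<partial>leb) = (\<Sum>i. \<integral>\<^sup>+x. ennreal (norm (d i x)) \<partial>leb)"
      using dint by (intro nn_integral_suminf) (auto dest: borel_measurable_integrable)
    also have "\<dots> = (\<Sum>i. ennreal (LINT x|leb. norm (d i x)))"
      using dint by (simp add: nn_integral_eq_integral)
    also have "\<dots> < top"
    proof -
      have s: "summable (\<lambda>i. LINT x|leb. norm (d i x))"
      proof (rule summable_comparison_test')
        show "summable (\<lambda>i. (1/2)^i * nrm (\<lambda>x. 1))"
          by (intro summable_mult2 summable_geometric) auto
        show "norm (LINT x|leb. norm (d i x)) \<le> (1/2)^i * nrm (\<lambda>x. 1)" for i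
          using dle[of i] by (simp add: abs_of_nonneg)
      qed
      show ?thesis
        using s by (subst suminf_ennreal2) auto
    qed
    finally have "AE x in leb. (\<Sum>i. ennreal (norm (d i x))) \<noteq> \<infinity>"
      using dint by (intro nn_integral_PInf_AE) (auto dest: borel_measurable_integrable)
    then show ?thesis
      by eventually_elim (auto intro: summable_suminf_not_top)
  qed
  then have conv: "AE x in leb. convergent (\<lambda>i. f (r i) x)"
  proof eventually_elim
    case (elim x)
    then have "summable (\<lambda>i. d i x)" by (rule summable_norm_cancel)
    then have "convergent (\<lambda>n. \<Sum>i<n. d i x)" by (simp add: summable_iff_convergent)
    moreover have "(\<Sum>i<n. d i x) = f (r n) x - f (r 0) x" for n
      unfolding d_def by (rule sum_lessThan_telescope)
    ultimately have "convergent (\<lambda>n. (f (r n) x - f (r 0) x) + f (r 0) x)"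
      by (intro convergent_add convergent_const) auto
    then show ?case by simp
  qed
  define F where "F x = lim (\<lambda>i. f (r i) x)" for x
  have Fm [measurable]: "F \<in> borel_measurable (leb)"
    unfolding F_def using f[THEN L2_measurable] by measurable
  have key: "(\<integral>\<^sup>+x. ennreal ((f n x - F x)\<^sup>2) \<partial>leb) \<le> ennreal (((1/2)^i)\<^sup>2)"
    if n: "n \<ge> N i" for n i
  proof -
    have "(\<integral>\<^sup>+x. ennreal ((f n x - F x)\<^sup>2) \<partial>leb)
        = (\<integral>\<^sup>+x. liminf (\<lambda>k. ennreal ((f n x - f (r k) x)\<^sup>2)) \<partial>leb)"
    proof (rule nn_integral_cong_AE)
      show "AE x in leb. ennreal ((f n x - F x)\<^sup>2) = liminf (\<lambda>k. ennreal ((f n x - f (r k) x)\<^sup>2))"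
        using conv
      proof eventually_elim
        case (elim x)
        then have "(\<lambda>k. f (r k) x) \<longlonglongrightarrow> F x" by (simp add: F_def convergent_LIMSEQ_iff)
        then have "(\<lambda>k. ennreal ((f n x - f (r k) x)\<^sup>2)) \<longlonglongrightarrow> ennreal ((f n x - F x)\<^sup>2)"
          by (intro tendsto_ennrealI tendsto_intros)
        then show ?case
          by (rule lim_imp_Liminf[OF trivial_limit_sequentially, symmetric])
      qed
    qed
    also have "\<dots> \<le> liminf (\<lambda>k. \<integral>\<^sup>+x. ennreal ((f n x - f (r k) x)\<^sup>2) \<partial>leb)"
      using f[THEN L2_measurable] by (intro nn_integral_liminf) measurable
    also have "\<dots> \<le> limsup (\<lambda>k. \<integral>\<^sup>+x. ennreal ((f n x - f (r k) x)\<^sup>2) \<partial>leb)"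
      by (rule Liminf_le_Limsup) simp
    also have "\<dots> \<le> ennreal (((1/2)^i)\<^sup>2)"
    proof (rule Limsup_bounded)
      show "\<forall>\<^sub>F k in sequentially. (\<integral>\<^sup>+x. ennreal ((f n x - f (r k) x)\<^sup>2) \<partial>leb) \<le> ennreal (((1/2)^i)\<^sup>2)"
        using eventually_ge_at_top[of i]
      proof eventually_elim
        case (elim k)
        have "(\<integral>\<^sup>+x. ennreal ((f n x - f (r k) x)\<^sup>2) \<partial>leb) = ennreal ((nrm (\<lambda>x. f n x - f (r k) x))\<^sup>2)"
          using L2_square[OF L2_diff[OF f f]]
          by (simp add: nn_integral_eq_integral L2_norm_sq L2_inner_def flip: power2_eq_square)
        also have "\<dots> \<le> ennreal (((1/2)^i)\<^sup>2)"
          using N[OF n, of "r k"] rN(1)[of i] rmono[OF elim]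
          by (intro ennreal_leI power_mono) (auto simp: less_imp_le)
        finally show ?case .
      qed
    qed
    finally show ?thesis .
  qed
  have dF: "(\<lambda>x. f n x - F x) \<in> L2 \<Omega>" if "n \<ge> N i" for n i
  proof -
    have "integrable (leb) (\<lambda>x. (f n x - F x)\<^sup>2)"
      using key[OF that] f[THEN L2_measurable, of n]
      by (intro integrableI_bounded) (auto intro: le_less_trans)
    then show ?thesis using f[THEN L2_measurable, of n] by (auto simp: L2_def)
  qed
  have F: "F \<in> L2 \<Omega>"
    using L2_diff[OF f[of "N 0"] dF[of 0 "N 0"]] by simp
  have le: "nrm (\<lambda>x. f n x - F x) \<le> (1/2)^i" if "n \<ge> N i" for n i
  proof (rule power2_le_imp_le)
    have "(\<integral>\<^sup>+x. ennreal ((f n x - F x)\<^sup>2) \<partial>leb) = ennreal ((nrm (\<lambda>x. f n x - F x))\<^sup>2)"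
      using L2_square[OF dF[OF that]]
      by (simp add: nn_integral_eq_integral L2_norm_sq L2_inner_def flip: power2_eq_square)
    then show "(nrm (\<lambda>x. f n x - F x))\<^sup>2 \<le> ((1/2)^i)\<^sup>2"
      using key[OF that] by (simp add: ennreal_le_iff)
  qed simp
  have "(\<lambda>n. nrm (\<lambda>x. f n x - F x)) \<longlonglongrightarrow> 0"
  proof (rule LIMSEQ_I)
    fix e :: real assume "e > 0"
    then obtain i where "(1/2)^i < e" using real_arch_pow_inv[of e "1/2"] by auto
    then show "\<exists>N0. \<forall>n\<ge>N0. norm (nrm (\<lambda>x. f n x - F x) - 0) < e"
      using le[of i] by (intro exI[of _ "N i"]) (auto intro: le_less_trans)
  qed
  then show ?thesis using F that by blast
qed

end

section \<open>Test functions and the fundamental lemma\<close>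

definition smooth :: "('a::euclidean_space \<Rightarrow> real) \<Rightarrow> bool" where
  "smooth f \<longleftrightarrow> (\<forall>k. Ck_on k UNIV f)"

abbreviation pd :: "('a::euclidean_space \<Rightarrow> real) \<Rightarrow> 'a \<Rightarrow> 'a \<Rightarrow> real" where
  "pd f b x \<equiv> frechet_derivative f (at x) b"

lemma smooth_const: "smooth (\<lambda>x. c)"
  and smooth_inner: "smooth (\<lambda>x. x \<bullet> v)"
  and smooth_add: "smooth f \<Longrightarrow> smooth g \<Longrightarrow> smooth (\<lambda>x. f x + g x)"
  and smooth_diff: "smooth f \<Longrightarrow> smooth g \<Longrightarrow> smooth (\<lambda>x. f x - g x)"
  and smooth_mult: "smooth f \<Longrightarrow> smooth g \<Longrightarrow> smooth (\<lambda>x. f x * g x)"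
  and smooth_flat: "smooth f \<Longrightarrow> smooth (\<lambda>x. flat n (f x))"
  and smooth_prod: "finite A \<Longrightarrow> (\<And>i. i \<in> A \<Longrightarrow> smooth (h i)) \<Longrightarrow> smooth (\<lambda>x. \<Prod>i\<in>A. h i x)"
  unfolding smooth_def
  by (auto intro: Ck_on_const Ck_on_inner Ck_on_add Ck_on_diff Ck_on_mult Ck_on_flat Ck_on_prod)

lemmas smooth_intros = smooth_const smooth_inner smooth_add smooth_diff smooth_mult smooth_flat smooth_prod

lemma smooth_has_derivative_Ck:
  assumes "smooth f"
  shows "(f has_derivative (\<lambda>h. \<Sum>b\<in>Basis. (h \<bullet> b) * pd f b x)) (at x)"
    and "b \<in> Basis \<Longrightarrow> Ck_on k UNIV (pd f b)"
proof -
  have *: "(\<forall>x. (f has_derivative (\<lambda>h. \<Sum>b\<in>Basis. (h \<bullet> b) * pd f b x)) (at x)) \<and>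
    (\<forall>b\<in>Basis. Ck_on k UNIV (pd f b))" for k
  proof -
    obtain D where D: "\<forall>x. (f has_derivative (\<lambda>h. \<Sum>b\<in>Basis. (h \<bullet> b) * D b x)) (at x)"
        "\<forall>b\<in>Basis. Ck_on k UNIV (D b)"
      using assms[unfolded smooth_def, rule_format, of "Suc k"] unfolding Ck_on.simps(2) by auto
    have "pd f b x = D b x" if "b \<in> Basis" for b x
    proof -
      have "pd f b x = (\<Sum>c\<in>Basis. (b \<bullet> c) * D c x)"
        by (subst frechet_derivative_at[OF D(1)[rule_format, of x], symmetric]) simp
      also have "\<dots> = (\<Sum>c\<in>Basis. if c = b then D b x else 0)"
        using that by (intro sum.cong) (auto simp: inner_Basis)
      finally show ?thesis using that by simp
    qed
    then have eq: "pd f b = D b" if "b \<in> Basis" for b using that by (intro ext)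
    have "(\<lambda>h. \<Sum>b\<in>Basis. (h \<bullet> b) * pd f b x) = (\<lambda>h. \<Sum>b\<in>Basis. (h \<bullet> b) * D b x)" for x
      using eq by (intro ext sum.cong refl) (metis)
    then show ?thesis using D eq by simp
  qed
  show "(f has_derivative (\<lambda>h. \<Sum>b\<in>Basis. (h \<bullet> b) * pd f b x)) (at x)"
    using * by blast
  show "b \<in> Basis \<Longrightarrow> Ck_on k UNIV (pd f b)"
    using * by blast
qed

lemma smooth_has_derivative:
  "smooth f \<Longrightarrow> (f has_derivative frechet_derivative f (at x)) (at x)"
  using smooth_has_derivative_Ck(1) frechet_derivative_works differentiable_def by blast

lemma smooth_pd: "smooth f \<Longrightarrow> b \<in> Basis \<Longrightarrow> smooth (pd f b)"
  using smooth_has_derivative_Ck(2) unfolding smooth_def by blast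

lemma smooth_continuous: "smooth f \<Longrightarrow> continuous_on UNIV f"
  by (simp add: smooth_def flip: Ck_on.simps(1))

lemma pd_mult:
  assumes "smooth f" "smooth g"
  shows "pd (\<lambda>x. f x * g x) b x = f x * pd g b x + pd f b x * g x"
  by (subst frechet_derivative_at[OF has_derivative_mult[OF smooth_has_derivative[OF assms(1)]
          smooth_has_derivative[OF assms(2)]], symmetric]) simp

lemma pd_diff:
  assumes "smooth f" "smooth g"
  shows "pd (\<lambda>x. f x - g x) b x = pd f b x - pd g b x"
  by (subst frechet_derivative_at[OF has_derivative_diff[OF smooth_has_derivative[OF assms(1)]
          smooth_has_derivative[OF assms(2)]], symmetric]) simp

lemma pd_flat_scaled:
  assumes "smooth f"
  shows "pd (\<lambda>x. flat 0 (m * (f x - k))) b x = m * flat 2 (m * (f x - k)) * pd f b x"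
proof -
  have "((\<lambda>x. m * (f x - k)) has_derivative (\<lambda>h. m * frechet_derivative f (at x) h)) (at x)"
    using smooth_has_derivative[OF assms, of x] by (auto intro!: derivative_eq_intros)
  from DERIV_compose_FDERIV[OF flat_deriv this, of 0]
  have "((\<lambda>x. flat 0 (m * (f x - k))) has_derivative
      (\<lambda>h. m * frechet_derivative f (at x) h * flat 2 (m * (f x - k)))) (at x)"
    by (simp add: numeral_2_eq_2)
  from frechet_derivative_at[OF this, symmetric] show ?thesis by simp
qed

lemma pd_inner_Basis:
  assumes "b \<in> Basis"
  shows "pd (\<lambda>x. x \<bullet> b) b x = 1"
proof -
  have "((\<lambda>x. x \<bullet> b) has_derivative (\<lambda>h. h \<bullet> b)) (at x)" by (auto intro!: derivative_eq_intros)
  from frechet_derivative_at[OF this, symmetric] show ?thesis using assms by simp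
qed

lemma test_function_smooth: "test_function S \<psi> \<Longrightarrow> smooth \<psi>"
  by (simp add: test_function_def smooth_def)

lemma test_function_support:
  assumes "test_function S \<psi>"
  obtains K where "compact K" "K \<subseteq> S" "\<And>x. x \<notin> K \<Longrightarrow> \<psi> x = 0"
  using assms by (auto simp: test_function_def)

lemma test_functionI:
  "smooth \<psi> \<Longrightarrow> compact K \<Longrightarrow> K \<subseteq> S \<Longrightarrow> (\<And>x. x \<notin> K \<Longrightarrow> \<psi> x = 0) \<Longrightarrow> test_function S \<psi>"
  by (auto simp: test_function_def smooth_def)

lemma test_function_mult:
  assumes "test_function S \<psi>" "smooth f" shows "test_function S (\<lambda>x. \<psi> x * f x)"
proof -
  obtain K where K: "compact K" "K \<subseteq> S" "\<And>x. x \<notin> K \<Longrightarrow> \<psi> x = 0"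
    using test_function_support[OF assms(1)] by blast
  then show ?thesis
    using smooth_mult[OF test_function_smooth[OF assms(1)] assms(2)] by (intro test_functionI) auto
qed

lemma test_function_diff:
  assumes "test_function S \<psi>" "test_function S \<phi>" shows "test_function S (\<lambda>x. \<psi> x - \<phi> x)"
proof -
  obtain K where K: "compact K" "K \<subseteq> S" "\<And>x. x \<notin> K \<Longrightarrow> \<psi> x = 0"
    using test_function_support[OF assms(1)] by blast
  obtain L where L: "compact L" "L \<subseteq> S" "\<And>x. x \<notin> L \<Longrightarrow> \<phi> x = 0"
    using test_function_support[OF assms(2)] by blast
  show ?thesis
    using K L assms[THEN test_function_smooth]
    by (intro test_functionI[of _ "K \<union> L"] smooth_diff) auto
qed

lemma test_function_pd:
  assumes "test_function S \<psi>" "b \<in> Basis" shows "test_function S (pd \<psi> b)"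
proof -
  obtain K where K: "compact K" "K \<subseteq> S" "\<And>x. x \<notin> K \<Longrightarrow> \<psi> x = 0"
    using test_function_support[OF assms(1)] by blast
  have "pd \<psi> b x = 0" if "x \<notin> K" for x
  proof -
    have "frechet_derivative (\<lambda>x. 0) (at x) = frechet_derivative \<psi> (at x)"
      using K(3) that compact_imp_closed[OF K(1)]
      by (intro frechet_derivative_transform_within_open[where X = "- K"]) auto
    then show ?thesis by (simp add: fun_eq_iff)
  qed
  then show ?thesis
    using K smooth_pd[OF test_function_smooth[OF assms(1)] assms(2)] by (intro test_functionI)
qed

lemma test_function_bounded:
  assumes "test_function S \<psi>"
  obtains B where "0 \<le> B" "\<And>x. \<bar>\<psi> x\<bar> \<le> B"
proof -
  obtain K where K: "compact K" "K \<subseteq> S" "\<And>x. x \<notin> K \<Longrightarrow> \<psi> x = 0"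
    using test_function_support[OF assms(1)] by blast
  have "compact (\<psi> ` K)"
    using K(1) smooth_continuous[OF test_function_smooth[OF assms]]
    by (intro compact_continuous_image) (auto intro: continuous_on_subset)
  then obtain B where "B > 0" "\<And>x. x \<in> K \<Longrightarrow> \<bar>\<psi> x\<bar> \<le> B"
    using compact_imp_bounded bounded_pos by (metis imageI real_norm_def)
  then show ?thesis using K(3) that[of B] by (metis abs_zero less_imp_le)
qed

text \<open>
  The difference quotients of \<open>F\<close> in direction \<open>b\<close> have integral zero by translation invariance, are
  bounded by the mean value theorem and vanish outside a fixed ball; dominated convergence passes
  to the derivative.
\<close>

lemma integral_pd_eq_0_lborel:
  fixes F :: "'a::euclidean_space \<Rightarrow> real"
  assumes F: "test_function S F" and b: "b \<in> Basis"
  shows "(LINT x|lborel. pd F b x) = 0"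
proof -
  obtain K where K: "compact K" "K \<subseteq> S" "\<And>x. x \<notin> K \<Longrightarrow> F x = 0"
    using test_function_support[OF F] by blast
  obtain R where R: "\<And>x. x \<in> K \<Longrightarrow> norm x \<le> R"
    using compact_imp_bounded[OF K(1)] bounded_iff by blast
  obtain B where B: "0 \<le> B" "\<And>x. \<bar>pd F b x\<bar> \<le> B"
    using test_function_bounded[OF test_function_pd[OF F b]] by blast
  obtain B0 where B0: "0 \<le> B0" "\<And>x. \<bar>F x\<bar> \<le> B0"
    using test_function_bounded[OF F] by blast
  have cF: "continuous_on UNIV F" using smooth_continuous[OF test_function_smooth[OF F]] .
  then have [measurable]: "F \<in> borel_measurable borel" by (rule borel_measurable_continuous_onI)
  have "continuous_on UNIV (pd F b)"
    using smooth_continuous[OF test_function_smooth[OF test_function_pd[OF F b]]] .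
  then have [measurable]: "pd F b \<in> borel_measurable borel" by (rule borel_measurable_continuous_onI)
  have icball: "integrable lborel (\<lambda>x. C * indicator (cball 0 r) x :: real)" for C r
    using emeasure_bounded_finite[OF bounded_cball, of 0 r]
    by (intro integrable_mult_right integrable_real_indicator) auto
  have iF: "integrable lborel F"
    by (rule Bochner_Integration.integrable_bound[OF icball[of B0 R]])
       (use B0 K(3) R in \<open>auto simp: indicator_def intro!: AE_I2\<close>)
  define h where "h n = 1 / (real n + 1)" for n
  have h: "0 < h n" "h n \<le> 1" for n by (auto simp: h_def)
  have der: "((\<lambda>t. F (x + t *\<^sub>R b)) has_real_derivative pd F b (x + t *\<^sub>R b)) (at t)" for x t
  proof -
    have "((\<lambda>t. F (x + t *\<^sub>R b)) has_derivative (\<lambda>s. frechet_derivative F (at (x + t *\<^sub>R b)) (s *\<^sub>R b))) (at t)"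
      by (rule has_derivative_compose[OF _ smooth_has_derivative[OF test_function_smooth[OF F]], of "\<lambda>t. x + t *\<^sub>R b"])
         (auto intro!: derivative_eq_intros)
    moreover have "frechet_derivative F (at y) (s *\<^sub>R b) = s * pd F b y" for s y
      using linear_cmul[OF has_derivative_linear[OF smooth_has_derivative[OF test_function_smooth[OF F]]], of y s b]
      by simp
    ultimately show ?thesis
      unfolding has_field_derivative_def by (elim has_derivative_eq_rhs) (simp add: fun_eq_iff)
  qed
  define q where "q n x = (F (x + h n *\<^sub>R b) - F x) / h n" for n x
  have qint: "(LINT x|lborel. q n x) = 0" for n
  proof -
    have d: "distr lborel borel ((+) (h n *\<^sub>R b)) = lborel" by (rule lborel_distr_plus)
    have 1: "(LINT x|lborel. F (h n *\<^sub>R b + x)) = (LINT x|lborel. F x)"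
      by (subst (2) d[symmetric], subst integral_distr) auto
    have 2: "integrable lborel (\<lambda>x. F (h n *\<^sub>R b + x))"
      using iF by (subst (asm) d[symmetric], subst (asm) integrable_distr_eq) auto
    show ?thesis unfolding q_def using 1 2 iF by (simp add: add.commute)
  qed
  have qbd: "\<bar>q n x\<bar> \<le> B * indicator (cball 0 (R + 1)) x" for n x
  proof (cases "x \<in> cball 0 (R + 1)")
    case True
    obtain z where "F (x + h n *\<^sub>R b) - F (x + 0 *\<^sub>R b) = (h n - 0) * pd F b (x + z *\<^sub>R b)"
      using MVT2[OF h(1)[of n] der] by blast
    then have "q n x = pd F b (x + z *\<^sub>R b)" using h[of n] by (simp add: q_def)
    then show ?thesis using True B(2) by simp
  next
    case False
    have "norm x \<le> norm (x + h n *\<^sub>R b) + norm (h n *\<^sub>R b)"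
      by (metis add_diff_cancel norm_triangle_ineq4)
    then have "norm (x + h n *\<^sub>R b) > R" "norm x > R"
      using False b h[of n] by auto
    then have "F x = 0" "F (x + h n *\<^sub>R b) = 0" using K(3) R not_le by metis+
    then show ?thesis by (simp add: q_def B(1))
  qed
  have lim: "(\<lambda>n. q n x) \<longlonglongrightarrow> pd F b x" for x
  proof -
    have "((\<lambda>t. (F (x + t *\<^sub>R b) - F x) / t) \<longlongrightarrow> pd F b x) (at 0)"
      using der[of x 0] by (simp add: DERIV_def)
    moreover have "filterlim h (at 0) sequentially"
    proof -
      have "h \<longlonglongrightarrow> 0" unfolding h_def using LIMSEQ_inverse_real_of_nat by (simp add: inverse_eq_divide add.commute)
      then show ?thesis using h(1) by (simp add: filterlim_at less_imp_neq[symmetric])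
    qed
    ultimately show ?thesis
      unfolding q_def by (rule filterlim_compose)
  qed
  have "(\<lambda>n. LINT x|lborel. q n x) \<longlonglongrightarrow> (LINT x|lborel. pd F b x)"
  proof (rule integral_dominated_convergence[OF _ _ icball[of B "R + 1"]])
    show "AE x in lborel. (\<lambda>n. q n x) \<longlonglongrightarrow> pd F b x" using lim by simp
    show "AE x in lborel. norm (q n x) \<le> B * indicator (cball 0 (R + 1)) x" for n
      using qbd by simp
  qed (auto simp: q_def)
  then show ?thesis using qint LIMSEQ_unique by (simp add: LIMSEQ_const_iff)
qed

context bounded_open begin

lemma test_measurable:
  assumes "test_function \<Omega> \<psi>" shows "\<psi> \<in> borel_measurable (leb)"
  using smooth_continuous[OF test_function_smooth[OF assms]]
  by (intro continuous_imp_measurable_on_sets_lebesgue) (auto intro: continuous_on_subset)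

lemma smooth_measurable:
  assumes "smooth \<psi>" shows "\<psi> \<in> borel_measurable (leb)"
  using smooth_continuous[OF assms]
  by (intro continuous_imp_measurable_on_sets_lebesgue) (auto intro: continuous_on_subset)

lemma test_L2: assumes "test_function \<Omega> \<psi>" shows "\<psi> \<in> L2 \<Omega>"
proof -
  obtain B where "\<And>x. \<bar>\<psi> x\<bar> \<le> B" using test_function_bounded[OF assms] by blast
  then show ?thesis using test_measurable[OF assms] by (intro L2_of_bounded[of _ B])
qed

lemma test_integral_lborel:
  assumes "test_function \<Omega> \<psi>"
  shows "(LINT x|leb. \<psi> x) = (LINT x|lborel. \<psi> x)"
proof -
  obtain K where K: "compact K" "K \<subseteq> \<Omega>" "\<And>x. x \<notin> K \<Longrightarrow> \<psi> x = 0"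
    using test_function_support[OF assms] by blast
  have "(LINT x|leb. \<psi> x) = (LINT x|lebesgue. indicator \<Omega> x *\<^sub>R \<psi> x)"
    by (subst integral_restrict_space) auto
  also have "\<dots> = (LINT x|lebesgue. \<psi> x)"
    using K by (intro Bochner_Integration.integral_cong) (auto simp: indicator_def)
  also have "\<dots> = (LINT x|lborel. \<psi> x)"
    using smooth_continuous[OF test_function_smooth[OF assms]]
    by (intro integral_completion) (simp add: borel_measurable_continuous_onI)
  finally show ?thesis .
qed

lemma integral_pd_test_eq_0:
  assumes "test_function \<Omega> \<psi>" "b \<in> Basis"
  shows "(LINT x|leb. pd \<psi> b x) = 0"
  unfolding test_integral_lborel[OF test_function_pd[OF assms]]
  by (rule integral_pd_eq_0_lborel[OF assms])

lemma integration_by_parts_test: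
  assumes "test_function \<Omega> \<psi>" "smooth f" "b \<in> Basis"
  shows "(LINT x|leb. f x * pd \<psi> b x) = - (LINT x|leb. pd f b x * \<psi> x)"
proof -
  have t: "test_function \<Omega> (\<lambda>x. \<psi> x * f x)" by (rule test_function_mult[OF assms(1,2)])
  note sm = test_function_smooth[OF assms(1)]
  have i1: "integrable (leb) (\<lambda>x. pd f b x * \<psi> x)"
    using L2_mult_integrable[OF test_L2[OF test_function_mult[OF assms(1) smooth_pd[OF assms(2,3)]]] L2_one]
    by (simp add: mult.commute)
  have i2: "integrable (leb) (\<lambda>x. f x * pd \<psi> b x)"
    using L2_mult_integrable[OF test_L2[OF test_function_mult[OF test_function_pd[OF assms(1,3)] assms(2)]] L2_one]
    by (simp add: mult.commute)
  have "0 = (LINT x|leb. \<psi> x * pd f b x + pd \<psi> b x * f x)"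
    using integral_pd_test_eq_0[OF t assms(3)] pd_mult[OF sm assms(2)] by simp
  also have "\<dots> = (LINT x|leb. pd f b x * \<psi> x) + (LINT x|leb. f x * pd \<psi> b x)"
    using i1 i2 by (simp add: mult.commute)
  finally show ?thesis by simp
qed

lemma test_has_weak_partial:
  assumes "test_function \<Omega> f" "b \<in> Basis"
  shows "has_weak_partial \<Omega> b f (pd f b)"
  unfolding has_weak_partial_def
  using integration_by_parts_test[OF _ test_function_smooth[OF assms(1)] assms(2)] by blast

text \<open>
  An open set is a countable union of balls whose closures it contains. Each ball carries a radial
  bump built from \<open>flat 0\<close>; the \<open>m\<close>-th function combines the first \<open>m\<close> bumps as
  \<open>1 - \<Prod>(1 - bump)\<close>, which keeps values in the unit interval and the support compact.
\<close>

lemma open_indicator_approx: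
  assumes "open U" "U \<subseteq> \<Omega>"
  obtains \<psi> :: "nat \<Rightarrow> 'a \<Rightarrow> real" where "\<And>m. test_function \<Omega> (\<psi> m)"
    "\<And>m x. \<bar>\<psi> m x\<bar> \<le> 1" "\<And>x. (\<lambda>m. \<psi> m x) \<longlonglongrightarrow> indicator U x"
proof (cases "U = {}")
  case True
  have "test_function \<Omega> (\<lambda>x. 0)"
    by (rule test_functionI[of _ "{}"]) (auto intro: smooth_const)
  then show ?thesis using that[of "\<lambda>_ _. 0"] True by simp
next
  case False
  define \<F> where "\<F> = {ball z r | z r. r > 0 \<and> cball z r \<subseteq> U}"
  have U: "\<Union>\<F> = U"
  proof
    show "\<Union>\<F> \<subseteq> U" unfolding \<F>_def using ball_subset_cball by blast
    show "U \<subseteq> \<Union>\<F>"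
    proof
      fix x assume "x \<in> U"
      then obtain r where "r > 0" "cball x r \<subseteq> U" using assms(1) open_contains_cball by blast
      then show "x \<in> \<Union>\<F>" unfolding \<F>_def by (auto intro!: exI[of _ "ball x r"] exI[of _ x])
    qed
  qed
  obtain \<G> where G: "\<G> \<subseteq> \<F>" "countable \<G>" "\<Union>\<G> = \<Union>\<F>"
  proof (rule Lindelof[of \<F>])
    show "open S" if "S \<in> \<F>" for S using that by (auto simp: \<F>_def)
  qed blast
  have "\<G> \<noteq> {}" using G(3) U False by auto
  define \<B> where "\<B> = from_nat_into \<G>"
  have "\<B> i \<in> \<G>" for i unfolding \<B>_def using \<open>\<G> \<noteq> {}\<close> by (rule from_nat_into)
  then have "\<exists>z r. \<B> i = ball z r \<and> r > 0 \<and> cball z r \<subseteq> U" for i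
    using G(1) unfolding \<F>_def by blast
  then obtain z r where zr: "\<And>i. \<B> i = ball (z i) (r i)" "\<And>i. r i > 0" "\<And>i. cball (z i) (r i) \<subseteq> U"
    by metis
  have UB: "U = (\<Union>i. ball (z i) (r i))"
  proof -
    have "range \<B> = \<G>" unfolding \<B>_def using \<open>\<G> \<noteq> {}\<close> G(2) by (rule range_from_nat_into)
    then have "U = \<Union>(range \<B>)" using G(3) U by simp
    then show ?thesis by (simp add: zr(1))
  qed
  define \<beta> where "\<beta> i m x = flat 0 (real m * ((r i)\<^sup>2 - (x - z i) \<bullet> (x - z i)))" for i m x
  have sm\<beta>: "smooth (\<beta> i m)" for i m
  proof -
    have "Ck_on k UNIV (\<lambda>x. \<Sum>b\<in>A. (x \<bullet> b - z i \<bullet> b) * (x \<bullet> b - z i \<bullet> b))" if "finite A" for k and A :: "'a set"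
      using that by (induction A rule: finite_induct)
        (auto intro!: Ck_on_const Ck_on_add Ck_on_mult Ck_on_diff Ck_on_inner)
    moreover have "(\<lambda>x. (x - z i) \<bullet> (x - z i)) = (\<lambda>x. \<Sum>b\<in>Basis. (x \<bullet> b - z i \<bullet> b) * (x \<bullet> b - z i \<bullet> b))"
      by (rule ext, subst euclidean_inner) (simp add: inner_diff_left)
    ultimately have "smooth (\<lambda>x. (x - z i) \<bullet> (x - z i))"
      by (simp add: smooth_def)
    then show ?thesis unfolding \<beta>_def by (intro smooth_intros)
  qed
  have in_ball: "(x - z i) \<bullet> (x - z i) < (r i)\<^sup>2 \<longleftrightarrow> x \<in> ball (z i) (r i)" for x i
    unfolding power2_norm_eq_inner[symmetric] mem_ball dist_norm norm_minus_commute[of "z i"]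
    using zr(2)[of i] by (intro iffI power_strict_mono) (auto intro: power2_less_imp_less)
  have \<beta>0: "\<beta> i m x = 0" if "x \<notin> ball (z i) (r i)" for i m x
  proof -
    have "real m * ((r i)\<^sup>2 - (x - z i) \<bullet> (x - z i)) \<le> 0"
      using that in_ball[of x i] by (intro mult_nonneg_nonpos) auto
    then show ?thesis by (simp add: \<beta>_def flat_def)
  qed
  have \<beta>1: "0 \<le> \<beta> i m x" "\<beta> i m x \<le> 1" for i m x by (auto simp: \<beta>_def flat_nonneg flat_0_le_1)
  define \<psi> where "\<psi> m x = 1 - (\<Prod>i<m. 1 - \<beta> i m x)" for m x
  have "test_function \<Omega> (\<psi> m)" for m
  proof (rule test_functionI[of _ "\<Union>i<m. cball (z i) (r i)"])
    show "smooth (\<psi> m)" unfolding \<psi>_def by (intro smooth_diff smooth_const smooth_prod sm\<beta>) auto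
    show "(\<Union>i<m. cball (z i) (r i)) \<subseteq> \<Omega>" using zr(3) assms(2) by blast
    show "\<psi> m x = 0" if "x \<notin> (\<Union>i<m. cball (z i) (r i))" for x
    proof -
      have "\<beta> i m x = 0" if "i < m" for i
        using \<open>x \<notin> (\<Union>i<m. cball (z i) (r i))\<close> that by (intro \<beta>0) force
      then show ?thesis by (simp add: \<psi>_def)
    qed
  qed (auto intro!: compact_UN)
  moreover have P: "0 \<le> (\<Prod>i<m. 1 - \<beta> i m x)" "(\<Prod>i<m. 1 - \<beta> i m x) \<le> 1" for m x
    using \<beta>1 by (auto intro!: prod_nonneg prod_le_1)
  then have "\<bar>\<psi> m x\<bar> \<le> 1" for m x using P[of m x] by (auto simp: \<psi>_def)
  moreover have "(\<lambda>m. \<psi> m x) \<longlonglongrightarrow> indicator U x" for x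
  proof (cases "x \<in> U")
    case True
    then obtain j where j: "x \<in> ball (z j) (r j)" using UB by blast
    have "(\<lambda>m. 1 - \<beta> j m x) \<longlonglongrightarrow> 1 - 1"
      using flat_0_scaled_tendsto[of "(r j)\<^sup>2 - (x - z j) \<bullet> (x - z j)"] in_ball[of x j] j
      unfolding \<beta>_def by (intro tendsto_diff tendsto_const) simp
    then have "(\<lambda>m. 1 - \<beta> j m x) \<longlonglongrightarrow> 0" by simp
    then have "(\<lambda>m. \<Prod>i<m. 1 - \<beta> i m x) \<longlonglongrightarrow> 0"
    proof (rule Lim_null_comparison[rotated])
      show "\<forall>\<^sub>F m in sequentially. norm (\<Prod>i<m. 1 - \<beta> i m x) \<le> 1 - \<beta> j m x"
        using eventually_gt_at_top[of j]
      proof eventually_elim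
        case (elim m)
        have "(\<Prod>i<m. 1 - \<beta> i m x) = (1 - \<beta> j m x) * (\<Prod>i\<in>{..<m} - {j}. 1 - \<beta> i m x)"
          using elim by (intro prod.remove) auto
        also have "\<dots> \<le> (1 - \<beta> j m x) * 1"
          using \<beta>1 by (intro mult_left_mono prod_le_1) auto
        finally show ?case using P(1)[of m x] by simp
      qed
    qed
    then have "(\<lambda>m. \<psi> m x) \<longlonglongrightarrow> 1 - 0" unfolding \<psi>_def by (intro tendsto_diff tendsto_const)
    then show ?thesis using True by simp
  next
    case False
    then have "\<psi> m x = 0" for m
      using UB \<beta>0 unfolding \<psi>_def by (auto intro!: prod.neutral)
    then show ?thesis using False by simp
  qed
  ultimately show ?thesis using that by blast
qed

text \<open>
  By approximation of indicators, \<open>h\<close> integrates to zero over every open subset. The set where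
  \<open>h > 0\<close> is contained in an open set exceeding it by arbitrarily small measure, and by
  Cauchy--Schwarz the excess contributes arbitrarily little; so the integral of \<open>h\<close> over that set
  vanishes.
\<close>

lemma fundamental_lemma_nonpos:
  assumes h: "h \<in> L2 \<Omega>" and ortho: "\<And>\<psi>. test_function \<Omega> \<psi> \<Longrightarrow> ip h \<psi> = 0"
  shows "AE x in leb. h x \<le> 0"
proof -
  let ?M = "leb"
  note [measurable] = L2_measurable[OF h]
  have hint: "integrable ?M h" using L2_mult_integrable[OF h L2_one] by simp
  have open0: "(LINT x|?M. h x * indicator U x) = 0" if "open U" "U \<subseteq> \<Omega>" for U
  proof -
    obtain \<psi> :: "nat \<Rightarrow> 'a \<Rightarrow> real" where \<psi>: "\<And>m. test_function \<Omega> (\<psi> m)"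
        "\<And>m x. \<bar>\<psi> m x\<bar> \<le> 1" "\<And>x. (\<lambda>m. \<psi> m x) \<longlonglongrightarrow> indicator U x"
      using open_indicator_approx[OF \<open>open U\<close> \<open>U \<subseteq> \<Omega>\<close>] by blast
    have Us: "U \<in> sets ?M" using that by (auto simp: sets_restrict_space_iff borel_open)
    have "(\<lambda>m. LINT x|?M. h x * \<psi> m x) \<longlonglongrightarrow> (LINT x|?M. h x * indicator U x)"
    proof (rule integral_dominated_convergence[OF _ _ integrable_norm[OF hint]])
      show "AE x in ?M. (\<lambda>m. h x * \<psi> m x) \<longlonglongrightarrow> h x * indicator U x"
        using \<psi>(3) by (intro AE_I2 tendsto_mult tendsto_const)
      show "AE x in ?M. norm (h x * \<psi> m x) \<le> norm (h x)" for m
        using \<psi>(2) by (intro AE_I2) (simp add: abs_mult mult_left_le)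
    qed (use \<psi>(1)[THEN test_measurable] Us in auto)
    moreover have "(LINT x|?M. h x * \<psi> m x) = 0" for m
      using ortho[OF \<psi>(1)] by (simp add: L2_inner_def)
    ultimately show ?thesis using LIMSEQ_unique by (simp add: LIMSEQ_const_iff)
  qed
  define A where "A = {x \<in> \<Omega>. h x > 0}"
  have A: "A \<in> sets ?M" unfolding A_def using L2_measurable[OF h] borel_measurable_less[of "\<lambda>_. 0" ?M h] by simp
  then have A': "A \<in> sets lebesgue" by (simp add: sets_restrict_space_iff)
  have le: "(LINT x|?M. h x * indicator A x) \<le> nrm h * sqrt e" if "e > 0" for e
  proof -
    obtain T where T: "open T" "A \<subseteq> T" "T - A \<in> lmeasurable" "emeasure lebesgue (T - A) < ennreal e"
      using sets_lebesgue_outer_open[OF A' \<open>e > 0\<close>] by blast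
    let ?U = "T \<inter> \<Omega>" let ?D = "T \<inter> \<Omega> - A"
    have U: "open ?U" "?U \<subseteq> \<Omega>" using T(1) open_dom by auto
    have Us: "?U \<in> sets ?M" using U by (auto simp: sets_restrict_space_iff borel_open)
    have Ds: "?D \<in> sets ?M" using Us A by blast
    have iD: "(\<lambda>x. indicator ?D x :: real) \<in> L2 \<Omega>"
      using Ds by (intro L2_of_bounded[of _ 1] borel_measurable_indicator) (auto simp: indicator_def)
    have "(LINT x|?M. h x * indicator ?U x) = (LINT x|?M. h x * indicator A x + h x * indicator ?D x)"
      using T(2) by (intro Bochner_Integration.integral_cong) (auto simp: indicator_def A_def)
    also have "\<dots> = (LINT x|?M. h x * indicator A x) + ip h (indicator ?D)"
      unfolding L2_inner_def using hint A Ds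
      by (intro Bochner_Integration.integral_add integrable_real_mult_indicator) auto
    finally have "(LINT x|?M. h x * indicator A x) = - ip h (indicator ?D)"
      using open0[OF U] by simp
    also have "\<dots> \<le> nrm h * nrm (indicator ?D)"
      using L2_Cauchy_Schwarz[OF h iD] by linarith
    also have "nrm (indicator ?D) \<le> sqrt e"
    proof -
      have "(LINT x|?M. (indicator ?D x)\<^sup>2) = (LINT x|?M. indicator ?D x :: real)"
        by (intro Bochner_Integration.integral_cong) (auto simp: indicator_def)
      also have "\<dots> = measure ?M ?D"
        using Ds by (simp add: Int_absorb2 sets.sets_into_space[OF Ds, simplified])
      also have "\<dots> = measure lebesgue ?D"
        using Ds by (intro measure_restrict_space) auto
      also have "\<dots> \<le> measure lebesgue (T - A)"
        using T(3) Ds by (intro measure_mono_fmeasurable) (auto simp: sets_restrict_space_iff)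
      also have "\<dots> \<le> e"
        using T(3,4) \<open>e > 0\<close> by (simp add: emeasure_eq_measure2 ennreal_less_iff less_imp_le)
      finally show ?thesis by (simp add: L2_norm_def)
    qed
    finally show ?thesis by (simp add: mult_left_mono)
  qed
  have nonneg: "0 \<le> (LINT x|?M. h x * indicator A x)"
    by (intro Bochner_Integration.integral_nonneg) (auto simp: A_def indicator_def)
  have "(LINT x|?M. h x * indicator A x) = 0"
  proof -
    have "(\<lambda>n. nrm h * sqrt (inverse (real (Suc n)))) \<longlonglongrightarrow> nrm h * sqrt 0"
      by (intro tendsto_intros LIMSEQ_inverse_real_of_nat)
    then have "(LINT x|?M. h x * indicator A x) \<le> nrm h * sqrt 0"
      by (rule LIMSEQ_le_const) (auto intro!: le)
    then show ?thesis using nonneg by simp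
  qed
  moreover have "integrable ?M (\<lambda>x. h x * indicator A x)"
    using hint A by (intro integrable_real_mult_indicator) auto
  ultimately have "AE x in ?M. h x * indicator A x = 0"
    by (subst (asm) integral_nonneg_eq_0_iff_AE) (auto simp: A_def indicator_def)
  then show ?thesis
    using AE_space by eventually_elim (auto simp: A_def indicator_def split: if_splits)
qed

lemma fundamental_lemma:
  assumes h: "h \<in> L2 \<Omega>" and ortho: "\<And>\<psi>. test_function \<Omega> \<psi> \<Longrightarrow> ip h \<psi> = 0"
  shows "AE x in leb. h x = 0"
proof -
  have "AE x in leb. - h x \<le> 0"
    by (rule fundamental_lemma_nonpos[OF L2_uminus[OF h]]) (simp add: L2_inner_uminus ortho)
  moreover have "AE x in leb. h x \<le> 0"
    by (rule fundamental_lemma_nonpos[OF h ortho])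
  ultimately show ?thesis by eventually_elim simp
qed

end

section \<open>Weak derivatives, the Green formula and the Poincare inequality\<close>

context bounded_open begin

lemma has_weak_partial_iff:
  "has_weak_partial \<Omega> b f g \<longleftrightarrow>
    (\<forall>\<psi>. test_function \<Omega> \<psi> \<longrightarrow> ip f (pd \<psi> b) = - ip g \<psi>)"
  by (simp add: has_weak_partial_def L2_inner_def)

lemma has_weak_partial_unique:
  assumes "has_weak_partial \<Omega> b f g" "has_weak_partial \<Omega> b f g'" "g \<in> L2 \<Omega>" "g' \<in> L2 \<Omega>"
  shows "AE x in leb. g x = g' x"
proof -
  have "AE x in leb. g x - g' x = 0"
  proof (rule fundamental_lemma[OF L2_diff[OF assms(3,4)]])
    fix \<psi> assume "test_function \<Omega> \<psi>"
    then show "ip (\<lambda>x. g x - g' x) \<psi> = 0"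
      using assms by (simp add: L2_inner_diff test_L2 has_weak_partial_iff)
  qed
  then show ?thesis by simp
qed

lemma has_weak_partial_diff:
  assumes "has_weak_partial \<Omega> b f f'" "has_weak_partial \<Omega> b g g'" "b \<in> Basis"
    "f \<in> L2 \<Omega>" "g \<in> L2 \<Omega>" "f' \<in> L2 \<Omega>" "g' \<in> L2 \<Omega>"
  shows "has_weak_partial \<Omega> b (\<lambda>x. f x - g x) (\<lambda>x. f' x - g' x)"
  using assms by (auto simp: has_weak_partial_iff L2_inner_diff test_L2 test_function_pd)

lemma has_weak_partial_cong:
  assumes "AE x in leb. f x = g x" "f \<in> L2 \<Omega>" "g \<in> L2 \<Omega>" "b \<in> Basis"
  shows "has_weak_partial \<Omega> b f h \<longleftrightarrow> has_weak_partial \<Omega> b g h"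
  using L2_inner_cong_AE[OF assms(1-3)] assms(4)
  by (auto simp: has_weak_partial_iff test_L2 test_function_pd)

text \<open>
  The choice made by \<open>weak_partial\<close> is determined almost everywhere, so that it may be replaced by
  any weak derivative at hand.
\<close>

lemma weak_partial_spec:
  assumes "g \<in> L2 \<Omega>" "has_weak_partial \<Omega> b f g"
  shows "wp b f \<in> L2 \<Omega>" "has_weak_partial \<Omega> b f (wp b f)"
    "AE x in leb. wp b f x = g x"
proof -
  have *: "wp b f \<in> L2 \<Omega> \<and> has_weak_partial \<Omega> b f (wp b f)"
    unfolding weak_partial_def using assms by (intro someI[of "\<lambda>g. g \<in> L2 \<Omega> \<and> has_weak_partial \<Omega> b f g"]) auto
  then show "wp b f \<in> L2 \<Omega>" "has_weak_partial \<Omega> b f (wp b f)" by auto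
  then show "AE x in leb. wp b f x = g x"
    using assms has_weak_partial_unique by blast
qed

lemma H1_L2: "f \<in> H1 \<Omega> \<Longrightarrow> f \<in> L2 \<Omega>"
  by (simp add: H1_def)

lemma H1_weak_partial:
  assumes "f \<in> H1 \<Omega>" "b \<in> Basis"
  shows "wp b f \<in> L2 \<Omega>" "has_weak_partial \<Omega> b f (wp b f)"
  using assms weak_partial_spec unfolding H1_def by blast+

lemma H1_diff:
  assumes "f \<in> H1 \<Omega>" "g \<in> H1 \<Omega>" shows "(\<lambda>x. f x - g x) \<in> H1 \<Omega>"
  using assms has_weak_partial_diff[OF H1_weak_partial(2)[OF assms(1)] H1_weak_partial(2)[OF assms(2)]]
    L2_diff H1_L2 H1_weak_partial(1) unfolding H1_def by blast

lemma weak_partial_diff: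
  assumes "f \<in> H1 \<Omega>" "g \<in> H1 \<Omega>" "b \<in> Basis"
  shows "AE x in leb. wp b (\<lambda>x. f x - g x) x = wp b f x - wp b g x"
  using assms by (intro weak_partial_spec(3) L2_diff has_weak_partial_diff H1_weak_partial H1_L2)

lemma H1_cong_AE:
  assumes "f \<in> H1 \<Omega>" "g \<in> L2 \<Omega>" "AE x in leb. f x = g x"
  shows "g \<in> H1 \<Omega>"
  using assms(1,2) has_weak_partial_cong[OF assms(3) H1_L2[OF assms(1)] assms(2)]
  unfolding H1_def by blast

lemma weak_partial_cong_AE:
  assumes "f \<in> H1 \<Omega>" "g \<in> L2 \<Omega>" "AE x in leb. f x = g x" "b \<in> Basis"
  shows "AE x in leb. wp b g x = wp b f x"
  using assms has_weak_partial_cong[OF assms(3) H1_L2[OF assms(1)] assms(2)]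
  by (intro weak_partial_spec(3) H1_weak_partial) (auto intro: H1_weak_partial)

lemma test_H1: "test_function \<Omega> \<psi> \<Longrightarrow> \<psi> \<in> H1 \<Omega>"
  unfolding H1_def using test_has_weak_partial test_L2 test_function_pd by blast

lemma weak_partial_test:
  assumes "test_function \<Omega> \<psi>" "b \<in> Basis"
  shows "AE x in leb. wp b \<psi> x = pd \<psi> b x"
  using assms by (intro weak_partial_spec(3) test_has_weak_partial test_L2 test_function_pd)

lemma grad_norm_sq: "(grad_norm \<Omega> f)\<^sup>2 = (\<Sum>b\<in>Basis. ip (wp b f) (wp b f))"
  unfolding grad_norm_def L2_norm_sq by (simp add: sum_nonneg L2_inner_self_nonneg)

lemma weak_partial_le_grad_norm:
  assumes "b \<in> Basis" shows "nrm (wp b f) \<le> grad_norm \<Omega> f"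
  unfolding grad_norm_def using assms
  by (intro real_le_rsqrt member_le_sum[of b _ "\<lambda>b. (nrm (wp b f))\<^sup>2"]) auto

lemma H10_H1: "f \<in> H10 \<Omega> \<Longrightarrow> f \<in> H1 \<Omega>"
  by (simp add: H10_def)

text \<open>
  The norm in the definition of \<open>H10\<close> applies \<open>weak_partial\<close> to the difference of a test function
  and \<open>f\<close>; by uniqueness this is the classical derivative minus that of \<open>f\<close>. The lemmas
  \<open>H10_approx\<close> and \<open>H10_I\<close> restate membership in \<open>H10\<close> in these terms.
\<close>

lemma H1_diff_test_partial_norm:
  assumes "f \<in> H1 \<Omega>" "test_function \<Omega> \<psi>" "b \<in> Basis"
  shows "nrm (wp b (\<lambda>x. \<psi> x - f x)) = nrm (\<lambda>x. pd \<psi> b x - wp b f x)"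
proof (rule L2_norm_cong_AE)
  show "AE x in leb. wp b (\<lambda>x. \<psi> x - f x) x = pd \<psi> b x - wp b f x"
    using weak_partial_diff[OF test_H1[OF assms(2)] assms(1,3)] weak_partial_test[OF assms(2,3)]
    by eventually_elim simp
qed (intro L2_diff test_L2 test_function_pd H1_weak_partial(1) H1_diff test_H1 assms)+

lemma H10_approx:
  assumes "f \<in> H10 \<Omega>"
  obtains \<psi> :: "nat \<Rightarrow> 'a \<Rightarrow> real" where "\<And>n. test_function \<Omega> (\<psi> n)"
    "(\<lambda>n. nrm (\<lambda>x. \<psi> n x - f x)) \<longlonglongrightarrow> 0"
    "\<And>b. b \<in> Basis \<Longrightarrow> (\<lambda>n. nrm (\<lambda>x. pd (\<psi> n) b x - wp b f x)) \<longlonglongrightarrow> 0"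
proof -
  obtain \<psi> :: "nat \<Rightarrow> 'a \<Rightarrow> real" where \<psi>: "\<And>n. test_function \<Omega> (\<psi> n)"
      "(\<lambda>n. H1_norm \<Omega> (\<lambda>x. \<psi> n x - f x)) \<longlonglongrightarrow> 0"
    using assms unfolding H10_def by blast
  have "(\<lambda>n. nrm (\<lambda>x. \<psi> n x - f x)) \<longlonglongrightarrow> 0"
    by (rule Lim_null_comparison[OF _ \<psi>(2)]) (auto simp: H1_norm_def intro!: always_eventually real_le_rsqrt)
  moreover have "(\<lambda>n. nrm (\<lambda>x. pd (\<psi> n) b x - wp b f x)) \<longlonglongrightarrow> 0" if "b \<in> Basis" for b
  proof (rule Lim_null_comparison[OF _ \<psi>(2)], intro always_eventually allI)
    fix n
    have "nrm (\<lambda>x. pd (\<psi> n) b x - wp b f x) \<le> grad_norm \<Omega> (\<lambda>x. \<psi> n x - f x)"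
      using H1_diff_test_partial_norm[OF H10_H1[OF assms] \<psi>(1) that] weak_partial_le_grad_norm[OF that] by metis
    also have "\<dots> \<le> H1_norm \<Omega> (\<lambda>x. \<psi> n x - f x)"
      unfolding H1_norm_def by (rule real_le_rsqrt) simp
    finally show "norm (nrm (\<lambda>x. pd (\<psi> n) b x - wp b f x)) \<le> H1_norm \<Omega> (\<lambda>x. \<psi> n x - f x)"
      by simp
  qed
  ultimately show ?thesis using that \<psi>(1) by blast
qed

lemma H10_I:
  assumes f: "f \<in> H1 \<Omega>" and "\<And>n. test_function \<Omega> (\<psi> n)"
    "(\<lambda>n::nat. nrm (\<lambda>x. \<psi> n x - f x)) \<longlonglongrightarrow> 0"
    "\<And>b. b \<in> Basis \<Longrightarrow> (\<lambda>n. nrm (\<lambda>x. pd (\<psi> n) b x - wp b f x)) \<longlonglongrightarrow> 0"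
  shows "f \<in> H10 \<Omega>"
proof -
  have "(\<lambda>n. H1_norm \<Omega> (\<lambda>x. \<psi> n x - f x)) \<longlonglongrightarrow> sqrt (0\<^sup>2 + (\<Sum>b\<in>(Basis::'a set). 0\<^sup>2))"
  proof -
    have "(grad_norm \<Omega> (\<lambda>x. \<psi> n x - f x))\<^sup>2 = (\<Sum>b\<in>Basis. (nrm (\<lambda>x. pd (\<psi> n) b x - wp b f x))\<^sup>2)" for n
      unfolding grad_norm_def using H1_diff_test_partial_norm[OF f assms(2)]
      by (simp add: sum_nonneg)
    then show ?thesis
      unfolding H1_norm_def
      by (simp only:) (intro tendsto_real_sqrt tendsto_add tendsto_sum tendsto_power assms(3,4))
  qed
  then show ?thesis using f assms(2) unfolding H10_def by auto
qed

lemma L2_norm_diff_diff_le: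
  assumes "a \<in> L2 \<Omega>" "b \<in> L2 \<Omega>" "c \<in> L2 \<Omega>" "d \<in> L2 \<Omega>"
  shows "nrm (\<lambda>x. (a x - b x) - (c x - d x)) \<le> nrm (\<lambda>x. a x - c x) + nrm (\<lambda>x. b x - d x)"
proof -
  have "nrm (\<lambda>x. (a x - b x) - (c x - d x)) = nrm (\<lambda>x. (a x - c x) + (d x - b x))"
    by (simp add: algebra_simps)
  also have "\<dots> \<le> nrm (\<lambda>x. a x - c x) + nrm (\<lambda>x. d x - b x)"
    using assms by (intro L2_norm_triangle L2_diff)
  finally show ?thesis using L2_norm_minus_commute[of d b] by simp
qed

lemma H10_diff:
  assumes "f \<in> H10 \<Omega>" "g \<in> H10 \<Omega>" shows "(\<lambda>x. f x - g x) \<in> H10 \<Omega>"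
proof -
  note f = H10_H1[OF assms(1)] and g = H10_H1[OF assms(2)]
  obtain \<psi> :: "nat \<Rightarrow> 'a \<Rightarrow> real" where \<psi>: "\<And>n. test_function \<Omega> (\<psi> n)"
    "(\<lambda>n. nrm (\<lambda>x. \<psi> n x - f x)) \<longlonglongrightarrow> 0"
    "\<And>b. b \<in> Basis \<Longrightarrow> (\<lambda>n. nrm (\<lambda>x. pd (\<psi> n) b x - wp b f x)) \<longlonglongrightarrow> 0"
    using H10_approx[OF assms(1)] by blast
  obtain \<phi> :: "nat \<Rightarrow> 'a \<Rightarrow> real" where \<phi>: "\<And>n. test_function \<Omega> (\<phi> n)"
    "(\<lambda>n. nrm (\<lambda>x. \<phi> n x - g x)) \<longlonglongrightarrow> 0"
    "\<And>b. b \<in> Basis \<Longrightarrow> (\<lambda>n. nrm (\<lambda>x. pd (\<phi> n) b x - wp b g x)) \<longlonglongrightarrow> 0"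
    using H10_approx[OF assms(2)] by blast
  show ?thesis
  proof (rule H10_I[OF H1_diff[OF f g], where \<psi> = "\<lambda>n x. \<psi> n x - \<phi> n x"])
    show "test_function \<Omega> (\<lambda>x. \<psi> n x - \<phi> n x)" for n by (intro test_function_diff \<psi> \<phi>)
    show "(\<lambda>n. nrm (\<lambda>x. \<psi> n x - \<phi> n x - (f x - g x))) \<longlonglongrightarrow> 0"
    proof (rule Lim_null_comparison)
      show "\<forall>\<^sub>F n in sequentially. norm (nrm (\<lambda>x. \<psi> n x - \<phi> n x - (f x - g x)))
          \<le> nrm (\<lambda>x. \<psi> n x - f x) + nrm (\<lambda>x. \<phi> n x - g x)"
        using L2_norm_diff_diff_le test_L2[OF \<psi>(1)] test_L2[OF \<phi>(1)] H1_L2 f g by auto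
      show "(\<lambda>n. nrm (\<lambda>x. \<psi> n x - f x) + nrm (\<lambda>x. \<phi> n x - g x)) \<longlonglongrightarrow> 0"
        using tendsto_add[OF \<psi>(2) \<phi>(2)] by simp
    qed
    fix b :: 'a assume b: "b \<in> Basis"
    show "(\<lambda>n. nrm (\<lambda>x. pd (\<lambda>x. \<psi> n x - \<phi> n x) b x - wp b (\<lambda>x. f x - g x) x)) \<longlonglongrightarrow> 0"
    proof (rule Lim_null_comparison)
      show "(\<lambda>n. nrm (\<lambda>x. pd (\<psi> n) b x - wp b f x) + nrm (\<lambda>x. pd (\<phi> n) b x - wp b g x)) \<longlonglongrightarrow> 0"
        using tendsto_add[OF \<psi>(3)[OF b] \<phi>(3)[OF b]] by simp
      have "nrm (\<lambda>x. pd (\<lambda>x. \<psi> n x - \<phi> n x) b x - wp b (\<lambda>x. f x - g x) x)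
          \<le> nrm (\<lambda>x. pd (\<psi> n) b x - wp b f x) + nrm (\<lambda>x. pd (\<phi> n) b x - wp b g x)" for n
      proof -
        note mem = test_L2[OF test_function_pd[OF \<psi>(1) b], of n] test_L2[OF test_function_pd[OF \<phi>(1) b], of n]
          H1_weak_partial(1)[OF f b] H1_weak_partial(1)[OF g b]
        have "nrm (\<lambda>x. pd (\<lambda>x. \<psi> n x - \<phi> n x) b x - wp b (\<lambda>x. f x - g x) x)
          = nrm (\<lambda>x. (pd (\<psi> n) b x - pd (\<phi> n) b x) - (wp b f x - wp b g x))"
        proof (rule L2_norm_cong_AE)
          show "AE x in leb. pd (\<lambda>x. \<psi> n x - \<phi> n x) b x - wp b (\<lambda>x. f x - g x) x =
              (pd (\<psi> n) b x - pd (\<phi> n) b x) - (wp b f x - wp b g x)"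
            using weak_partial_diff[OF f g b]
            by eventually_elim (simp add: pd_diff test_function_smooth[OF \<psi>(1)] test_function_smooth[OF \<phi>(1)])
          show "(\<lambda>x. pd (\<lambda>x. \<psi> n x - \<phi> n x) b x - wp b (\<lambda>x. f x - g x) x) \<in> L2 \<Omega>"
            by (intro L2_diff test_L2 test_function_pd test_function_diff \<psi> \<phi> b H1_weak_partial H1_diff f g)
        qed (intro L2_diff mem)
        also have "\<dots> \<le> nrm (\<lambda>x. pd (\<psi> n) b x - wp b f x) + nrm (\<lambda>x. pd (\<phi> n) b x - wp b g x)"
          by (rule L2_norm_diff_diff_le[OF mem])
        finally show ?thesis .
      qed
      then show "\<forall>\<^sub>F n in sequentially. norm (nrm (\<lambda>x. pd (\<lambda>x. \<psi> n x - \<phi> n x) b x - wp b (\<lambda>x. f x - g x) x))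
          \<le> nrm (\<lambda>x. pd (\<psi> n) b x - wp b f x) + nrm (\<lambda>x. pd (\<phi> n) b x - wp b g x)"
        by simp
    qed
  qed
qed

lemma H2_H1: "f \<in> H2 \<Omega> \<Longrightarrow> f \<in> H1 \<Omega>"
  and H2_partial: "f \<in> H2 \<Omega> \<Longrightarrow> b \<in> Basis \<Longrightarrow> wp b f \<in> H1 \<Omega>"
  by (auto simp: H2_def)

lemma H2_diff:
  assumes "f \<in> H2 \<Omega>" "g \<in> H2 \<Omega>" shows "(\<lambda>x. f x - g x) \<in> H2 \<Omega>"
proof -
  note h = H1_diff[OF assms[THEN H2_H1]]
  have "wp b (\<lambda>x. f x - g x) \<in> H1 \<Omega>" if b: "b \<in> Basis" for b
  proof (rule H1_cong_AE[OF H1_diff[OF H2_partial[OF assms(1) b] H2_partial[OF assms(2) b]]])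
    show "wp b (\<lambda>x. f x - g x) \<in> L2 \<Omega>" by (rule H1_weak_partial[OF h b])
    show "AE x in leb. wp b f x - wp b g x = wp b (\<lambda>x. f x - g x) x"
      using weak_partial_diff[OF assms[THEN H2_H1] b] by eventually_elim simp
  qed
  then show ?thesis using h by (simp add: H2_def)
qed

lemma dom_A_H2: "f \<in> dom_A \<Omega> \<Longrightarrow> f \<in> H2 \<Omega>"
  and dom_A_H10: "f \<in> dom_A \<Omega> \<Longrightarrow> f \<in> H10 \<Omega>"
  and dom_A_H1: "f \<in> dom_A \<Omega> \<Longrightarrow> f \<in> H1 \<Omega>"
  and dom_A_L2: "f \<in> dom_A \<Omega> \<Longrightarrow> f \<in> L2 \<Omega>"
  by (auto simp: dom_A_def H10_def H1_def)

lemma dom_A_diff: "f \<in> dom_A \<Omega> \<Longrightarrow> g \<in> dom_A \<Omega> \<Longrightarrow> (\<lambda>x. f x - g x) \<in> dom_A \<Omega>"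
  by (simp add: dom_A_def H2_diff H10_diff)

lemma laplacian_L2:
  assumes "f \<in> H2 \<Omega>" shows "laplacian \<Omega> f \<in> L2 \<Omega>"
  unfolding laplacian_def[abs_def] using assms
  by (intro L2_sum H1_weak_partial H2_partial)

lemma op_A_eq: "opA f = (\<lambda>x. - laplacian \<Omega> f x)"
  by (simp add: op_A_def fun_eq_iff)

lemma op_A_L2: "f \<in> dom_A \<Omega> \<Longrightarrow> opA f \<in> L2 \<Omega>"
  unfolding op_A_eq by (intro L2_uminus laplacian_L2 dom_A_H2)

text \<open>
  Linearity holds only almost everywhere, since each application of \<open>weak_partial\<close> chooses a
  representative; the outer derivative is applied to functions that agree up to a null set.
\<close>

lemma op_A_diff:
  assumes "f \<in> dom_A \<Omega>" "g \<in> dom_A \<Omega>"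
  shows "AE x in leb. opA (\<lambda>x. f x - g x) x = opA f x - opA g x"
proof -
  note f = dom_A_H2[OF assms(1)] and g = dom_A_H2[OF assms(2)]
  have "AE x in leb. \<forall>b\<in>Basis. wp b (wp b (\<lambda>x. f x - g x)) x =
      wp b (wp b f) x - wp b (wp b g) x"
  proof (rule AE_finite_allI)
    fix b :: 'a assume b: "b \<in> Basis"
    note h = H1_diff[OF H2_partial[OF f b] H2_partial[OF g b]]
    have "AE x in leb. wp b f x - wp b g x = wp b (\<lambda>x. f x - g x) x"
      using weak_partial_diff[OF f[THEN H2_H1] g[THEN H2_H1] b] by eventually_elim simp
    from weak_partial_cong_AE[OF h H1_weak_partial(1)[OF H1_diff[OF f[THEN H2_H1] g[THEN H2_H1]] b] this b]
      weak_partial_diff[OF H2_partial[OF f b] H2_partial[OF g b] b]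
    show "AE x in leb. wp b (wp b (\<lambda>x. f x - g x)) x =
      wp b (wp b f) x - wp b (wp b g) x"
      by eventually_elim simp
  qed simp
  then show ?thesis
    by eventually_elim (simp add: op_A_def laplacian_def sum_subtractf)
qed

lemma op_A_diff_norm:
  assumes "f \<in> dom_A \<Omega>" "g \<in> dom_A \<Omega>"
  shows "nrm (opA (\<lambda>x. f x - g x)) = nrm (\<lambda>x. opA f x - opA g x)"
  using assms by (intro L2_norm_cong_AE op_A_diff L2_diff op_A_L2 dom_A_diff)

lemma op_A_test:
  assumes "f \<in> dom_A \<Omega>" "test_function \<Omega> \<psi>"
  shows "ip (opA f) \<psi> = (\<Sum>b\<in>Basis. ip (wp b f) (pd \<psi> b))"
proof -
  have "ip (opA f) \<psi> = - (\<Sum>b\<in>Basis. ip (wp b (wp b f)) \<psi>)"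
    unfolding op_A_eq laplacian_def L2_inner_uminus using assms
    by (subst L2_inner_sum) (auto intro: H1_weak_partial H2_partial dom_A_H2 test_L2)
  also have "\<dots> = (\<Sum>b\<in>Basis. ip (wp b f) (pd \<psi> b))"
    unfolding sum_negf[symmetric] using assms H1_weak_partial(2)[OF H2_partial[OF dom_A_H2[OF assms(1)]]]
    by (intro sum.cong) (auto simp: has_weak_partial_iff)
  finally show ?thesis .
qed

text \<open>
  For test functions this is the definition of the weak derivatives of \<open>grad f\<close>, and both sides are
  continuous in the \<open>H\<^sup>1\<close> norm of \<open>g\<close>.
\<close>

lemma Green:
  assumes f: "f \<in> dom_A \<Omega>" and g: "g \<in> H10 \<Omega>"
  shows "ip (opA f) g = (\<Sum>b\<in>Basis. ip (wp b f) (wp b g))"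
proof -
  obtain \<psi> :: "nat \<Rightarrow> 'a \<Rightarrow> real" where \<psi>: "\<And>n. test_function \<Omega> (\<psi> n)"
    "(\<lambda>n. nrm (\<lambda>x. \<psi> n x - g x)) \<longlonglongrightarrow> 0"
    "\<And>b. b \<in> Basis \<Longrightarrow> (\<lambda>n. nrm (\<lambda>x. pd (\<psi> n) b x - wp b g x)) \<longlonglongrightarrow> 0"
    using H10_approx[OF g] by blast
  have "(\<lambda>n. ip (\<psi> n) (opA f)) \<longlonglongrightarrow> ip g (opA f)"
    using \<psi> by (intro L2_inner_tendsto) (auto intro: test_L2 H1_L2 H10_H1 g op_A_L2 f)
  moreover have "(\<lambda>n. ip (\<psi> n) (opA f)) \<longlonglongrightarrow> (\<Sum>b\<in>Basis. ip (wp b g) (wp b f))"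
    unfolding L2_inner_commute[of _ "opA f"] op_A_test[OF f \<psi>(1)] L2_inner_commute[of "wp _ f"]
    using \<psi> by (intro tendsto_sum L2_inner_tendsto)
      (auto intro: test_L2 test_function_pd H1_weak_partial H10_H1 g dom_A_H1 f)
  ultimately show ?thesis
    using LIMSEQ_unique by (metis (no_types, lifting) L2_inner_commute sum.cong)
qed

lemma op_A_symmetric:
  assumes "f \<in> dom_A \<Omega>" "g \<in> dom_A \<Omega>"
  shows "ip (opA f) g = ip f (opA g)"
  using Green[OF assms(1) dom_A_H10[OF assms(2)]] Green[OF assms(2) dom_A_H10[OF assms(1)]]
  by (simp add: L2_inner_commute)

lemma op_A_grad: "f \<in> dom_A \<Omega> \<Longrightarrow> ip (opA f) f = (grad_norm \<Omega> f)\<^sup>2"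
  by (simp add: Green dom_A_H10 grad_norm_sq)

lemma L2_norm_bounded_mult:
  assumes "f \<in> L2 \<Omega>" "g \<in> borel_measurable (leb)" "\<And>x. x \<in> \<Omega> \<Longrightarrow> \<bar>g x\<bar> \<le> R"
  shows "(\<lambda>x. g x * f x) \<in> L2 \<Omega>" "nrm (\<lambda>x. g x * f x) \<le> R * nrm f"
proof -
  have le: "(g x * f x)\<^sup>2 \<le> R\<^sup>2 * (f x)\<^sup>2" if "x \<in> \<Omega>" for x
    unfolding power_mult_distrib using assms(3)[OF that]
    by (intro mult_right_mono) (auto simp: abs_le_square_iff[symmetric])
  have i: "integrable (leb) (\<lambda>x. R\<^sup>2 * (f x)\<^sup>2)" using L2_square[OF assms(1)] by simp
  show m: "(\<lambda>x. g x * f x) \<in> L2 \<Omega>"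
    unfolding L2_def using assms(2) L2_measurable[OF assms(1)] le
    by (auto intro!: Bochner_Integration.integrable_bound[OF i] AE_I2)
  show "nrm (\<lambda>x. g x * f x) \<le> R * nrm f"
  proof (cases "\<Omega> = {}")
    case True
    then show ?thesis by (simp add: L2_norm_def)
  next
    case False
    then have "0 \<le> R" using assms(3) abs_ge_zero order_trans by blast
    have "(LINT x|leb. (g x * f x)\<^sup>2) \<le> (LINT x|leb. R\<^sup>2 * (f x)\<^sup>2)"
      using le i L2_square[OF m] by (intro integral_mono) auto
    then have "sqrt (LINT x|leb. (g x * f x)\<^sup>2) \<le> sqrt (R\<^sup>2 * (LINT x|leb. (f x)\<^sup>2))"
      by simp
    then show ?thesis using \<open>0 \<le> R\<close> by (simp add: L2_norm_def real_sqrt_mult)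
  qed
qed

text \<open>
  The derivative of \<open>x\<^sub>b \<psi>\<^sup>2\<close> in direction \<open>b\<close> has integral zero, which expresses the integral of
  \<open>\<psi>\<^sup>2\<close> through \<open>x\<^sub>b \<psi> \<partial>\<^sub>b\<psi>\<close>; on a bounded domain \<open>x\<^sub>b\<close> is bounded.
\<close>

lemma Poincare_test:
  assumes R: "\<And>x. x \<in> \<Omega> \<Longrightarrow> norm x \<le> R" and \<psi>: "test_function \<Omega> \<psi>" and b: "b \<in> Basis"
  shows "nrm \<psi> \<le> 2 * R * nrm (pd \<psi> b)"
proof -
  note sm = test_function_smooth[OF \<psi>]
  let ?p = "\<lambda>x. (x \<bullet> b) * pd \<psi> b x"
  have xb: "(\<lambda>x. x \<bullet> b) \<in> borel_measurable (leb)" by (intro smooth_measurable smooth_inner)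
  have xbR: "\<bar>x \<bullet> b\<bar> \<le> R" if "x \<in> \<Omega>" for x
    using R[OF that] Basis_le_norm[OF b, of x] by linarith
  note p = L2_norm_bounded_mult[OF test_L2[OF test_function_pd[OF \<psi> b]] xb xbR]
  have "0 = (LINT x|leb. pd (\<lambda>x. \<psi> x * (\<psi> x * (x \<bullet> b))) b x)"
    using integral_pd_test_eq_0[OF test_function_mult[OF \<psi> smooth_mult[OF sm smooth_inner]] b] by simp
  also have "\<dots> = (LINT x|leb. \<psi> x * \<psi> x + 2 * (\<psi> x * ?p x))"
    using sm b by (intro Bochner_Integration.integral_cong refl)
      (simp add: pd_mult smooth_mult smooth_inner pd_inner_Basis algebra_simps)
  also have "\<dots> = ip \<psi> \<psi> + 2 * ip \<psi> ?p"
    unfolding L2_inner_def using L2_mult_integrable[OF test_L2[OF \<psi>] test_L2[OF \<psi>]]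
      L2_mult_integrable[OF test_L2[OF \<psi>] p(1)] by simp
  finally have "(nrm \<psi>)\<^sup>2 \<le> 2 * (nrm \<psi> * nrm ?p)"
    using L2_Cauchy_Schwarz[OF test_L2[OF \<psi>] p(1)] by (simp add: L2_norm_sq)
  also have "\<dots> \<le> 2 * (nrm \<psi> * (R * nrm (pd \<psi> b)))"
    using p(2) by (intro mult_left_mono) auto
  finally have *: "nrm \<psi> * nrm \<psi> \<le> nrm \<psi> * (2 * R * nrm (pd \<psi> b))"
    by (simp add: power2_eq_square mult_ac)
  show ?thesis
  proof (cases "nrm \<psi> = 0")
    case True
    have "0 \<le> R * nrm (pd \<psi> b)" using p(2) L2_norm_nonneg order_trans by blast
    then show ?thesis using True by simp
  next
    case False
    then have "0 < nrm \<psi>" using L2_norm_nonneg[of \<psi>] by linarith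
    then show ?thesis using * by simp
  qed
qed

lemma Poincare:
  obtains C where "0 \<le> C" "\<And>f. f \<in> H10 \<Omega> \<Longrightarrow> nrm f \<le> C * grad_norm \<Omega> f"
proof -
  obtain R where R: "0 < R" "\<And>x. x \<in> \<Omega> \<Longrightarrow> norm x \<le> R"
    using bounded_dom unfolding bounded_pos by blast
  obtain b :: 'a where b: "b \<in> Basis" using nonempty_Basis by blast
  have "nrm f \<le> 2 * R * grad_norm \<Omega> f" if f: "f \<in> H10 \<Omega>" for f
  proof -
    obtain \<psi> :: "nat \<Rightarrow> 'a \<Rightarrow> real" where \<psi>: "\<And>n. test_function \<Omega> (\<psi> n)"
      "(\<lambda>n. nrm (\<lambda>x. \<psi> n x - f x)) \<longlonglongrightarrow> 0"
      "\<And>b. b \<in> Basis \<Longrightarrow> (\<lambda>n. nrm (\<lambda>x. pd (\<psi> n) b x - wp b f x)) \<longlonglongrightarrow> 0"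
      using H10_approx[OF f] by blast
    note fL = H1_L2[OF H10_H1[OF f]] and wL = H1_weak_partial(1)[OF H10_H1[OF f] b]
    let ?w = "wp b f"
    have "nrm f \<le> nrm (\<lambda>x. \<psi> n x - f x) + 2 * R * (nrm (\<lambda>x. pd (\<psi> n) b x - ?w x) + nrm ?w)" for n
    proof -
      have "nrm f \<le> nrm (\<lambda>x. \<psi> n x - f x) + nrm (\<psi> n)"
        using L2_norm_triangle_diff[OF test_L2[OF \<psi>(1)] fL, of n] by linarith
      also have "nrm (\<psi> n) \<le> 2 * R * nrm (pd (\<psi> n) b)"
        by (rule Poincare_test[OF R(2) \<psi>(1) b])
      also have "nrm (pd (\<psi> n) b) \<le> nrm (\<lambda>x. pd (\<psi> n) b x - ?w x) + nrm ?w"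
        using L2_norm_triangle_diff[OF test_L2[OF test_function_pd[OF \<psi>(1) b]] wL, of n] by linarith
      finally show ?thesis using R(1) by (simp add: mult_left_mono)
    qed
    moreover have "(\<lambda>n. nrm (\<lambda>x. \<psi> n x - f x) + 2 * R * (nrm (\<lambda>x. pd (\<psi> n) b x - ?w x) + nrm ?w))
        \<longlonglongrightarrow> 0 + 2 * R * (0 + nrm ?w)"
      by (intro tendsto_intros \<psi> b)
    ultimately have "nrm f \<le> 0 + 2 * R * (0 + nrm ?w)"
      by (intro LIMSEQ_le_const) auto
    also have "\<dots> \<le> 2 * R * grad_norm \<Omega> f"
      using weak_partial_le_grad_norm[OF b] R(1) by simp
    finally show ?thesis .
  qed
  then show ?thesis using R(1) that[of "2 * R"] by simp
qed

text \<open>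
  Combine Poincare with \<open>|grad f|\<^sup>2 = \<langle>A f, f\<rangle>\<close>. Its use is that continuity in \<open>D(A)\<close>, where the norm
  is \<open>|A f|\<close>, entails continuity in \<open>L\<^sup>2\<close>.
\<close>

lemma L2_norm_le_op_A:
  obtains C where "0 \<le> C" "\<And>f. f \<in> dom_A \<Omega> \<Longrightarrow> nrm f \<le> C * nrm (opA f)"
proof -
  obtain C where C: "0 \<le> C" "\<And>f. f \<in> H10 \<Omega> \<Longrightarrow> nrm f \<le> C * grad_norm \<Omega> f"
    using Poincare by blast
  have "nrm f \<le> C\<^sup>2 * nrm (opA f)" if f: "f \<in> dom_A \<Omega>" for f
  proof -
    have "(nrm f)\<^sup>2 \<le> (C * grad_norm \<Omega> f)\<^sup>2"
      using C(2)[OF dom_A_H10[OF f]] by (intro power_mono) auto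
    also have "\<dots> = C\<^sup>2 * ip (opA f) f" by (simp add: power_mult_distrib op_A_grad[OF f])
    also have "\<dots> \<le> C\<^sup>2 * (nrm (opA f) * nrm f)"
      using L2_Cauchy_Schwarz[OF op_A_L2[OF f] dom_A_L2[OF f]] by (intro mult_left_mono) auto
    finally have "nrm f * nrm f \<le> nrm f * (C\<^sup>2 * nrm (opA f))"
      by (simp add: power2_eq_square mult_ac)
    then show ?thesis
      using L2_norm_nonneg[of f] by (cases "nrm f = 0") auto
  qed
  then show ?thesis using that[of "C\<^sup>2"] by simp
qed

end

section \<open>Accretivity of the nonlinearity\<close>

context bounded_open begin

text \<open>
  Formally \<open>\<langle>A f, g(f)\<rangle> = \<integral> g'(f) |grad f|\<^sup>2\<close>, with \<open>g\<close> the increasing function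
  \<open>\<lambda>y. flat 0 (m * (y - k))\<close>. For test functions \<open>\<psi>\<^sub>n\<close> tending to \<open>f\<close> in \<open>H\<^sup>1\<close> the function \<open>g(\<psi>\<^sub>n)\<close> is
  again a test function, as \<open>g\<close> vanishes at zero, and
  \<open>\<langle>A f, g(\<psi>\<^sub>n)\<rangle> = \<integral> g'(\<psi>\<^sub>n) grad f \<bullet> grad \<psi>\<^sub>n\<close>. Replacing \<open>grad \<psi>\<^sub>n\<close> by \<open>grad f\<close> makes the integrand
  nonnegative and costs an error that tends to zero because \<open>g' \<le> 2 m\<close>.
\<close>

lemma op_A_smoothed_level_nonneg:
  assumes f: "f \<in> dom_A \<Omega>" and k: "0 \<le> k" and m: "0 \<le> m"
  shows "0 \<le> ip (opA f) (\<lambda>x. flat 0 (m * (f x - k)))"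
proof -
  let ?M = "leb" let ?w = "\<lambda>b. wp b f"
  have Af: "opA f \<in> L2 \<Omega>" by (rule op_A_L2[OF f])
  have iAf: "integrable ?M (opA f)" using L2_mult_integrable[OF Af L2_one] by simp
  obtain \<psi>' :: "nat \<Rightarrow> 'a \<Rightarrow> real" where \<psi>': "\<And>n. test_function \<Omega> (\<psi>' n)"
    "(\<lambda>n. nrm (\<lambda>x. \<psi>' n x - f x)) \<longlonglongrightarrow> 0"
    "\<And>b. b \<in> Basis \<Longrightarrow> (\<lambda>n. nrm (\<lambda>x. pd (\<psi>' n) b x - ?w b x)) \<longlonglongrightarrow> 0"
    using H10_approx[OF dom_A_H10[OF f]] by blast
  obtain r :: "nat \<Rightarrow> nat" where r: "strict_mono r" "AE x in ?M. (\<lambda>n. \<psi>' (r n) x) \<longlonglongrightarrow> f x"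
    using L2_norm_AE_subseq[OF test_L2[OF \<psi>'(1)] dom_A_L2[OF f] \<psi>'(2)] by blast
  define \<psi> where "\<psi> n = \<psi>' (r n)" for n
  have \<psi>: "test_function \<Omega> (\<psi> n)" for n unfolding \<psi>_def by (rule \<psi>')
  have \<psi>lim: "(\<lambda>n. nrm (\<lambda>x. pd (\<psi> n) b x - ?w b x)) \<longlonglongrightarrow> 0" if "b \<in> Basis" for b
    using LIMSEQ_subseq_LIMSEQ[OF \<psi>'(3)[OF that] r(1)] by (simp add: \<psi>_def o_def)
  have \<psi>ae: "AE x in ?M. (\<lambda>n. \<psi> n x) \<longlonglongrightarrow> f x" using r(2) by (simp add: \<psi>_def)
  define g where "g n x = flat 0 (m * (\<psi> n x - k))" for n x
  have g: "test_function \<Omega> (g n)" for n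
  proof -
    obtain K where K: "compact K" "K \<subseteq> \<Omega>" "\<And>x. x \<notin> K \<Longrightarrow> \<psi> n x = 0"
      using test_function_support[OF \<psi>] by blast
    show ?thesis
    proof (rule test_functionI[OF _ K(1,2)])
      show "smooth (g n)" unfolding g_def
        by (intro smooth_flat smooth_mult smooth_diff smooth_const test_function_smooth[OF \<psi>])
      show "g n x = 0" if "x \<notin> K" for x
        using K(3)[OF that] k m by (simp add: g_def flat_def mult_nonneg_nonneg)
    qed
  qed
  have [measurable]: "flat i \<in> borel_measurable borel" for i
    by (intro borel_measurable_continuous_onI flat_continuous)
  \<comment> \<open>the chain rule factor \<open>g'(\<psi>\<^sub>n)\<close>\<close>
  define c where "c n x = m * flat 2 (m * (\<psi> n x - k))" for n x
  have c: "0 \<le> c n x" "\<bar>c n x\<bar> \<le> m * 2" for n x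
    using m flat_nonneg flat_2_le by (auto simp: c_def abs_mult intro!: mult_nonneg_nonneg mult_left_mono)
  have cm: "c n \<in> borel_measurable ?M" for n
    unfolding c_def using test_measurable[OF \<psi>] by measurable
  have pdg: "pd (g n) b = (\<lambda>x. c n x * pd (\<psi> n) b x)" for n b
    unfolding g_def c_def by (intro ext pd_flat_scaled test_function_smooth[OF \<psi>])
  have lower: "- (\<Sum>b\<in>Basis. nrm (?w b) * (m * 2 * nrm (\<lambda>x. pd (\<psi> n) b x - ?w b x)))
      \<le> ip (opA f) (g n)" for n
    unfolding op_A_test[OF f g] sum_negf[symmetric]
  proof (rule sum_mono)
    fix b :: 'a assume b: "b \<in> Basis"
    have w: "?w b \<in> L2 \<Omega>" by (rule H1_weak_partial(1)[OF dom_A_H1[OF f] b])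
    have d: "(\<lambda>x. pd (\<psi> n) b x - ?w b x) \<in> L2 \<Omega>"
      by (intro L2_diff w test_L2 test_function_pd \<psi> b)
    note cd = L2_norm_bounded_mult[OF d cm c(2)] and cw = L2_norm_bounded_mult[OF w cm c(2)]
    have "ip (?w b) (pd (g n) b)
        = ip (?w b) (\<lambda>x. c n x * (pd (\<psi> n) b x - ?w b x) + c n x * ?w b x)"
      unfolding pdg by (simp add: algebra_simps)
    also have "\<dots> = ip (?w b) (\<lambda>x. c n x * (pd (\<psi> n) b x - ?w b x)) + ip (?w b) (\<lambda>x. c n x * ?w b x)"
      by (rule L2_inner_add_right[OF cd(1) cw(1) w])
    finally have eq: "ip (?w b) (pd (g n) b) = \<dots>" .
    have "0 \<le> ip (?w b) (\<lambda>x. c n x * ?w b x)"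
      unfolding L2_inner_def
    proof (rule Bochner_Integration.integral_nonneg)
      fix x have "0 \<le> c n x * (?w b x * ?w b x)" using c(1) by simp
      then show "0 \<le> ?w b x * (c n x * ?w b x)" by (simp add: mult_ac)
    qed
    moreover have "\<bar>ip (?w b) (\<lambda>x. c n x * (pd (\<psi> n) b x - ?w b x))\<bar>
        \<le> nrm (?w b) * (m * 2 * nrm (\<lambda>x. pd (\<psi> n) b x - ?w b x))"
      using L2_Cauchy_Schwarz[OF w cd(1)] cd(2) by (meson L2_norm_nonneg mult_left_mono order_trans)
    ultimately show "- (nrm (?w b) * (m * 2 * nrm (\<lambda>x. pd (\<psi> n) b x - ?w b x)))
        \<le> ip (?w b) (pd (g n) b)" using eq by linarith
  qed
  have "(\<lambda>n. - (\<Sum>b\<in>Basis. nrm (?w b) * (m * 2 * nrm (\<lambda>x. pd (\<psi> n) b x - ?w b x))))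
      \<longlonglongrightarrow> - (\<Sum>b\<in>(Basis::'a set). nrm (?w b) * (m * 2 * 0))"
    by (intro tendsto_intros \<psi>lim)
  then have l1: "(\<lambda>n. - (\<Sum>b\<in>Basis. nrm (?w b) * (m * 2 * nrm (\<lambda>x. pd (\<psi> n) b x - ?w b x)))) \<longlonglongrightarrow> 0"
    by simp
  have l2: "(\<lambda>n. ip (opA f) (g n)) \<longlonglongrightarrow> ip (opA f) (\<lambda>x. flat 0 (m * (f x - k)))"
    unfolding L2_inner_def
  proof (rule integral_dominated_convergence[OF _ _ integrable_norm[OF iAf]])
    show "AE x in ?M. (\<lambda>n. opA f x * g n x) \<longlonglongrightarrow> opA f x * flat 0 (m * (f x - k))"
      using \<psi>ae
    proof eventually_elim
      case (elim x)
      have "isCont (flat 0) (m * (f x - k))" using flat_continuous[of UNIV] by (simp add: continuous_on_eq_continuous_at)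
      then show ?case unfolding g_def
        by (intro tendsto_mult tendsto_const isCont_tendsto_compose[of _ "flat 0"] tendsto_diff elim)
    qed
    show "AE x in ?M. norm (opA f x * g n x) \<le> norm (opA f x)" for n
      using flat_nonneg flat_0_le_1 by (intro AE_I2) (simp add: g_def abs_mult mult_left_le)
    show "(\<lambda>x. opA f x * flat 0 (m * (f x - k))) \<in> borel_measurable ?M"
      using L2_measurable[OF Af] L2_measurable[OF dom_A_L2[OF f]] by measurable
    show "(\<lambda>x. opA f x * g n x) \<in> borel_measurable ?M" for n
      using L2_measurable[OF Af] test_measurable[OF g] by measurable
  qed
  show ?thesis by (rule LIMSEQ_le[OF l1 l2]) (use lower in blast)
qed

lemma op_A_level_nonneg:
  assumes f: "f \<in> dom_A \<Omega>" and k: "0 \<le> k"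
  shows "0 \<le> ip (opA f) (\<lambda>x. if f x > k then 1 else 0)"
proof -
  let ?M = "leb"
  have Af: "opA f \<in> L2 \<Omega>" by (rule op_A_L2[OF f])
  have iAf: "integrable ?M (opA f)" using L2_mult_integrable[OF Af L2_one] by simp
  have [measurable]: "flat i \<in> borel_measurable borel" for i
    by (intro borel_measurable_continuous_onI flat_continuous)
  note [measurable] = L2_measurable[OF Af] L2_measurable[OF dom_A_L2[OF f]]
  have "(\<lambda>n. ip (opA f) (\<lambda>x. flat 0 (real n * (f x - k)))) \<longlonglongrightarrow>
      ip (opA f) (\<lambda>x. if f x > k then 1 else 0)"
    unfolding L2_inner_def
  proof (rule integral_dominated_convergence[OF _ _ integrable_norm[OF iAf]])
    show "AE x in ?M. (\<lambda>n. opA f x * flat 0 (real n * (f x - k))) \<longlonglongrightarrow> opA f x * (if f x > k then 1 else 0)"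
    proof (intro AE_I2 tendsto_mult tendsto_const)
      fix x
      show "(\<lambda>n. flat 0 (real n * (f x - k))) \<longlonglongrightarrow> (if f x > k then 1 else 0)"
        using flat_0_scaled_tendsto[of "f x - k"] by simp
    qed
    show "AE x in ?M. norm (opA f x * flat 0 (real n * (f x - k))) \<le> norm (opA f x)" for n
      using flat_nonneg flat_0_le_1 by (intro AE_I2) (simp add: abs_mult mult_left_le)
  qed measurable
  then show ?thesis
    by (rule LIMSEQ_le_const) (use op_A_smoothed_level_nonneg[OF f k] in auto)
qed

lemma card_below_bounds:
  fixes y :: real
  assumes "0 \<le> y"
  shows "real (card {i\<in>{1..N}. real i < y}) \<le> y"
    and "y \<le> real N \<Longrightarrow> y - 1 \<le> real (card {i\<in>{1..N}. real i < y})"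
proof -
  have "card {i\<in>{1..N}. real i < y} \<le> card {1..nat \<lfloor>y\<rfloor>}"
    by (intro card_mono) (auto intro!: le_nat_floor)
  then have "real (card {i\<in>{1..N}. real i < y}) \<le> real (nat \<lfloor>y\<rfloor>)" by simp
  also have "\<dots> \<le> y" by (rule of_nat_floor[OF assms])
  finally show "real (card {i\<in>{1..N}. real i < y}) \<le> y" .
  assume y: "y \<le> real N"
  have "{1..nat (\<lceil>y\<rceil> - 1)} \<subseteq> {i\<in>{1..N}. real i < y}"
  proof
    fix i assume i: "i \<in> {1..nat (\<lceil>y\<rceil> - 1)}"
    then have "int i \<le> \<lceil>y\<rceil> - 1" by auto
    then have "real i < y" by linarith
    then show "i \<in> {i\<in>{1..N}. real i < y}" using i y by auto
  qed
  then have "card {1..nat (\<lceil>y\<rceil> - 1)} \<le> card {i\<in>{1..N}. real i < y}"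
    by (intro card_mono) auto
  then have "real (nat (\<lceil>y\<rceil> - 1)) \<le> real (card {i\<in>{1..N}. real i < y})" by simp
  moreover have "y - 1 \<le> real (nat (\<lceil>y\<rceil> - 1))" by linarith
  ultimately show "y - 1 \<le> real (card {i\<in>{1..N}. real i < y})" by linarith
qed

text \<open>
  Layer cake: \<open>h\<close> is the limit from below of the sums \<open>1/n \<Sum>\<^sub>i 1\<^bsub>h > i/n\<^esub>\<close> with \<open>1 \<le> i \<le> n\<^sup>2\<close>, so
  nonnegativity on superlevel sets carries over to \<open>h\<close>.
\<close>

lemma L2_inner_nonneg_of_levels:
  assumes a: "a \<in> L2 \<Omega>" and h: "h \<in> L2 \<Omega>" and h0: "\<And>x. 0 \<le> h x"
    and lev: "\<And>c. 0 < c \<Longrightarrow> 0 \<le> ip a (\<lambda>x. if h x > c then 1 else 0)"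
  shows "0 \<le> ip a h"
proof -
  let ?M = "leb"
  note [measurable] = L2_measurable[OF a] L2_measurable[OF h]
  define s where "s n x = (\<Sum>i\<in>{1..Suc n * Suc n}. (1 / real (Suc n)) * (if h x > real i / real (Suc n) then 1 else 0))" for n x
  have s_eq: "s n x = real (card {i\<in>{1..Suc n * Suc n}. real i < real (Suc n) * h x}) / real (Suc n)" for n x
  proof -
    have "s n x = (1 / real (Suc n)) * (\<Sum>i\<in>{1..Suc n * Suc n}. if real i < real (Suc n) * h x then 1 else 0)"
      unfolding s_def sum_distrib_left
      by (intro sum.cong refl arg_cong2[of _ _ _ _ "(*)"] if_cong) (auto simp: field_simps)
    also have "(\<Sum>i\<in>{1..Suc n * Suc n}. if real i < real (Suc n) * h x then 1 else 0)
        = real (card {i\<in>{1..Suc n * Suc n}. real i < real (Suc n) * h x})"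
      by (subst sum.If_cases) (auto simp: Int_def)
    finally show ?thesis by simp
  qed
  have s_le: "s n x \<le> h x" "0 \<le> s n x" for n x
  proof -
    have "0 \<le> real (Suc n) * h x" using h0 by simp
    from card_below_bounds(1)[OF this, of "Suc n * Suc n"] show "s n x \<le> h x"
      unfolding s_eq by (simp add: divide_simps mult.commute)
    show "0 \<le> s n x" unfolding s_eq by simp
  qed
  have s_lim: "(\<lambda>n. s n x) \<longlonglongrightarrow> h x" for x
  proof (rule tendsto_sandwich)
    show "\<forall>\<^sub>F n in sequentially. s n x \<le> h x" using s_le by simp
    have "\<forall>\<^sub>F n in sequentially. h x \<le> real n"
      by (meson eventually_sequentially nat_le_real_less real_arch_simple of_nat_le_iff order_trans)
    then show "\<forall>\<^sub>F n in sequentially. h x - inverse (real (Suc n)) \<le> s n x"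
    proof eventually_elim
      case (elim n)
      have "real (Suc n) * h x \<le> real (Suc n) * real (Suc n)"
        using elim by (intro mult_left_mono) auto
      then have "real (Suc n) * h x \<le> real (Suc n * Suc n)" by (simp only: of_nat_mult)
      from card_below_bounds(2)[OF _ this] h0[of x]
      have "real (Suc n) * h x - 1 \<le> real (card {i\<in>{1..Suc n * Suc n}. real i < real (Suc n) * h x})"
        by simp
      then have "(real (Suc n) * h x - 1) / real (Suc n) \<le> s n x"
        unfolding s_eq by (intro divide_right_mono) auto
      moreover have "(real (Suc n) * h x - 1) / real (Suc n) = h x - inverse (real (Suc n))"
        by (simp add: diff_divide_distrib inverse_eq_divide del: of_nat_Suc)
      ultimately show ?case by simp
    qed
    show "(\<lambda>n. h x - inverse (real (Suc n))) \<longlonglongrightarrow> h x"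
      using tendsto_diff[OF tendsto_const LIMSEQ_inverse_real_of_nat, of "h x"] by simp
  qed simp
  have "(\<lambda>n. ip a (s n)) \<longlonglongrightarrow> ip a h"
    unfolding L2_inner_def
  proof (rule integral_dominated_convergence[OF _ _ integrable_norm[OF L2_mult_integrable[OF a h]]])
    show "AE x in ?M. (\<lambda>n. a x * s n x) \<longlonglongrightarrow> a x * h x"
      by (intro AE_I2 tendsto_mult tendsto_const s_lim)
    show "AE x in ?M. norm (a x * s n x) \<le> norm (a x * h x)" for n
      using s_le by (intro AE_I2) (simp add: abs_mult mult_left_mono h0)
    show "(\<lambda>x. a x * s n x) \<in> borel_measurable ?M" for n unfolding s_def by measurable
  qed measurable
  moreover have "0 \<le> ip a (s n)" for n
  proof -
    have L: "(\<lambda>x. if h x > c then 1 else 0) \<in> L2 \<Omega>" for c :: real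
      using L2_measurable[OF h] by (intro L2_of_bounded[of _ 1] measurable_If borel_measurable_const)
        (use borel_measurable_less[of "\<lambda>_. c" ?M h] in \<open>auto simp: pred_def\<close>)
    have "ip a (s n) = (\<Sum>i\<in>{1..Suc n * Suc n}. (1 / real (Suc n)) * ip a (\<lambda>x. if h x > real i / real (Suc n) then 1 else 0))"
      unfolding s_def L2_inner_commute[of a] L2_inner_cmult[symmetric]
      by (rule L2_inner_sum, rule L2_cmult[OF L], rule a)
    also have "\<dots> \<ge> 0"
      by (intro sum_nonneg mult_nonneg_nonneg lev) auto
    finally show ?thesis .
  qed
  ultimately show ?thesis by (intro LIMSEQ_le_const) auto
qed

lemma op_A_positive_power_nonneg:
  assumes f: "f \<in> dom_A \<Omega>" and q: "0 < q" and L: "(\<lambda>x. (max 0 (f x)) powr q) \<in> L2 \<Omega>"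
  shows "0 \<le> ip (opA f) (\<lambda>x. (max 0 (f x)) powr q)"
proof (rule L2_inner_nonneg_of_levels[OF op_A_L2[OF f] L])
  fix c :: real assume c: "0 < c"
  have "c < (max 0 y) powr q \<longleftrightarrow> c powr (1 / q) < y" for y
  proof (cases "y > 0")
    case True
    have "c < y powr q \<longleftrightarrow> c powr (1 / q) < (y powr q) powr (1 / q)"
    proof
      assume "c < y powr q"
      then show "c powr (1 / q) < (y powr q) powr (1 / q)"
        using c q by (intro powr_less_mono2) auto
    next
      assume "c powr (1 / q) < (y powr q) powr (1 / q)"
      then show "c < y powr q"
        using powr_mono2[of "1 / q" "y powr q" c] q by (auto simp: not_le[symmetric])
    qed
    then show ?thesis using True q by (simp add: powr_powr)
  next
    case False
    then show ?thesis using c q by (simp add: max_def not_less) (meson powr_ge_zero order_trans)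
  qed
  then have eq: "(\<lambda>x. if c < (max 0 (f x)) powr q then 1 else 0 :: real) = (\<lambda>x. if c powr (1 / q) < f x then 1 else 0)"
    by simp
  show "0 \<le> ip (opA f) (\<lambda>x. if c < (max 0 (f x)) powr q then 1 else 0)"
    unfolding eq by (rule op_A_level_nonneg[OF f]) simp
qed simp

lemma op_A_uminus:
  assumes f: "f \<in> dom_A \<Omega>"
  shows "(\<lambda>x. - f x) \<in> dom_A \<Omega>" "AE x in leb. opA (\<lambda>x. - f x) x = - opA f x"
proof -
  have z: "(\<lambda>x. 0) \<in> dom_A \<Omega>" using dom_A_diff[OF f f] by simp
  then show "(\<lambda>x. - f x) \<in> dom_A \<Omega>" using dom_A_diff[OF z f] by simp
  have "AE x in leb. opA (\<lambda>x. 0) x = 0" using op_A_diff[OF f f] by simp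
  moreover have "AE x in leb. opA (\<lambda>x. - f x) x = opA (\<lambda>x. 0) x - opA f x"
    using op_A_diff[OF z f] by simp
  ultimately show "AE x in leb. opA (\<lambda>x. - f x) x = - opA f x"
    by eventually_elim simp
qed

lemma L2_dominated:
  assumes f: "f \<in> L2 \<Omega>" and g: "g \<in> borel_measurable (leb)"
    and le: "\<And>x. \<bar>g x\<bar> \<le> \<bar>f x\<bar>"
  shows "g \<in> L2 \<Omega>"
proof -
  have "(g x)\<^sup>2 \<le> (f x)\<^sup>2" for x using le[of x] by (simp add: abs_le_square_iff)
  then have "integrable (leb) (\<lambda>x. (g x)\<^sup>2)"
    using g by (intro Bochner_Integration.integrable_bound[OF L2_square[OF f]]) auto
  then show ?thesis using g by (simp add: L2_def)
qed

text \<open>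
  The superlevel sets of a positive power of \<open>max 0 f\<close> are superlevel sets of \<open>f\<close>. The negative part
  is the positive part of \<open>- f\<close>.
\<close>

lemma op_A_power_nonneg:
  assumes f: "f \<in> dom_A \<Omega>" and p: "1 < p" and L: "(\<lambda>x. \<bar>f x\<bar> powr (p - 2) * f x) \<in> L2 \<Omega>"
  shows "0 \<le> ip (opA f) (\<lambda>x. \<bar>f x\<bar> powr (p - 2) * f x)"
proof -
  let ?M = "leb" let ?N = "\<lambda>x. \<bar>f x\<bar> powr (p - 2) * f x"
  let ?P = "\<lambda>x. (max 0 (f x)) powr (p - 1)" and ?Q = "\<lambda>x. (max 0 (- f x)) powr (p - 1)"
  note [measurable] = L2_measurable[OF dom_A_L2[OF f]]
  have N: "?N x = ?P x - ?Q x" and PN: "\<bar>?P x\<bar> \<le> \<bar>?N x\<bar>" and QN: "\<bar>?Q x\<bar> \<le> \<bar>?N x\<bar>" for x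
  proof -
    have e: "y powr (p - 2) * y = y powr (p - 1)" if "0 < y" for y :: real
    proof -
      have "y * y powr (p - 2) = y powr (1 + (p - 2))" using that by (intro powr_mult_base) simp
      then show ?thesis by (simp add: mult.commute)
    qed
    consider "f x > 0" | "f x = 0" | "f x < 0" by linarith
    then have "?N x = ?P x - ?Q x \<and> \<bar>?P x\<bar> \<le> \<bar>?N x\<bar> \<and> \<bar>?Q x\<bar> \<le> \<bar>?N x\<bar>"
    proof cases
      case 1 then show ?thesis using e[OF 1] by simp
    next
      case 2 then show ?thesis by simp
    next
      case 3 then show ?thesis using e[of "- f x"] by (simp add: max_def)
    qed
    then show "?N x = ?P x - ?Q x" "\<bar>?P x\<bar> \<le> \<bar>?N x\<bar>" "\<bar>?Q x\<bar> \<le> \<bar>?N x\<bar>" by auto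
  qed
  have P: "?P \<in> L2 \<Omega>" and Q: "?Q \<in> L2 \<Omega>"
    by (rule L2_dominated[OF L _ PN], measurable) (rule L2_dominated[OF L _ QN], measurable)
  note m = op_A_uminus[OF f]
  have "0 \<le> ip (opA (\<lambda>x. - f x)) ?Q"
    using p by (intro op_A_positive_power_nonneg m(1) Q) auto
  also have "\<dots> = ip (\<lambda>x. - opA f x) ?Q"
    by (intro L2_inner_cong_AE m(2) op_A_L2 m(1) Q L2_uminus f)
  finally have "ip (opA f) ?Q \<le> 0" by (simp add: L2_inner_uminus)
  moreover have "0 \<le> ip (opA f) ?P"
    using p by (intro op_A_positive_power_nonneg f P) auto
  moreover have "ip (opA f) ?N = ip (opA f) ?P - ip (opA f) ?Q"
    unfolding N by (rule L2_inner_diff_right[OF P Q op_A_L2[OF f]])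
  ultimately show ?thesis by simp
qed

end

section \<open>Spectral expansion\<close>

context bounded_open begin

lemma orthonormal_sum_norm:
  assumes e: "\<And>k. e k \<in> L2 \<Omega>" "\<And>j k. ip (e j) (e k) = (if j = k then 1 else 0)" and "finite A"
  shows "(nrm (\<lambda>x. \<Sum>k\<in>A. c k * e k x))\<^sup>2 = (\<Sum>k\<in>A. (c k)\<^sup>2)"
    and "ip (\<lambda>x. \<Sum>k\<in>A. c k * e k x) (e j) = (if j \<in> A then c j else 0)"
proof -
  have ce: "(\<lambda>x. c k * e k x) \<in> L2 \<Omega>" for k by (intro L2_cmult e)
  have S: "(\<lambda>x. \<Sum>k\<in>A. c k * e k x) \<in> L2 \<Omega>" by (intro L2_sum ce)
  have i: "ip (\<lambda>x. \<Sum>k\<in>A. c k * e k x) (e j) = (if j \<in> A then c j else 0)" for j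
    using \<open>finite A\<close> by (simp add: L2_inner_sum[OF ce e(1)] L2_inner_cmult e(2) if_distrib cong: if_cong)
  show "ip (\<lambda>x. \<Sum>k\<in>A. c k * e k x) (e j) = (if j \<in> A then c j else 0)" by (rule i)
  have "(nrm (\<lambda>x. \<Sum>k\<in>A. c k * e k x))\<^sup>2 = (\<Sum>j\<in>A. ip (\<lambda>x. c j * e j x) (\<lambda>x. \<Sum>k\<in>A. c k * e k x))"
    unfolding L2_norm_sq by (rule L2_inner_sum[OF ce S])
  also have "\<dots> = (\<Sum>j\<in>A. (c j)\<^sup>2)"
    by (intro sum.cong refl)
      (simp add: L2_inner_cmult L2_inner_commute[of "e _"] i power2_eq_square)
  finally show "(nrm (\<lambda>x. \<Sum>k\<in>A. c k * e k x))\<^sup>2 = (\<Sum>k\<in>A. (c k)\<^sup>2)" .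
qed

lemma Bessel:
  assumes e: "\<And>k. e k \<in> L2 \<Omega>" "\<And>j k. ip (e j) (e k) = (if j = k then 1 else 0)"
    and "finite A" "f \<in> L2 \<Omega>"
  shows "(\<Sum>k\<in>A. (ip f (e k))\<^sup>2) \<le> (nrm f)\<^sup>2"
proof -
  let ?c = "\<lambda>k. ip f (e k)" let ?S = "\<lambda>x. \<Sum>k\<in>A. ?c k * e k x"
  have ce: "(\<lambda>x. ?c k * e k x) \<in> L2 \<Omega>" for k by (intro L2_cmult e)
  have S: "?S \<in> L2 \<Omega>" by (intro L2_sum ce)
  have "ip f ?S = (\<Sum>k\<in>A. (?c k)\<^sup>2)"
    unfolding L2_inner_commute[of f ?S] L2_inner_sum[OF ce assms(4)]
    by (simp add: L2_inner_cmult L2_inner_commute[of "e _"] power2_eq_square)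
  then have "0 \<le> (nrm f)\<^sup>2 - 2 * (\<Sum>k\<in>A. (?c k)\<^sup>2) + (\<Sum>k\<in>A. (?c k)\<^sup>2)"
    using zero_le_power2[of "nrm (\<lambda>x. f x - ?S x)"]
    by (simp add: L2_norm_diff_sq[OF assms(4) S] orthonormal_sum_norm(1)[OF e \<open>finite A\<close>])
  then show ?thesis by simp
qed

text \<open>
  The partial sums of \<open>\<Sum>\<^sub>k c\<^sub>k e\<^sub>k\<close> form a Cauchy sequence since the squares of the coefficients are
  summable.
\<close>

lemma Riesz_Fischer_bounded:
  fixes c :: "nat \<Rightarrow> real"
  assumes e: "\<And>k. e k \<in> L2 \<Omega>" "\<And>j k. ip (e j) (e k) = (if j = k then 1 else 0)"
    and c: "\<And>n. (\<Sum>k<n. (c k)\<^sup>2) \<le> B"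
  obtains w where "w \<in> L2 \<Omega>" "\<And>k. ip w (e k) = c k" "(nrm w)\<^sup>2 \<le> B"
proof -
  define S where "S n x = (\<Sum>k<n. c k * e k x)" for n x
  have SL: "S n \<in> L2 \<Omega>" for n unfolding S_def by (intro L2_sum L2_cmult e)
  have "summable (\<lambda>k. (c k)\<^sup>2)"
    using c[of "Suc _"] unfolding lessThan_Suc_atMost by (intro bounded_imp_summable[of _ B]) auto
  have diff: "(nrm (\<lambda>x. S n x - S m x))\<^sup>2 = (\<Sum>k\<in>{m..<n}. (c k)\<^sup>2)" if "m \<le> n" for m n
  proof -
    have "(\<lambda>x. S n x - S m x) = (\<lambda>x. \<Sum>k\<in>{m..<n}. c k * e k x)"
      using that by (auto simp: S_def fun_eq_iff sum_diff_nat_ivl lessThan_atLeast0)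
    then show ?thesis by (simp add: orthonormal_sum_norm(1)[OF e])
  qed
  have cau: "\<exists>N. \<forall>m\<ge>N. \<forall>n\<ge>N. nrm (\<lambda>x. S m x - S n x) < \<epsilon>" if "\<epsilon> > 0" for \<epsilon>
  proof -
    have "0 < \<epsilon>\<^sup>2" using that by simp
    then obtain N where N: "\<And>m n. m \<ge> N \<Longrightarrow> norm (\<Sum>k\<in>{m..<n}. (c k)\<^sup>2) < \<epsilon>\<^sup>2"
      using \<open>summable (\<lambda>k. (c k)\<^sup>2)\<close> unfolding summable_Cauchy by blast
    have lt: "nrm (\<lambda>x. S n x - S m x) < \<epsilon>" if "N \<le> m" "m \<le> n" for m n
    proof (rule power2_less_imp_less)
      show "(nrm (\<lambda>x. S n x - S m x))\<^sup>2 < \<epsilon>\<^sup>2"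
        using diff[OF that(2)] N[OF that(1), of n] by (simp add: abs_less_iff)
    qed (use \<open>\<epsilon> > 0\<close> in simp)
    have "nrm (\<lambda>x. S m x - S n x) < \<epsilon>" if "N \<le> m" "N \<le> n" for m n
      using lt[of m n] lt[of n m] that L2_norm_minus_commute[of "S m" "S n"] by (cases "m \<le> n") auto
    then show ?thesis by blast
  qed
  obtain w where w: "w \<in> L2 \<Omega>" "(\<lambda>n. nrm (\<lambda>x. S n x - w x)) \<longlonglongrightarrow> 0"
    using L2_complete[OF SL cau] by blast
  have "ip w (e j) = c j" for j
  proof -
    have "(\<lambda>n. ip (S n) (e j)) \<longlonglongrightarrow> ip w (e j)"
      by (rule L2_inner_tendsto[OF SL w(1) e(1) w(2)])
    moreover have "\<forall>\<^sub>F n in sequentially. ip (S n) (e j) = c j"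
      using eventually_gt_at_top[of j]
      by eventually_elim (simp add: S_def[abs_def] orthonormal_sum_norm(2)[OF e])
    ultimately show ?thesis by (metis LIMSEQ_unique tendsto_eventually)
  qed
  moreover have "(nrm w)\<^sup>2 \<le> B"
  proof -
    have "(\<lambda>n. nrm (S n)) \<longlonglongrightarrow> nrm w"
      by (rule LIM_zero_cancel, rule Lim_null_comparison[OF _ w(2)])
        (use L2_norm_triangle_diff[OF SL w(1)] in auto)
    then have "(\<lambda>n. (nrm (S n))\<^sup>2) \<longlonglongrightarrow> (nrm w)\<^sup>2" by (intro tendsto_intros)
    moreover have "(nrm (S n))\<^sup>2 \<le> B" for n
      unfolding S_def using c by (simp add: orthonormal_sum_norm(1)[OF e])
    ultimately show ?thesis by (intro LIMSEQ_le_const2) auto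
  qed
  ultimately show ?thesis using w(1) that by blast
qed

lemma eigenbasis_props:
  assumes "eigenbasis_A \<Omega> e \<mu>"
  shows "e k \<in> dom_A \<Omega>" "AE x in leb. opA (e k) x = \<mu> k * e k x" "e k \<in> L2 \<Omega>"
    "ip (e j) (e k) = (if j = k then 1 else 0)"
    "f \<in> L2 \<Omega> \<Longrightarrow> (\<And>k. ip f (e k) = 0) \<Longrightarrow> AE x in leb. f x = 0"
  using assms dom_A_L2 unfolding eigenbasis_A_def by blast+

text \<open>
  One half of Parseval: the function rebuilt from the coefficients of \<open>v\<close> agrees with \<open>v\<close> by
  totality of the basis, and its norm is controlled by the partial sums.
\<close>

lemma eigenbasis_norm_le:
  assumes eb: "eigenbasis_A \<Omega> e \<mu>" and v: "v \<in> L2 \<Omega>"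
    and B: "\<And>n. (\<Sum>k<n. (ip v (e k))\<^sup>2) \<le> B"
  shows "(nrm v)\<^sup>2 \<le> B"
proof -
  note e = eigenbasis_props(3)[OF eb] eigenbasis_props(4)[OF eb]
  obtain w where w: "w \<in> L2 \<Omega>" "\<And>k. ip w (e k) = ip v (e k)" "(nrm w)\<^sup>2 \<le> B"
    using Riesz_Fischer_bounded[OF e B] by blast
  have "AE x in leb. v x - w x = 0"
    by (rule eigenbasis_props(5)[OF eb L2_diff[OF v w(1)]]) (simp add: L2_inner_diff[OF v w(1) e(1)] w(2))
  then have "AE x in leb. v x = w x" by simp
  from L2_norm_cong_AE[OF this v w(1)] show ?thesis using w(3) by simp
qed

lemma eigen_coefficient:
  assumes eb: "eigenbasis_A \<Omega> e \<mu>" and v: "v \<in> dom_A \<Omega>"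
  shows "ip (opA v) (e k) = \<mu> k * ip v (e k)"
proof -
  have "ip (opA v) (e k) = ip (opA (e k)) v"
    using op_A_symmetric[OF v eigenbasis_props(1)[OF eb]] by (simp add: L2_inner_commute)
  also have "\<dots> = ip (\<lambda>x. \<mu> k * e k x) v"
    by (rule L2_inner_cong_AE[OF eigenbasis_props(2)[OF eb] op_A_L2[OF eigenbasis_props(1)[OF eb]]
        L2_cmult[OF eigenbasis_props(3)[OF eb]] dom_A_L2[OF v]])
  finally show ?thesis by (simp add: L2_inner_cmult L2_inner_commute)
qed

text \<open>
  Here \<open>\<mu> powr s\<close> only depends on \<open>|\<mu>|\<close>, by the convention for logarithms of negative numbers, so
  that the bound can be used without knowing the sign of an eigenvalue.
\<close>

lemma powr_sq_le_interpolate: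
  fixes \<mu> :: real assumes "0 \<le> s" "s \<le> 1" shows "(\<mu> powr s)\<^sup>2 \<le> 1 + \<mu>\<^sup>2"
proof -
  have e: "\<mu> powr s = \<bar>\<mu>\<bar> powr s"
    by (cases "\<mu> < 0") (auto simp: powr_def ln_minus)
  show ?thesis
  proof (cases "\<bar>\<mu>\<bar> \<le> 1")
    case True
    then have "\<bar>\<mu>\<bar> powr s \<le> 1 powr s" using assms by (intro powr_mono2) auto
    then have "(\<mu> powr s)\<^sup>2 \<le> 1\<^sup>2" unfolding e by (intro power_mono) auto
    also have "\<dots> \<le> 1 + \<mu>\<^sup>2" by simp
    finally show ?thesis .
  next
    case False
    then have "\<bar>\<mu>\<bar> powr s \<le> \<bar>\<mu>\<bar> powr 1" using assms by (intro powr_mono) auto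
    then have "(\<mu> powr s)\<^sup>2 \<le> \<bar>\<mu>\<bar>\<^sup>2" unfolding e by (intro power_mono) auto
    then show ?thesis by simp
  qed
qed

lemma frac_coefficients_bounded:
  assumes eb: "eigenbasis_A \<Omega> e \<mu>" and v: "v \<in> dom_A \<Omega>" and s: "0 \<le> s" "s \<le> 1"
  shows "(\<Sum>k<n. (\<mu> k powr s * ip v (e k))\<^sup>2) \<le> (nrm v)\<^sup>2 + (nrm (opA v))\<^sup>2"
proof -
  note e = eigenbasis_props(3)[OF eb] eigenbasis_props(4)[OF eb]
  have "(\<Sum>k<n. (\<mu> k powr s * ip v (e k))\<^sup>2)
      \<le> (\<Sum>k<n. (ip v (e k))\<^sup>2 + (ip (opA v) (e k))\<^sup>2)"
  proof (rule sum_mono)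
    fix k
    have "(\<mu> k powr s * ip v (e k))\<^sup>2 \<le> (1 + (\<mu> k)\<^sup>2) * (ip v (e k))\<^sup>2"
      unfolding power_mult_distrib by (intro mult_right_mono powr_sq_le_interpolate s) auto
    then show "(\<mu> k powr s * ip v (e k))\<^sup>2 \<le> (ip v (e k))\<^sup>2 + (ip (opA v) (e k))\<^sup>2"
      by (simp add: eigen_coefficient[OF eb v] power_mult_distrib algebra_simps)
  qed
  also have "\<dots> \<le> (nrm v)\<^sup>2 + (nrm (opA v))\<^sup>2"
    unfolding sum.distrib using v by (intro add_mono Bessel e dom_A_L2 op_A_L2) auto
  finally show ?thesis .
qed

text \<open>
  The representative \<open>frac_A\<close> is chosen together with some eigenbasis that need not be the given one.
  The coefficient bound depends only on \<open>|v|\<close> and \<open>|A v|\<close>, hence applies to whichever basis was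
  chosen.
\<close>

lemma frac_A_bound:
  assumes ex: "\<exists>e \<mu>. eigenbasis_A \<Omega> e \<mu>" and v: "v \<in> dom_A \<Omega>" and s: "0 \<le> s" "s \<le> 1"
  shows "v \<in> dom_frac_A \<Omega> s"
    and "norm_frac_A \<Omega> s v \<le> sqrt ((nrm v)\<^sup>2 + (nrm (opA v))\<^sup>2)"
proof -
  obtain e \<mu> where eb: "eigenbasis_A \<Omega> e \<mu>" using ex by blast
  note e = eigenbasis_props(3)[OF eb] eigenbasis_props(4)[OF eb]
  obtain w where "w \<in> L2 \<Omega>" "\<And>k. ip w (e k) = \<mu> k powr s * ip v (e k)"
    using Riesz_Fischer_bounded[OF e frac_coefficients_bounded[OF eb v s]] by blast
  then have "is_frac_A \<Omega> s v w"
    unfolding is_frac_A_def using eb dom_A_L2[OF v] by blast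
  then show "v \<in> dom_frac_A \<Omega> s" by (auto simp: dom_frac_A_def)
  from \<open>is_frac_A \<Omega> s v w\<close> have "is_frac_A \<Omega> s v (frac_A \<Omega> s v)"
    unfolding frac_A_def by (rule someI[of "is_frac_A \<Omega> s v"])
  then obtain e' \<mu>' where e': "eigenbasis_A \<Omega> e' \<mu>'" "frac_A \<Omega> s v \<in> L2 \<Omega>"
      "\<And>k. ip (frac_A \<Omega> s v) (e' k) = \<mu>' k powr s * ip v (e' k)"
    unfolding is_frac_A_def by blast
  have "(nrm (frac_A \<Omega> s v))\<^sup>2 \<le> (nrm v)\<^sup>2 + (nrm (opA v))\<^sup>2"
    by (rule eigenbasis_norm_le[OF e'(1,2)]) (use frac_coefficients_bounded[OF e'(1) v s] e'(3) in simp)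
  then show "norm_frac_A \<Omega> s v \<le> sqrt ((nrm v)\<^sup>2 + (nrm (opA v))\<^sup>2)"
    unfolding norm_frac_A_def by (rule real_le_rsqrt)
qed

end

section \<open>Pairings of vector-valued integrals and a smooth step\<close>

context bounded_open begin

lemma simple_into_pairing:
  assumes s: "simple_into {a..b} (L2 \<Omega>) s" and g: "g \<in> L2 \<Omega>"
  shows "integrable (lebesgue_on {a..b}) (\<lambda>t. ip (s t) g)"
    and "(LINT t|lebesgue_on {a..b}. ip (s t) g) =
      ip (\<lambda>x. \<Sum>v\<in>s ` {a..b}. measure lebesgue {t\<in>{a..b}. s t = v} * v x) g"
proof -
  let ?J = "{a..b}" let ?M = "lebesgue_on ?J"
  have sf: "simple_function ?M s" and sX: "\<And>v. v \<in> s ` ?J \<Longrightarrow> v \<in> L2 \<Omega>"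
    using s by (auto simp: simple_into_def)
  have fin: "finite (s ` ?J)" using sf by (simp add: simple_function_def)
  have ms: "{t\<in>?J. s t = v} \<in> sets ?M" for v
  proof -
    have "s -` {v} \<inter> space ?M \<in> sets ?M" by (rule simple_functionD(2)[OF sf])
    moreover have "s -` {v} \<inter> space ?M = {t\<in>?J. s t = v}" by auto
    ultimately show ?thesis by simp
  qed
  have finM: "finite_measure ?M" by (rule finite_measure_lebesgue_on) auto
  have ind: "integrable ?M (indicator {t\<in>?J. s t = v} :: real \<Rightarrow> real)" for v
    using ms finM by (intro integrable_real_indicator) (auto simp: finite_measure.emeasure_finite less_top[symmetric])
  have meas: "(LINT t|?M. indicator {t\<in>?J. s t = v} t) = measure lebesgue {t\<in>?J. s t = v}" for v
  proof -
    have "(LINT t|?M. indicator {t\<in>?J. s t = v} t) = measure ?M ({t\<in>?J. s t = v} \<inter> space ?M)" by simp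
    also have "{t\<in>?J. s t = v} \<inter> space ?M = {t\<in>?J. s t = v}" by auto
    also have "measure ?M {t\<in>?J. s t = v} = measure lebesgue {t\<in>?J. s t = v}"
      by (intro measure_restrict_space) auto
    finally show ?thesis .
  qed
  have eq: "ip (s t) g = (\<Sum>v\<in>s ` ?J. indicator {t\<in>?J. s t = v} t * ip v g)" if "t \<in> ?J" for t
  proof -
    have "(\<Sum>v\<in>s ` ?J. indicator {t\<in>?J. s t = v} t * ip v g) = (\<Sum>v\<in>s ` ?J. if v = s t then ip v g else 0)"
      using that by (intro sum.cong) (auto simp: indicator_def)
    then show ?thesis using fin that by simp
  qed
  have int: "integrable ?M (\<lambda>t. \<Sum>v\<in>s ` ?J. indicator {t\<in>?J. s t = v} t * ip v g)"
    by (intro Bochner_Integration.integrable_sum integrable_mult_left ind)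
  then show "integrable ?M (\<lambda>t. ip (s t) g)"
    by (subst Bochner_Integration.integrable_cong[OF refl eq]) auto
  have "(LINT t|?M. ip (s t) g) = (LINT t|?M. (\<Sum>v\<in>s ` ?J. indicator {t\<in>?J. s t = v} t * ip v g))"
    by (intro Bochner_Integration.integral_cong refl eq) auto
  also have "\<dots> = (\<Sum>v\<in>s ` ?J. (LINT t|?M. indicator {t\<in>?J. s t = v} t * ip v g))"
    by (intro Bochner_Integration.integral_sum integrable_mult_left ind)
  also have "\<dots> = (\<Sum>v\<in>s ` ?J. measure lebesgue {t\<in>?J. s t = v} * ip v g)"
    by (simp only: integral_mult_left_zero meas)
  also have "\<dots> = ip (\<lambda>x. \<Sum>v\<in>s ` ?J. measure lebesgue {t\<in>?J. s t = v} * v x) g"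
    unfolding L2_inner_cmult[symmetric]
    by (rule L2_inner_sum[symmetric]) (auto intro: L2_cmult sX g)
  finally show "(LINT t|?M. ip (s t) g) =
      ip (\<lambda>x. \<Sum>v\<in>s ` ?J. measure lebesgue {t\<in>?J. s t = v} * v x) g" .
qed

text \<open>
  Completeness of Lebesgue measure lets the limit be altered on a null set.
\<close>

lemma borel_measurable_AE_lim_lebesgue_on:
  fixes f :: "real \<Rightarrow> real"
  assumes s: "\<And>n. s n \<in> borel_measurable (lebesgue_on J)" and J: "J \<in> sets lebesgue"
    and lim: "AE t in lebesgue_on J. (\<lambda>n. s n t) \<longlonglongrightarrow> f t"
  shows "f \<in> borel_measurable (lebesgue_on J)"
proof -
  have "AE t in lebesgue_on J. lim (\<lambda>n. s n t) = f t"
    using lim by eventually_elim (rule limI)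
  then have ae: "AE t in lebesgue. (if t \<in> J then lim (\<lambda>n. s n t) else 0) = (if t \<in> J then f t else 0)"
    using J by (subst (asm) AE_restrict_space_iff) auto
  have "(\<lambda>t. lim (\<lambda>n. s n t)) \<in> borel_measurable (lebesgue_on J)" using s by measurable
  then have "(\<lambda>t. if t \<in> J then lim (\<lambda>n. s n t) else 0) \<in> borel_measurable lebesgue"
    using J by (simp add: borel_measurable_if)
  from borel_measurable_AE[OF this ae] show ?thesis using J by (simp add: borel_measurable_if)
qed

lemma strongly_measurable_pairing:
  assumes F: "strongly_measurable {a..b} (L2 \<Omega>) (nrm) F" and g: "g \<in> L2 \<Omega>"
  shows "(\<lambda>t. ip (F t) g) \<in> borel_measurable (lebesgue_on {a..b})"
proof -
  obtain s where s: "\<And>n::nat. simple_into {a..b} (L2 \<Omega>) (s n)"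
      "AE t in lebesgue_on {a..b}. (\<lambda>n. nrm (\<lambda>x. F t x - s n t x)) \<longlonglongrightarrow> 0"
    and FL: "AE t in lebesgue_on {a..b}. F t \<in> L2 \<Omega>"
    using F unfolding strongly_measurable_def by blast
  have sL: "s n t \<in> L2 \<Omega>" if "t \<in> {a..b}" for n t
    using s(1)[of n] that by (auto simp: simple_into_def)
  show ?thesis
  proof (rule borel_measurable_AE_lim_lebesgue_on)
    show "(\<lambda>t. ip (s n t) g) \<in> borel_measurable (lebesgue_on {a..b})" for n
      using simple_into_pairing(1)[OF s(1) g] by (rule borel_measurable_integrable)
    show "AE t in lebesgue_on {a..b}. (\<lambda>n. ip (s n t) g) \<longlonglongrightarrow> ip (F t) g"
      using s(2) FL AE_space
    proof eventually_elim
      case (elim t)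
      show ?case
        using elim(1) elim(2) sL[of t] elim(3) g
        by (intro L2_inner_tendsto) (auto simp: L2_norm_minus_commute[of "s _ t"])
    qed
  qed simp
qed

text \<open>
  Pairing with \<open>g\<close> commutes with the vector-valued integral, as it does for simple functions. The
  normalisation \<open>|g| \<le> 1\<close> bounds the pairing by the norm itself: the integrals of norms in
  \<open>has_Bochner_integral\<close> may have a non-measurable integrand, for which monotonicity of the integral
  is safe but pulling out a factor is not.
\<close>

lemma Bochner_pairing_small:
  assumes F: "has_Bochner_integral {a..b} (L2 \<Omega>) (nrm) F I" and g: "g \<in> L2 \<Omega>" "nrm g \<le> 1"
  shows "integrable (lebesgue_on {a..b}) (\<lambda>t. ip (F t) g)"
    and "(LINT t|lebesgue_on {a..b}. ip (F t) g) = ip I g"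
proof -
  let ?M = "lebesgue_on {a..b}"
  obtain s where sm: "strongly_measurable {a..b} (L2 \<Omega>) (nrm) F" and IL: "I \<in> L2 \<Omega>"
    and s: "\<And>n::nat. simple_into {a..b} (L2 \<Omega>) (s n)"
      "(\<lambda>n. \<integral>\<^sup>+ t. ennreal (nrm (\<lambda>x. F t x - s n t x)) \<partial>?M) \<longlonglongrightarrow> 0"
      "(\<lambda>n. nrm (\<lambda>x. I x - (\<Sum>v\<in>s n ` {a..b}. measure lebesgue {t\<in>{a..b}. s n t = v} * v x))) \<longlonglongrightarrow> 0"
    using F unfolding has_Bochner_integral_def by blast
  have FL: "AE t in ?M. F t \<in> L2 \<Omega>" using sm by (simp add: strongly_measurable_def)
  have sL: "s n t \<in> L2 \<Omega>" if "t \<in> {a..b}" for n t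
    using s(1)[of n] that by (auto simp: simple_into_def)
  let ?f = "\<lambda>t. ip (F t) g" let ?s = "\<lambda>n t. ip (s n t) g"
  have fm: "?f \<in> borel_measurable ?M" by (rule strongly_measurable_pairing[OF sm g(1)])
  note si = simple_into_pairing[OF s(1) g(1)]
  have le: "(\<integral>\<^sup>+ t. ennreal \<bar>?f t - ?s n t\<bar> \<partial>?M) \<le> (\<integral>\<^sup>+ t. ennreal (nrm (\<lambda>x. F t x - s n t x)) \<partial>?M)" for n
  proof (rule nn_integral_mono_AE)
    show "AE t in ?M. ennreal \<bar>?f t - ?s n t\<bar> \<le> ennreal (nrm (\<lambda>x. F t x - s n t x))"
      using FL AE_space
    proof eventually_elim
      case (elim t)
      then have st: "s n t \<in> L2 \<Omega>" using sL by simp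
      have "\<bar>?f t - ?s n t\<bar> \<le> nrm (\<lambda>x. F t x - s n t x) * nrm g"
        using L2_Cauchy_Schwarz[OF L2_diff[OF elim(1) st] g(1)]
        by (simp add: L2_inner_diff elim(1) st g(1))
      also have "\<dots> \<le> nrm (\<lambda>x. F t x - s n t x)" using g(2) by (simp add: mult_left_le)
      finally show ?case by (rule ennreal_leI)
    qed
  qed
  have lim0: "(\<lambda>n. \<integral>\<^sup>+ t. ennreal \<bar>?f t - ?s n t\<bar> \<partial>?M) \<longlonglongrightarrow> 0"
    by (rule tendsto_sandwich[OF _ _ tendsto_const s(2)]) (use le in auto)
  then have "\<forall>\<^sub>F n in sequentially. (\<integral>\<^sup>+ t. ennreal \<bar>?f t - ?s n t\<bar> \<partial>?M) < 1"
    by (rule order_tendstoD) simp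
  then obtain n where n: "(\<integral>\<^sup>+ t. ennreal \<bar>?f t - ?s n t\<bar> \<partial>?M) < 1"
    by (meson eventually_sequentially order_refl)
  have "integrable ?M (\<lambda>t. ?f t - ?s n t)"
    using n fm borel_measurable_integrable[OF si(1)]
    by (intro integrableI_bounded) (auto intro: less_trans simp: less_top[symmetric])
  from Bochner_Integration.integrable_add[OF this si(1)[of n]] show fi: "integrable ?M ?f" by simp
  have "(\<lambda>n. LINT t|?M. ?s n t) \<longlonglongrightarrow> (LINT t|?M. ?f t)"
  proof (rule tendsto_L1_int[OF si(1) fi])
    show "(\<lambda>n. \<integral>\<^sup>+ t. ennreal (norm (?s n t - ?f t)) \<partial>?M) \<longlonglongrightarrow> 0"
      using lim0 by (simp add: abs_minus_commute)
  qed
  moreover have "(\<lambda>n. LINT t|?M. ?s n t) \<longlonglongrightarrow> ip I g"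
    unfolding si(2)
  proof (rule L2_inner_tendsto[OF _ IL g(1)])
    show "(\<lambda>x. \<Sum>v\<in>s n ` {a..b}. measure lebesgue {t\<in>{a..b}. s n t = v} * v x) \<in> L2 \<Omega>" for n
      using sL by (intro L2_sum L2_cmult) auto
    show "(\<lambda>n. nrm (\<lambda>x. (\<Sum>v\<in>s n ` {a..b}. measure lebesgue {t\<in>{a..b}. s n t = v} * v x) - I x)) \<longlonglongrightarrow> 0"
      using s(3) by (subst L2_norm_minus_commute)
  qed
  ultimately show "(LINT t|?M. ?f t) = ip I g" by (rule LIMSEQ_unique)
qed

lemma Bochner_pairing:
  assumes F: "has_Bochner_integral {a..b} (L2 \<Omega>) (nrm) F I" and g: "g \<in> L2 \<Omega>"
  shows "integrable (lebesgue_on {a..b}) (\<lambda>t. ip (F t) g)"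
    and "(LINT t|lebesgue_on {a..b}. ip (F t) g) = ip I g"
proof -
  \<comment> \<open>the summand 1 keeps the divisor positive when \<open>g\<close> vanishes\<close>
  define G where "G = nrm g + 1"
  have G: "0 < G" unfolding G_def by (simp add: add_nonneg_pos)
  let ?g = "\<lambda>x. (1 / G) * g x"
  have g1: "?g \<in> L2 \<Omega>" by (rule L2_cmult[OF g])
  have g2: "nrm ?g \<le> 1" using G by (simp only: L2_norm_cmult) (simp add: G_def)
  have eq: "ip f g = G * ip f ?g" for f
    using G by (simp only: L2_inner_cmult_right) simp
  show "integrable (lebesgue_on {a..b}) (\<lambda>t. ip (F t) g)"
    unfolding eq by (intro integrable_mult_right Bochner_pairing_small[OF F g1 g2])
  show "(LINT t|lebesgue_on {a..b}. ip (F t) g) = ip I g"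
    unfolding eq integral_mult_right_zero Bochner_pairing_small(2)[OF F g1 g2] ..
qed

end

lemma smooth_of_real_derivative:
  fixes f :: "real \<Rightarrow> real"
  assumes "\<And>x. (f has_real_derivative f' x) (at x)" "smooth f'"
  shows "smooth f"
proof -
  have "Ck_on (Suc k) UNIV f" for k
    unfolding Ck_on.simps(2)
  proof (intro exI[of _ "\<lambda>_. f'"] conjI ballI)
    show "(f has_derivative (\<lambda>h. \<Sum>b\<in>Basis. (h \<bullet> b) * f' x)) (at x)" for x
      using assms(1)[of x] unfolding has_field_derivative_def
      by (rule has_derivative_eq_rhs) (simp add: fun_eq_iff mult.commute)
    show "Ck_on k UNIV f'" using assms(2) by (simp add: smooth_def)
  qed
  then have "Ck_on k UNIV f" for k by (rule Ck_on_Suc_imp)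
  then show ?thesis by (simp add: smooth_def)
qed

definition bump :: "real \<Rightarrow> real" where
  "bump x = flat 0 (x + 1) * flat 0 (1 - x)"

lemma smooth_bump_affine: "smooth (\<lambda>x. bump (c * (x - d)))"
proof -
  have "smooth (\<lambda>x::real. c * (x \<bullet> 1 - d))" by (intro smooth_intros)
  then have *: "smooth (\<lambda>x. c * (x - d))" by simp
  show ?thesis unfolding bump_def by (intro smooth_mult smooth_flat smooth_add smooth_diff smooth_const *)
qed

lemma bump_nonneg: "0 \<le> bump x" by (simp add: bump_def flat_nonneg)

lemma bump_pos: "\<bar>x\<bar> < 1 \<Longrightarrow> 0 < bump x"
  by (auto simp: bump_def flat_def abs_if split: if_splits)

lemma bump_zero: "1 \<le> \<bar>x\<bar> \<Longrightarrow> bump x = 0"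
  by (auto simp: bump_def flat_def abs_if split: if_splits)

lemma bump_continuous: "continuous_on UNIV bump"
  using smooth_continuous[OF smooth_bump_affine[of 1 0]] by simp

text \<open>
  The primitive of \<open>bump\<close>, normalised by its total mass \<open>m\<close>.
\<close>

lemma smooth_step_exists:
  "\<exists>B m. 0 < m \<and> (\<forall>y. (B has_real_derivative bump y / m) (at y)) \<and>
    (\<forall>y\<le>-1. B y = 0) \<and> (\<forall>y\<ge>1. B y = 1) \<and> mono B"
proof -
  define A where "A y = (LBINT x=ereal 0..y. bump x)" for y :: real
  have A: "(A has_real_derivative bump y) (at y)" for y
  proof -
    let ?r = "\<bar>y\<bar> + 1"
    have "((\<lambda>u. LBINT x=ereal 0..u. bump x) has_vector_derivative bump y) (at y within {-?r..?r})"
      using bump_continuous by (intro interval_integral_FTC2) (auto intro: continuous_on_subset)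
    moreover have "at y within {-?r..?r} = at y"
      by (rule at_within_interior) auto
    ultimately show ?thesis
      by (simp add: A_def[abs_def] has_real_derivative_iff_has_vector_derivative)
  qed
  have mono: "A y \<le> A z" if "y \<le> z" for y z
    by (rule DERIV_nonneg_imp_nondecreasing[OF that]) (use A bump_nonneg in blast)
  have lo: "A y = A (-1)" if "y \<le> -1" for y
  proof (cases "y = -1")
    case False
    then have "y < -1" using that by simp
    from MVT2[OF this A] obtain z where "z < -1" "A (-1) - A y = (-1 - y) * bump z" by auto
    then show ?thesis by (simp add: bump_zero)
  qed simp
  have hi: "A y = A 1" if "1 \<le> y" for y
  proof (cases "y = 1")
    case False
    then have "1 < y" using that by simp
    from MVT2[OF this A] obtain z where "1 < z" "A y - A 1 = (y - 1) * bump z" by auto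
    then show ?thesis by (simp add: bump_zero)
  qed simp
  define m where "m = A 1 - A (-1)"
  have m: "0 < m"
  proof -
    have "-1 < (1::real)" by simp
    from MVT2[OF this A] obtain z where "-1 < z" "z < 1" "A 1 - A (-1) = (1 - (-1)) * bump z" by auto
    then show ?thesis using bump_pos[of z] by (simp add: m_def abs_less_iff)
  qed
  show ?thesis
  proof (intro exI[of _ "\<lambda>y. (A y - A (-1)) / m"] exI[of _ m] conjI allI impI monoI m)
    show "((\<lambda>y. (A y - A (-1)) / m) has_real_derivative bump y / m) (at y)" for y
      using A[of y] m by (auto intro!: derivative_eq_intros)
    show "(A y - A (-1)) / m = 0" if "y \<le> -1" for y using lo[OF that] by simp
    show "(A y - A (-1)) / m = 1" if "1 \<le> y" for y using hi[OF that] m by (simp add: m_def)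
    show "(A y - A (-1)) / m \<le> (A z - A (-1)) / m" if "y \<le> z" for y z
      using mono[OF that] m by (simp add: divide_right_mono)
  qed
qed

section \<open>Evolution variational inequalities\<close>

text \<open>
  The inequality in terms of real functions only. In the application \<open>\<Phi> t s\<close> is the squared
  distance of \<open>u t\<close> and \<open>u s\<close>, \<open>j\<close> is the energy along the orbit, \<open>r s t\<close> is half of the derivative
  of \<open>\<Phi>\<close> in its first argument, and \<open>G\<close> is the set of times at which the equation holds with speed
  at most \<open>L\<close>. The constant \<open>L\<close> and the final time \<open>T\<close> must not enter the conclusions. The bound on
  mixed second differences of \<open>\<Phi>\<close> replaces a chain rule along the diagonal.
\<close>

locale evi =
  fixes a T L p :: real and G :: "real set"
    and \<Phi> r :: "real \<Rightarrow> real \<Rightarrow> real" and j :: "real \<Rightarrow> real"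
  assumes aT: "a < T" and p: "0 \<le> p"
    and G_sub: "G \<subseteq> {a..T}" and aG: "a \<in> G" and G_null: "negligible ({a..T} - G)"
    and Phi_sym: "\<Phi> t s = \<Phi> s t" and Phi_diag: "\<Phi> t t = 0" and Phi_nonneg: "0 \<le> \<Phi> t s"
    and Phi_quad: "t \<in> {a..T} \<Longrightarrow> s \<in> {a..T} \<Longrightarrow> \<Phi> t s \<le> L\<^sup>2 * (t - s)\<^sup>2"
    and Phi_second: "t \<in> {a..T} \<Longrightarrow> t' \<in> {a..T} \<Longrightarrow> s \<in> {a..T} \<Longrightarrow> s' \<in> {a..T} \<Longrightarrow>
      \<bar>\<Phi> t' s' - \<Phi> t' s - \<Phi> t s' + \<Phi> t s\<bar> \<le> 2 * L\<^sup>2 * \<bar>t' - t\<bar> * \<bar>s' - s\<bar>"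
    and r_integral: "s \<in> {a..T} \<Longrightarrow> a \<le> x \<Longrightarrow> x \<le> y \<Longrightarrow> y \<le> T \<Longrightarrow>
      (r s has_integral (\<Phi> y s - \<Phi> x s) / 2) {x..y}"
    and r_bound: "t \<in> G \<Longrightarrow> s \<in> {a..T} \<Longrightarrow> \<bar>r s t\<bar> \<le> L\<^sup>2 * \<bar>t - s\<bar>"
    and r_lip: "t \<in> G \<Longrightarrow> s \<in> {a..T} \<Longrightarrow> s' \<in> {a..T} \<Longrightarrow> \<bar>r s t - r s' t\<bar> \<le> L\<^sup>2 * \<bar>s - s'\<bar>"
    and j_nonneg: "t \<in> G \<Longrightarrow> 0 \<le> j t"
    and evi: "s \<in> G \<Longrightarrow> t \<in> G \<Longrightarrow> r s t \<le> j s - j t + p / 2 * j t * \<Phi> t s"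
begin

lemma G_dense:
  assumes "a \<le> x" "x < y" "y \<le> T"
  obtains s where "s \<in> G" "x < s" "s < y"
proof -
  have "\<not> {x<..<y} \<subseteq> {a..T} - G"
  proof
    assume "{x<..<y} \<subseteq> {a..T} - G"
    then have "negligible {x<..<y}" using G_null negligible_subset by blast
    then show False using assms(2) by (simp add: open_not_negligible)
  qed
  then obtain s where "s \<in> {x<..<y}" "s \<notin> {a..T} - G" by blast
  then show ?thesis using assms that[of s] by auto
qed

lemma closure_G: "closure G = {a..T}"
proof
  show "closure G \<subseteq> {a..T}" using G_sub by (intro closure_minimal) auto
  show "{a..T} \<subseteq> closure G"
  proof
    fix x assume x: "x \<in> {a..T}"
    show "x \<in> closure G"
      unfolding closure_approachable
    proof (intro allI impI)
      fix e :: real assume "e > 0"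
      obtain lo hi where lh: "a \<le> lo" "lo < hi" "hi \<le> T" "x - e \<le> lo" "hi \<le> x + e"
      proof (cases "x < T")
        case True
        then show ?thesis using that[of x "min T (x + e)"] x \<open>e > 0\<close> by auto
      next
        case False
        then show ?thesis using that[of "max a (x - e)" x] x \<open>e > 0\<close> aT by auto
      qed
      then obtain s where "s \<in> G" "lo < s" "s < hi" using G_dense by metis
      then show "\<exists>y\<in>G. dist y x < e" using lh by (intro bexI[of _ s]) (auto simp: dist_real_def abs_less_iff)
    qed
  qed
qed

definition \<delta> :: real where "\<delta> = 1 / (p * L\<^sup>2 + 1)"

lemma \<delta>: "0 < \<delta>" "\<delta> \<le> 1" "p * L\<^sup>2 * \<delta> \<le> 1"
proof -
  have "0 \<le> p * L\<^sup>2" using p by simp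
  then show "0 < \<delta>" "\<delta> \<le> 1" "p * L\<^sup>2 * \<delta> \<le> 1" by (auto simp: \<delta>_def divide_simps)
qed

text \<open>
  For \<open>t\<close> close to \<open>s\<close> the term \<open>p / 2 * j t * \<Phi> t s\<close> is at most \<open>j t / 2\<close> and can be absorbed.
\<close>

lemma j_step:
  assumes "s \<in> G" "t \<in> G" "\<bar>t - s\<bar> \<le> \<delta>"
  shows "j t \<le> 2 * j s + 2 * L\<^sup>2"
proof -
  have mem: "s \<in> {a..T}" "t \<in> {a..T}" using assms G_sub by auto
  have "p * \<Phi> t s \<le> p * (L\<^sup>2 * (t - s)\<^sup>2)" using Phi_quad[OF mem(2,1)] p by (rule mult_left_mono)
  also have "(t - s)\<^sup>2 \<le> \<delta>\<^sup>2" using assms(3) \<delta> by (simp add: abs_le_square_iff[symmetric])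
  also have "\<delta>\<^sup>2 \<le> \<delta>" using \<delta> by (simp add: power2_eq_square mult_left_le)
  finally have "p * \<Phi> t s \<le> 1" using \<delta>(3) p by (simp add: mult_left_mono mult.assoc)
  then have "j t * (p * \<Phi> t s) \<le> j t * 1" using j_nonneg[OF assms(2)] by (rule mult_left_mono)
  then have "p / 2 * j t * \<Phi> t s \<le> j t / 2" by (simp add: mult_ac)
  moreover have "\<bar>r s t\<bar> \<le> L\<^sup>2 * 1"
    using r_bound[OF assms(2) mem(1)] assms(3) \<delta>(2) by (meson mult_left_mono order_trans zero_le_power2)
  moreover note evi[OF assms(1,2)]
  ultimately show ?thesis by linarith
qed

text \<open>
  No bound on \<open>j\<close> is assumed. It is propagated from \<open>j a\<close> in finitely many steps of length
  \<open>\<delta> / 2\<close>; the step is half of what \<open>j_step\<close> allows, so that a point of \<open>G\<close> fits in between.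
\<close>

lemma j_bounded: obtains M where "0 \<le> M" "\<And>t. t \<in> G \<Longrightarrow> j t \<le> M"
proof -
  have "\<exists>M. \<forall>t\<in>G. t \<le> a + real n * (\<delta> / 2) \<longrightarrow> j t \<le> M" for n
  proof (induction n)
    case 0
    show ?case using G_sub by (intro exI[of _ "j a"]) force
  next
    case (Suc n)
    then obtain M where M: "\<And>t. t \<in> G \<Longrightarrow> t \<le> a + real n * (\<delta> / 2) \<Longrightarrow> j t \<le> M" by blast
    have "j t \<le> 2 * max M (j a) + 2 * L\<^sup>2" if t: "t \<in> G" "t \<le> a + real (Suc n) * (\<delta> / 2)" for t
    proof (cases "t \<le> a + \<delta>")
      case True
      then have "\<bar>t - a\<bar> \<le> \<delta>" using G_sub t(1) by auto
      from j_step[OF aG t(1) this] show ?thesis by linarith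
    next
      case False
      have "t \<le> T" using G_sub t(1) by auto
      then have "a \<le> t - \<delta>" "t - \<delta> < t - \<delta> / 2" "t - \<delta> / 2 \<le> T"
        using False \<delta>(1) by auto
      then obtain s where s: "s \<in> G" "t - \<delta> < s" "s < t - \<delta> / 2"
        using G_dense by blast
      have "s \<le> a + real n * (\<delta> / 2)"
      proof -
        have "real (Suc n) * (\<delta> / 2) = real n * (\<delta> / 2) + \<delta> / 2" by (simp add: distrib_right)
        then show ?thesis using s(3) t(2) by linarith
      qed
      then have "j s \<le> M" using M s(1) by blast
      moreover have "\<bar>t - s\<bar> \<le> \<delta>" using s \<delta>(1) by auto
      ultimately show ?thesis using j_step[OF s(1) t(1)] by linarith
    qed
    then show ?case by blast
  qed
  moreover obtain n :: nat where "(T - a) / (\<delta> / 2) \<le> real n" using real_arch_simple by blast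
  then have "T \<le> a + real n * (\<delta> / 2)" using \<delta>(1) by (simp add: field_simps)
  ultimately obtain M where "\<forall>t\<in>G. t \<le> a + real n * (\<delta> / 2) \<longrightarrow> j t \<le> M" by blast
  then have "\<And>t. t \<in> G \<Longrightarrow> j t \<le> M" using \<open>T \<le> a + real n * (\<delta> / 2)\<close> G_sub by force
  then show ?thesis using that[of M] j_nonneg[OF aG] aG by force
qed

text \<open>
  Once \<open>j\<close> is bounded, the inequality bounds its increments in both directions, so \<open>j\<close> is Lipschitz
  on the dense set \<open>G\<close> and extends to the whole interval.
\<close>

lemma j_extension:
  obtains J K M where "0 \<le> K" "K-lipschitz_on {a..T} J" "\<And>t. t \<in> G \<Longrightarrow> J t = j t"
    "\<And>t. t \<in> {a..T} \<Longrightarrow> 0 \<le> J t" "0 \<le> M" "\<And>t. t \<in> {a..T} \<Longrightarrow> J t \<le> M"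
proof -
  obtain M where M: "0 \<le> M" "\<And>t. t \<in> G \<Longrightarrow> j t \<le> M" using j_bounded by blast
  define K where "K = L\<^sup>2 + p / 2 * M * L\<^sup>2 * (T - a)"
  have K: "0 \<le> K" unfolding K_def using p M aT by simp
  have one: "j t - j s \<le> K * \<bar>t - s\<bar>" if "s \<in> G" "t \<in> G" for s t
  proof -
    have mem: "s \<in> {a..T}" "t \<in> {a..T}" using that G_sub by auto
    have "p / 2 * j t * \<Phi> t s \<le> p / 2 * M * (L\<^sup>2 * (t - s)\<^sup>2)"
      using Phi_quad[OF mem(2,1)] p M that j_nonneg Phi_nonneg
      by (intro mult_mono mult_left_mono) auto
    also have "(t - s)\<^sup>2 \<le> (T - a) * \<bar>t - s\<bar>"
    proof -
      have "\<bar>t - s\<bar> \<le> T - a" using mem by auto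
      then have "\<bar>t - s\<bar> * \<bar>t - s\<bar> \<le> (T - a) * \<bar>t - s\<bar>" by (rule mult_right_mono) simp
      then show ?thesis by (simp add: power2_eq_square)
    qed
    finally have "p / 2 * j t * \<Phi> t s \<le> p / 2 * M * (L\<^sup>2 * ((T - a) * \<bar>t - s\<bar>))"
      using p M by (simp add: mult_left_mono)
    moreover have "K * \<bar>t - s\<bar> = L\<^sup>2 * \<bar>t - s\<bar> + p / 2 * M * (L\<^sup>2 * ((T - a) * \<bar>t - s\<bar>))"
      by (simp add: K_def field_simps)
    ultimately show ?thesis
      using evi[OF that] r_bound[OF that(2) mem(1)] by linarith
  qed
  have "K-lipschitz_on G j"
  proof (rule lipschitz_onI[OF _ K])
    fix s t assume "s \<in> G" "t \<in> G"
    then show "dist (j s) (j t) \<le> K * dist s t"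
      using one[of s t] one[of t s] by (simp add: dist_real_def abs_le_iff abs_minus_commute)
  qed
  from lipschitz_extend_closure[OF this] obtain J where
    J: "K-lipschitz_on {a..T} J" "\<And>t. t \<in> G \<Longrightarrow> J t = j t" unfolding closure_G by blast
  have cont: "continuous_on (closure G) J" using lipschitz_on_continuous_on[OF J(1)] closure_G by simp
  have "0 \<le> J t" if "t \<in> {a..T}" for t
    by (rule continuous_ge_on_closure[OF cont]) (use that closure_G J(2) j_nonneg in auto)
  moreover have "J t \<le> M" if "t \<in> {a..T}" for t
    by (rule continuous_le_on_closure[OF cont]) (use that closure_G J(2) M(2) in auto)
  ultimately show ?thesis using that[OF K J] M(1) by blast
qed

text \<open>
  Compare \<open>\<Phi> y s - \<Phi> x s\<close> with \<open>\<Phi> y x - \<Phi> x x\<close> by means of the mixed second difference.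
\<close>

lemma Phi_lip:
  assumes "s \<in> {a..T}" "x \<in> {a..T}" "y \<in> {a..T}"
  shows "\<bar>\<Phi> y s - \<Phi> x s\<bar> \<le> 3 * L\<^sup>2 * (T - a) * \<bar>y - x\<bar>"
proof -
  have "\<bar>y - x\<bar> \<le> T - a" "\<bar>x - s\<bar> \<le> T - a" using assms by auto
  have "\<bar>\<Phi> y s - \<Phi> x s\<bar> \<le> \<bar>\<Phi> y s - \<Phi> y x - \<Phi> x s + \<Phi> x x\<bar> + \<Phi> y x"
    using Phi_diag[of x] Phi_nonneg[of y x] by linarith
  also have "\<dots> \<le> 2 * L\<^sup>2 * \<bar>y - x\<bar> * \<bar>s - x\<bar> + L\<^sup>2 * (y - x)\<^sup>2"
    using Phi_second[OF assms(2,3,2,1)] Phi_quad[OF assms(3,2)] by (rule add_mono)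
  also have "\<dots> = L\<^sup>2 * \<bar>y - x\<bar> * (2 * \<bar>s - x\<bar> + \<bar>y - x\<bar>)"
  proof -
    have "(y - x)\<^sup>2 = \<bar>y - x\<bar> * \<bar>y - x\<bar>" by (simp add: power2_eq_square)
    then show ?thesis by (simp only:) (simp add: distrib_left mult_ac del: abs_mult_self_eq)
  qed
  also have "\<dots> \<le> L\<^sup>2 * \<bar>y - x\<bar> * (3 * (T - a))"
  proof (rule mult_left_mono)
    have "2 * u + v \<le> 3 * w" if "u \<le> w" "v \<le> w" for u v w :: real using that by simp
    then show "2 * \<bar>s - x\<bar> + \<bar>y - x\<bar> \<le> 3 * (T - a)"
      using \<open>\<bar>y - x\<bar> \<le> T - a\<close> \<open>\<bar>x - s\<bar> \<le> T - a\<close> by (simp only: abs_minus_commute[of s x])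
  qed simp
  finally show ?thesis by (simp only: mult_ac)
qed

lemma Phi_continuous: "s \<in> {a..T} \<Longrightarrow> continuous_on {a..T} (\<lambda>t. \<Phi> t s)"
  by (rule lipschitz_on_continuous_on[of "3 * L\<^sup>2 * (T - a)"], rule lipschitz_onI)
     (use Phi_lip aT in \<open>auto simp: dist_real_def abs_minus_commute\<close>)

end

text \<open>
  \<open>J\<close> extends the energy to all times of the interval, as provided by \<open>j_extension\<close>. The continuity
  arguments below need the energy at every point, not only on \<open>G\<close>.
\<close>

locale evi_ext = evi +
  fixes J :: "real \<Rightarrow> real" and K M :: real
  assumes K: "0 \<le> K" "K-lipschitz_on {a..T} J" and J_eq: "t \<in> G \<Longrightarrow> J t = j t"
    and J_nonneg: "t \<in> {a..T} \<Longrightarrow> 0 \<le> J t" and M: "0 \<le> M" "t \<in> {a..T} \<Longrightarrow> J t \<le> M"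
begin

lemma J_lip: "s \<in> {a..T} \<Longrightarrow> t \<in> {a..T} \<Longrightarrow> \<bar>J t - J s\<bar> \<le> K * \<bar>t - s\<bar>"
  using lipschitz_onD[OF K(2), of t s] by (simp add: dist_real_def)

text \<open>
  Both sides are continuous in \<open>s\<close>, and \<open>G\<close> is dense.
\<close>

lemma evi_all:
  assumes s: "s \<in> {a..T}" and t: "t \<in> G"
  shows "r s t \<le> J s - J t + p / 2 * J t * \<Phi> t s"
proof -
  have t': "t \<in> {a..T}" using t G_sub by auto
  obtain \<sigma> where \<sigma>: "\<And>n. \<sigma> n \<in> G" "\<sigma> \<longlonglongrightarrow> s"
    using s closure_G closure_sequential by blast
  have \<sigma>': "\<sigma> n \<in> {a..T}" for n using \<sigma>(1) G_sub by blast
  have "(\<lambda>n. r (\<sigma> n) t) \<longlonglongrightarrow> r s t"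
  proof (rule LIM_zero_cancel, rule Lim_null_comparison)
    show "\<forall>\<^sub>F n in sequentially. norm (r (\<sigma> n) t - r s t) \<le> L\<^sup>2 * \<bar>\<sigma> n - s\<bar>"
      using r_lip[OF t \<sigma>' s] by simp
    show "(\<lambda>n. L\<^sup>2 * \<bar>\<sigma> n - s\<bar>) \<longlonglongrightarrow> 0"
      using \<sigma>(2) by (auto intro!: tendsto_mult_right_zero tendsto_rabs_zero LIM_zero)
  qed
  moreover have "(\<lambda>n. J (\<sigma> n) - J t + p / 2 * J t * \<Phi> (\<sigma> n) t) \<longlonglongrightarrow> J s - J t + p / 2 * J t * \<Phi> s t"
  proof -
    have "(\<lambda>n. J (\<sigma> n)) \<longlonglongrightarrow> J s"
      using continuous_on_tendsto_compose[OF lipschitz_on_continuous_on[OF K(2)] \<sigma>(2) s] \<sigma>' by simp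
    moreover have "(\<lambda>n. \<Phi> (\<sigma> n) t) \<longlonglongrightarrow> \<Phi> s t"
      using continuous_on_tendsto_compose[OF Phi_continuous[OF t'] \<sigma>(2) s] \<sigma>' by simp
    ultimately show ?thesis by (intro tendsto_intros)
  qed
  ultimately have "r s t \<le> J s - J t + p / 2 * J t * \<Phi> s t"
  proof (rule LIMSEQ_le)
    show "\<exists>N. \<forall>n\<ge>N. r (\<sigma> n) t \<le> J (\<sigma> n) - J t + p / 2 * J t * \<Phi> (\<sigma> n) t"
      using evi[OF \<sigma>(1) t] J_eq[OF \<sigma>(1)] J_eq[OF t] Phi_sym[of t] by auto
  qed
  then show ?thesis using Phi_sym[of t s] by simp
qed

lemma evi_integrated:
  assumes s: "s \<in> {a..T}" and xy: "a \<le> x" "x \<le> y" "y \<le> T"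
    and D: "\<And>t. x \<le> t \<Longrightarrow> t \<le> y \<Longrightarrow> J s - J t + p / 2 * J t * \<Phi> t s \<le> D"
  shows "(\<Phi> y s - \<Phi> x s) / 2 \<le> D * (y - x)"
proof -
  define r' where "r' t = (if t \<in> G then r s t else D)" for t
  have "(r' has_integral (\<Phi> y s - \<Phi> x s) / 2) {x..y}"
    by (rule has_integral_spike[OF G_null _ r_integral[OF s xy]]) (use xy in \<open>auto simp: r'_def\<close>)
  moreover have "((\<lambda>t. D) has_integral D * (y - x)) {x..y}"
    using has_integral_const_real[of D x y] xy by (simp add: mult.commute)
  moreover have "r' t \<le> D" if "t \<in> {x..y}" for t
    using that D[of t] evi_all[OF s, of t] by (auto simp: r'_def)
  ultimately show ?thesis by (rule has_integral_le)
qed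

text \<open>
  Otherwise \<open>J\<close> lies above a line of slope \<open>\<eta> > 0\<close> immediately to the right of some point \<open>s\<close>. With
  this \<open>s\<close> the inequality makes \<open>\<Phi> (s + e) s\<close> at most a negative multiple of \<open>\<eta> e\<^sup>2\<close> up to terms of
  order \<open>e\<^sup>3\<close>, which contradicts \<open>\<Phi> \<ge> 0\<close>.
\<close>

lemma J_antimono:
  assumes "a \<le> x" "x \<le> y" "y \<le> T"
  shows "J y \<le> J x"
proof (rule ccontr)
  assume "\<not> J y \<le> J x"
  then have less: "J x < J y" by simp
  then have "x < y" using assms(2) by (cases "x = y") auto
  define \<eta> where "\<eta> = (J y - J x) / (2 * (y - x))"
  have \<eta>: "0 < \<eta>" using less \<open>x < y\<close> by (simp add: \<eta>_def)
  define f where "f t = J t - J x - \<eta> * (t - x)" for t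
  have "\<eta> * (y - x) = (J y - J x) / 2" using \<open>x < y\<close> by (simp add: \<eta>_def field_simps)
  then have fy: "0 < f y" using less by (simp add: f_def)
  have cont: "continuous_on {x..y} f"
    unfolding f_def using lipschitz_on_continuous_on[OF K(2)] assms
    by (intro continuous_intros) (auto intro: continuous_on_subset)
  \<comment> \<open>to the right of the last point of this compact set, \<open>J\<close> stays above the line\<close>
  define S where "S = {t \<in> {x..y}. f t \<le> 0}"
  have "compact S"
    unfolding S_def using continuous_closed_preimage[OF cont closed_atLeastAtMost closed_atMost, of 0]
    by (auto simp: compact_eq_bounded_closed vimage_def Int_def conj_commute intro: bounded_subset[OF bounded_closed_interval[of x y]])
  moreover have "x \<in> S" using assms by (simp add: S_def f_def)
  ultimately obtain s where s: "s \<in> S" "\<And>t. t \<in> S \<Longrightarrow> t \<le> s"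
    using compact_attains_sup[of S] by blast
  have sxy: "x \<le> s" "s \<le> y" "f s \<le> 0" using s(1) by (auto simp: S_def)
  then have "s < y" using fy by (cases "s = y") auto
  have s': "s \<in> {a..T}" using sxy assms by auto
  have grow: "\<eta> * (t - s) \<le> J t - J s" if "s < t" "t \<le> y" for t
  proof -
    have "0 < f t" using s(2)[of t] that sxy by (force simp: S_def)
    then show ?thesis using sxy(3) by (simp add: f_def algebra_simps)
  qed
  define C where "C = p / 2 * M * L\<^sup>2"
  have C: "0 \<le> C" using p M by (simp add: C_def)
  have quad: "p / 2 * J t * \<Phi> t s \<le> C * e\<^sup>2" if "s \<le> t" "t \<le> s + e" "t \<le> y" for t e
  proof -
    have t: "t \<in> {a..T}" using that sxy assms by auto
    have "p / 2 * J t * \<Phi> t s \<le> p / 2 * M * (L\<^sup>2 * (t - s)\<^sup>2)"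
      using Phi_quad[OF t s'] p M(2)[OF t] M(1) J_nonneg[OF t] Phi_nonneg
      by (intro mult_mono mult_left_mono) auto
    also have "\<dots> \<le> p / 2 * M * (L\<^sup>2 * e\<^sup>2)"
      using that p M(1) by (intro mult_left_mono power_mono) auto
    finally show ?thesis by (simp add: C_def)
  qed
  \<comment> \<open>small enough for \<open>4 C e < \<eta>\<close>, so that the cubic error cannot compensate the slope\<close>
  define e where "e = min (y - s) (\<eta> / (4 * C + 1) / 2)"
  have e: "0 < e" "s + e \<le> y" using \<open>s < y\<close> \<eta> C by (auto simp: e_def)
  have e2: "(4 * C + 1) * e < \<eta>"
  proof -
    have "e \<le> \<eta> / (4 * C + 1) / 2" by (simp add: e_def)
    then have "(4 * C + 1) * e \<le> \<eta> / 2" using C by (simp add: field_simps)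
    then show ?thesis using \<eta> by simp
  qed
  have 1: "(\<Phi> (s + e / 2) s - \<Phi> s s) / 2 \<le> (C * e\<^sup>2) * (s + e / 2 - s)"
  proof (rule evi_integrated[OF s'])
    fix t assume t: "s \<le> t" "t \<le> s + e / 2"
    have "0 \<le> \<eta> * (t - s)" using t \<eta> by simp
    then have "J s \<le> J t" using grow[of t] t e by (cases "t = s") auto
    moreover have "p / 2 * J t * \<Phi> t s \<le> C * e\<^sup>2" by (rule quad) (use t e in auto)
    ultimately show "J s - J t + p / 2 * J t * \<Phi> t s \<le> C * e\<^sup>2" by linarith
  qed (use s' e assms in auto)
  have 2: "(\<Phi> (s + e) s - \<Phi> (s + e / 2) s) / 2 \<le> (C * e\<^sup>2 - \<eta> * (e / 2)) * (s + e - (s + e / 2))"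
  proof (rule evi_integrated[OF s'])
    fix t assume t: "s + e / 2 \<le> t" "t \<le> s + e"
    have "\<eta> * (e / 2) \<le> \<eta> * (t - s)" using t \<eta> by (intro mult_left_mono) auto
    then have "\<eta> * (e / 2) \<le> J t - J s" using grow[of t] t e by linarith
    moreover have "p / 2 * J t * \<Phi> t s \<le> C * e\<^sup>2" by (rule quad) (use t e in auto)
    ultimately show "J s - J t + p / 2 * J t * \<Phi> t s \<le> C * e\<^sup>2 - \<eta> * (e / 2)" by linarith
  qed (use s' e assms in auto)
  have "0 \<le> \<Phi> (s + e) s / 2" using Phi_nonneg by simp
  also have "\<dots> \<le> (C * e\<^sup>2) * (e / 2) + (C * e\<^sup>2 - \<eta> * (e / 2)) * (e / 2)"
    using 1 2 Phi_diag[of s] by (simp add: diff_divide_distrib)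
  also have "\<dots> = e\<^sup>2 / 4 * (4 * C * e - \<eta>)" by (simp add: power2_eq_square algebra_simps)
  finally have "0 \<le> 4 * C * e - \<eta>" using e(1) by (simp add: zero_le_mult_iff)
  then show False using e2 e(1) C by (simp add: algebra_simps)
qed

definition \<Lambda> :: real where "\<Lambda> = p * j a"

lemma \<Lambda>_nonneg: "0 \<le> \<Lambda>" using p j_nonneg[OF aG] by (simp add: \<Lambda>_def)

lemma pJ_le: "t \<in> {a..T} \<Longrightarrow> p / 2 * J t * \<Phi> t s \<le> \<Lambda> / 2 * \<Phi> t s"
  using J_antimono[of a t] J_eq[OF aG] p Phi_nonneg[of t s]
  by (intro mult_right_mono) (auto simp: \<Lambda>_def intro: mult_left_mono)

text \<open>
  Integrate the inequality from \<open>t\<close>, with \<open>s = t\<close>, up to the time \<open>\<tau>\<close> in \<open>{t..t+h}\<close>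
  where \<open>\<Phi> \<tau> t\<close> is largest; the condition on \<open>h\<close> allows the quadratic term to be absorbed by that maximum.
\<close>

lemma dissipation:
  assumes t: "a \<le> t" "0 < h" "t + h \<le> T" and h: "h * \<Lambda> \<le> 1 / 2"
  shows "\<Phi> (t + h) t \<le> 4 * h * (J t - J (t + h))"
proof -
  have t': "t \<in> {a..T}" using t by auto
  obtain m where m: "m \<in> {t..t+h}" "\<And>\<tau>. \<tau> \<in> {t..t+h} \<Longrightarrow> \<Phi> \<tau> t \<le> \<Phi> m t"
    using continuous_attains_sup[of "{t..t+h}" "\<lambda>\<tau>. \<Phi> \<tau> t"] continuous_on_subset[OF Phi_continuous[OF t']] t
    by (auto simp: subset_eq)
  have J: "J (t + h) \<le> J t" using J_antimono[of t "t + h"] t by simp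
  let ?D = "J t - J (t + h) + \<Lambda> / 2 * \<Phi> m t"
  have D: "0 \<le> ?D" using J \<Lambda>_nonneg Phi_nonneg by simp
  have "(\<Phi> m t - \<Phi> t t) / 2 \<le> ?D * (m - t)"
  proof (rule evi_integrated[OF t'])
    fix \<tau> assume \<tau>: "t \<le> \<tau>" "\<tau> \<le> m"
    then have "\<tau> \<in> {t..t+h}" using m(1) by auto
    then have "J (t + h) \<le> J \<tau>" "\<Phi> \<tau> t \<le> \<Phi> m t" using J_antimono[of \<tau> "t + h"] m(2) t by auto
    moreover have "p / 2 * J \<tau> * \<Phi> \<tau> t \<le> \<Lambda> / 2 * \<Phi> \<tau> t"
      by (rule pJ_le) (use \<open>\<tau> \<in> {t..t+h}\<close> t in auto)
    moreover have "\<Lambda> / 2 * \<Phi> \<tau> t \<le> \<Lambda> / 2 * \<Phi> m t"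
      using \<open>\<Phi> \<tau> t \<le> \<Phi> m t\<close> \<Lambda>_nonneg by (intro mult_left_mono) auto
    ultimately show "J t - J \<tau> + p / 2 * J \<tau> * \<Phi> \<tau> t \<le> ?D" by linarith
  qed (use m t in auto)
  also have "\<dots> \<le> ?D * h" using m(1) D by (intro mult_left_mono) auto
  also have "\<dots> = h * (J t - J (t + h)) + h * \<Lambda> * (\<Phi> m t / 2)" by (simp add: algebra_simps)
  also have "h * \<Lambda> * (\<Phi> m t / 2) \<le> 1 / 2 * (\<Phi> m t / 2)" using h Phi_nonneg by (intro mult_right_mono) auto
  finally have "\<Phi> m t \<le> 4 * h * (J t - J (t + h))" using Phi_diag[of t] by simp
  moreover have "\<Phi> (t + h) t \<le> \<Phi> m t" using m(2) t by simp
  ultimately show ?thesis by linarith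
qed

text \<open>
  Collects the errors of second order in \<open>contraction_step\<close>: from the variation of the energy, from
  that of \<open>\<Phi>\<close>, and from the mixed second difference.
\<close>

definition C2 :: real where "C2 = 4 * K + 6 * \<Lambda> * L\<^sup>2 * (T - a) + 2 * L\<^sup>2"

lemma C2_nonneg: "0 \<le> C2"
  using K(1) \<Lambda>_nonneg aT by (simp add: C2_def)

text \<open>
  Doubling of variables: the increment of \<open>\<Phi>\<close> along the diagonal is the sum of the increments in the
  two arguments, up to the mixed second difference, which is of order \<open>e\<^sup>2\<close>. In that sum the
  energies of the two time points cancel.
\<close>

lemma contraction_step:
  assumes t: "a \<le> t" "0 < h" "0 \<le> e" "t + h + e \<le> T"
  shows "\<Phi> (t + e + h) (t + e) \<le> (1 + 2 * \<Lambda> * e) * \<Phi> (t + h) t + C2 * e\<^sup>2"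
proof -
  let ?c = "3 * L\<^sup>2 * (T - a)"
  have c: "0 \<le> ?c" using aT by simp
  have m: "t \<in> {a..T}" "t + h \<in> {a..T}" "t + e \<in> {a..T}" "t + h + e \<in> {a..T}" using t by auto
  \<comment> \<open>the increment in one argument, used once for each of the two time points\<close>
  have half: "(\<Phi> (x + e) s - \<Phi> x s) / 2 \<le> (J s - J x + K * e + \<Lambda> / 2 * (\<Phi> x s + ?c * e)) * (x + e - x)"
    if s: "s \<in> {a..T}" and x: "x \<in> {a..T}" "x + e \<in> {a..T}" for x s
  proof (rule evi_integrated[OF s])
    fix \<tau> assume \<tau>: "x \<le> \<tau>" "\<tau> \<le> x + e"
    then have \<tau>': "\<tau> \<in> {a..T}" using x by auto
    have "J x - J \<tau> \<le> K * e"
    proof -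
      have "J x - J \<tau> \<le> K * \<bar>\<tau> - x\<bar>" using J_lip[OF x(1) \<tau>'] by linarith
      also have "\<dots> \<le> K * e" using \<tau> K(1) by (intro mult_left_mono) auto
      finally show ?thesis .
    qed
    moreover have "\<Phi> \<tau> s \<le> \<Phi> x s + ?c * e"
    proof -
      have "\<Phi> \<tau> s - \<Phi> x s \<le> ?c * \<bar>\<tau> - x\<bar>" using Phi_lip[OF s x(1) \<tau>'] by linarith
      also have "\<dots> \<le> ?c * e" using \<tau> c by (intro mult_left_mono) auto
      finally show ?thesis by simp
    qed
    then have "\<Lambda> / 2 * \<Phi> \<tau> s \<le> \<Lambda> / 2 * (\<Phi> x s + ?c * e)" using \<Lambda>_nonneg by (intro mult_left_mono) auto
    moreover note pJ_le[OF \<tau>', of s]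
    ultimately show "J s - J \<tau> + p / 2 * J \<tau> * \<Phi> \<tau> s \<le> J s - J x + K * e + \<Lambda> / 2 * (\<Phi> x s + ?c * e)"
      by linarith
  qed (use x t in auto)
  have "\<Phi> (t + h + e) (t + e) \<le> \<Phi> (t + h + e) t + \<Phi> (t + h) (t + e) - \<Phi> (t + h) t + 2 * L\<^sup>2 * e * e"
    using Phi_second[OF m(2,4,1,3)] t by simp
  also have "\<Phi> (t + h) (t + e) = \<Phi> (t + e) (t + h)" by (rule Phi_sym)
  also have "\<Phi> (t + h + e) t + \<Phi> (t + e) (t + h) - \<Phi> (t + h) t + 2 * L\<^sup>2 * e * e \<le>
      (1 + 2 * \<Lambda> * e) * \<Phi> (t + h) t + C2 * e\<^sup>2"
  proof -
    let ?P = "\<Phi> (t + h) t"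
    have "\<Phi> (t + h + e) t - ?P \<le> 2 * ((J t - J (t + h) + K * e + \<Lambda> / 2 * (?P + ?c * e)) * e)"
      using half[OF m(1,2,4)] by simp
    moreover have "\<Phi> (t + e) (t + h) - ?P \<le> 2 * ((J (t + h) - J t + K * e + \<Lambda> / 2 * (?P + ?c * e)) * e)"
      using half[OF m(2,1,3)] Phi_sym[of t "t + h"] by simp
    moreover have "2 * ((J t - J (t + h) + K * e + \<Lambda> / 2 * (?P + ?c * e)) * e)
        + 2 * ((J (t + h) - J t + K * e + \<Lambda> / 2 * (?P + ?c * e)) * e) + 2 * L\<^sup>2 * e * e
        = 2 * \<Lambda> * e * ?P + C2 * e\<^sup>2"
      by (simp add: C2_def power2_eq_square algebra_simps)
    moreover have "(1 + 2 * \<Lambda> * e) * ?P = ?P + 2 * \<Lambda> * e * ?P" by (simp only: distrib_right mult_1)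
    ultimately show ?thesis by linarith
  qed
  finally show ?thesis by (simp add: algebra_simps)
qed

text \<open>
  Iterate the previous step with \<open>e = \<tau> / n\<close>; the accumulated error \<open>n e\<^sup>2\<close> vanishes in the limit.
\<close>

lemma contraction:
  assumes t: "a \<le> t" "0 < h" "0 \<le> \<tau>" "t + \<tau> + h \<le> T"
  shows "\<Phi> (t + \<tau> + h) (t + \<tau>) \<le> exp (2 * \<Lambda> * \<tau>) * \<Phi> (t + h) t"
proof -
  have fin: "\<Phi> (t + \<tau> + h) (t + \<tau>) \<le> exp (2 * \<Lambda> * \<tau>) * (\<Phi> (t + h) t + C2 * \<tau>\<^sup>2 * inverse (real (Suc N)))" for N
  proof -
    define e where "e = \<tau> / real (Suc N)"
    have e: "0 \<le> e" "real (Suc N) * e = \<tau>" using t by (auto simp: e_def)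
    have *: "\<Phi> (t + real n * e + h) (t + real n * e) \<le> (1 + 2 * \<Lambda> * e) ^ n * (\<Phi> (t + h) t + C2 * e\<^sup>2 * real n)" if "n \<le> Suc N" for n
      using that
    proof (induction n)
      case (Suc n)
      have "real (Suc n) * e \<le> real (Suc N) * e" using Suc.prems e(1) by (intro mult_right_mono) auto
      then have le: "t + real n * e + h + e \<le> T" using e(2) t by (simp add: algebra_simps)
      have pw: "1 \<le> (1 + 2 * \<Lambda> * e) ^ k" for k using \<Lambda>_nonneg e(1) by (intro one_le_power) simp
      have "\<Phi> (t + real n * e + e + h) (t + real n * e + e)
          \<le> (1 + 2 * \<Lambda> * e) * \<Phi> (t + real n * e + h) (t + real n * e) + C2 * e\<^sup>2"
      proof (rule contraction_step)
        have "0 \<le> real n * e" using e(1) by simp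
        then show "a \<le> t + real n * e" using t(1) by linarith
      qed (use t e(1) le in auto)
      also have "\<dots> \<le> (1 + 2 * \<Lambda> * e) * ((1 + 2 * \<Lambda> * e) ^ n * (\<Phi> (t + h) t + C2 * e\<^sup>2 * real n)) + (1 + 2 * \<Lambda> * e) ^ Suc n * (C2 * e\<^sup>2)"
      proof (rule add_mono)
        show "(1 + 2 * \<Lambda> * e) * \<Phi> (t + real n * e + h) (t + real n * e)
            \<le> (1 + 2 * \<Lambda> * e) * ((1 + 2 * \<Lambda> * e) ^ n * (\<Phi> (t + h) t + C2 * e\<^sup>2 * real n))"
          using Suc \<Lambda>_nonneg e(1) by (intro mult_left_mono) auto
        show "C2 * e\<^sup>2 \<le> (1 + 2 * \<Lambda> * e) ^ Suc n * (C2 * e\<^sup>2)"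
          using mult_right_mono[OF pw[of "Suc n"], of "C2 * e\<^sup>2"] C2_nonneg by simp
      qed
      also have "\<dots> = (1 + 2 * \<Lambda> * e) ^ Suc n * (\<Phi> (t + h) t + C2 * e\<^sup>2 * real (Suc n))"
        by (simp add: algebra_simps)
      finally show ?case by (simp add: algebra_simps)
    qed simp
    have "(1 + 2 * \<Lambda> * e) ^ Suc N \<le> exp (2 * \<Lambda> * e) ^ Suc N"
      using \<Lambda>_nonneg e(1) exp_ge_add_one_self[of "2 * \<Lambda> * e"] by (intro power_mono) auto
    also have "\<dots> = exp (2 * \<Lambda> * \<tau>)"
      unfolding exp_of_nat_mult[symmetric] e(2)[symmetric] by (simp add: mult_ac)
    finally have ex: "(1 + 2 * \<Lambda> * e) ^ Suc N \<le> exp (2 * \<Lambda> * \<tau>)" .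
    have "e\<^sup>2 * real (Suc N) = \<tau>\<^sup>2 * inverse (real (Suc N))"
      unfolding e_def by (simp add: power2_eq_square field_simps del: of_nat_Suc)
    then have eq: "C2 * e\<^sup>2 * real (Suc N) = C2 * \<tau>\<^sup>2 * inverse (real (Suc N))" by (simp only: mult.assoc)
    have "\<Phi> (t + \<tau> + h) (t + \<tau>) \<le> (1 + 2 * \<Lambda> * e) ^ Suc N * (\<Phi> (t + h) t + C2 * \<tau>\<^sup>2 * inverse (real (Suc N)))"
      using *[of "Suc N"] unfolding e(2) eq by simp
    also have "\<dots> \<le> exp (2 * \<Lambda> * \<tau>) * (\<Phi> (t + h) t + C2 * \<tau>\<^sup>2 * inverse (real (Suc N)))"
      using ex Phi_nonneg C2_nonneg by (intro mult_right_mono add_nonneg_nonneg) auto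
    finally show ?thesis .
  qed
  have "(\<lambda>N. exp (2 * \<Lambda> * \<tau>) * (\<Phi> (t + h) t + C2 * \<tau>\<^sup>2 * inverse (real (Suc N))))
      \<longlonglongrightarrow> exp (2 * \<Lambda> * \<tau>) * (\<Phi> (t + h) t + C2 * \<tau>\<^sup>2 * 0)"
    by (intro tendsto_intros LIMSEQ_inverse_real_of_nat)
  then have "\<Phi> (t + \<tau> + h) (t + \<tau>) \<le> exp (2 * \<Lambda> * \<tau>) * (\<Phi> (t + h) t + C2 * \<tau>\<^sup>2 * 0)"
    by (rule LIMSEQ_le_const) (use fin in blast)
  then show ?thesis by simp
qed

text \<open>
  By \<open>contraction\<close> the displacement at \<open>b\<close> is controlled by each of the displacements at
  \<open>b - k h\<close>, for \<open>k = 0..n\<close> with \<open>n\<close> about \<open>1 / h\<close>. By \<open>dissipation\<close> the sum of these is at most a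
  constant times \<open>h j(a)\<close>, so their mean is of order \<open>h\<^sup>2\<close>.
\<close>

lemma uniform_speed:
  assumes b: "a + 1 \<le> b" "b + h \<le> T" and h: "0 < h" "h \<le> 1" "h * \<Lambda> \<le> 1 / 2"
  shows "\<Phi> (b + h) b \<le> 4 * exp (2 * \<Lambda>) * j a * h\<^sup>2"
proof -
  \<comment> \<open>the largest number of steps of length \<open>h\<close> that fit into a unit of time\<close>
  define n where "n = nat \<lfloor>1 / h\<rfloor>"
  have n1: "real n * h \<le> 1"
  proof -
    have "real n \<le> 1 / h" unfolding n_def using h by (intro of_nat_floor) simp
    then show ?thesis using h by (simp add: field_simps)
  qed
  have n2: "1 \<le> real (Suc n) * h"
  proof -
    have "1 / h \<le> real (Suc n)" unfolding n_def by linarith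
    then show ?thesis using h by (simp add: field_simps)
  qed
  define \<sigma> where "\<sigma> k = b + h - real k * h" for k
  have step: "\<Phi> (b + h) b \<le> exp (2 * \<Lambda>) * (4 * h * (J (\<sigma> (Suc k)) - J (\<sigma> k)))" if "k < Suc n" for k
  proof -
    have "real k * h \<le> real n * h" using that h by (intro mult_right_mono) auto
    then have kh: "real k * h \<le> 1" "0 \<le> real k * h" using n1 h by (linarith, simp)
    let ?t = "b - real k * h"
    have t: "a \<le> ?t" "?t + h \<le> T" using kh b h by linarith+
    have "\<Phi> (?t + real k * h + h) (?t + real k * h) \<le> exp (2 * \<Lambda> * (real k * h)) * \<Phi> (?t + h) ?t"
      by (rule contraction) (use t kh b h in auto)
    also have "\<dots> \<le> exp (2 * \<Lambda>) * \<Phi> (?t + h) ?t"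
      using kh \<Lambda>_nonneg Phi_nonneg by (intro mult_right_mono) (auto simp: mult_left_le)
    also have "\<dots> \<le> exp (2 * \<Lambda>) * (4 * h * (J ?t - J (?t + h)))"
      by (intro mult_left_mono dissipation) (use t b h in auto)
    also have "J ?t - J (?t + h) = J (\<sigma> (Suc k)) - J (\<sigma> k)"
      by (simp add: \<sigma>_def algebra_simps)
    finally show ?thesis by simp
  qed
  have "real (Suc n) * \<Phi> (b + h) b = (\<Sum>k<Suc n. \<Phi> (b + h) b)" by simp
  also have "\<dots> \<le> (\<Sum>k<Suc n. exp (2 * \<Lambda>) * (4 * h * (J (\<sigma> (Suc k)) - J (\<sigma> k))))"
    by (rule sum_mono) (use step in auto)
  also have "\<dots> = exp (2 * \<Lambda>) * (4 * h * (J (\<sigma> (Suc n)) - J (\<sigma> 0)))"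
    by (simp only: sum_distrib_left[symmetric] sum_lessThan_telescope[of "\<lambda>k. J (\<sigma> k)"])
  also have "\<dots> \<le> exp (2 * \<Lambda>) * (4 * h * j a)"
  proof -
    have s: "\<sigma> (Suc n) = b - real n * h" "\<sigma> 0 = b + h" by (auto simp: \<sigma>_def algebra_simps)
    have "J (\<sigma> (Suc n)) \<le> j a"
      unfolding s J_eq[OF aG, symmetric] by (rule J_antimono) (use n1 b h mult_nonneg_nonneg[of "real n" h] in linarith)+
    moreover have "0 \<le> J (\<sigma> 0)" unfolding s by (rule J_nonneg) (use b h in auto)
    ultimately show ?thesis using h by (intro mult_left_mono) auto
  qed
  finally have "h * (real (Suc n) * \<Phi> (b + h) b) \<le> h * (exp (2 * \<Lambda>) * (4 * h * j a))"
    using h by (intro mult_left_mono) auto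
  moreover have "\<Phi> (b + h) b \<le> (real (Suc n) * h) * \<Phi> (b + h) b"
    using mult_right_mono[OF n2 Phi_nonneg[of "b + h" b]] by simp
  ultimately show ?thesis by (simp add: power2_eq_square mult_ac)
qed

end

context evi begin

lemma evi_ext_exists: "\<exists>J K M. evi_ext a T L p G \<Phi> r j J K M"
proof (rule j_extension)
  fix J K M
  assume "0 \<le> K" "K-lipschitz_on {a..T} J" "\<And>t. t \<in> G \<Longrightarrow> J t = j t"
    "\<And>t. t \<in> {a..T} \<Longrightarrow> 0 \<le> J t" "0 \<le> M" "\<And>t. t \<in> {a..T} \<Longrightarrow> J t \<le> M"
  then have "evi_ext a T L p G \<Phi> r j J K M"
    by (intro evi_ext.intro evi_ext_axioms.intro evi_axioms)
  then show ?thesis by blast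
qed

theorem energy_nonincreasing:
  assumes t: "t \<in> G"
  shows "j t \<le> j a"
proof -
  obtain J K M where "evi_ext a T L p G \<Phi> r j J K M" using evi_ext_exists by blast
  then interpret evi_ext a T L p G \<Phi> r j J K M .
  show "j t \<le> j a" using J_antimono[of a t] J_eq[OF t] J_eq[OF aG] t G_sub by auto
qed

theorem speed_bound:
  assumes "a + 1 \<le> b" "b + h \<le> T" "0 < h" "h \<le> 1" "h * (p * j a) \<le> 1 / 2"
  shows "\<Phi> (b + h) b \<le> 4 * exp (2 * (p * j a)) * j a * h\<^sup>2"
proof -
  obtain J K M where "evi_ext a T L p G \<Phi> r j J K M" using evi_ext_exists by blast
  then interpret evi_ext a T L p G \<Phi> r j J K M .
  show ?thesis using uniform_speed[of b h] assms by (simp add: \<Lambda>_def)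
qed

end

section \<open>The equation in integrated form\<close>

text \<open>
  Test with smooth approximations \<open>\<phi>\<^sub>n\<close> of the indicator of \<open>{a..b}\<close> whose derivatives concentrate at
  the two end points: the left-hand side tends to \<open>c a - c b\<close> by continuity of \<open>c\<close>, the right-hand
  side to minus the integral of \<open>v\<close>. The open conditions \<open>0 < a\<close> and \<open>b < T\<close> leave room for the
  supports.
\<close>

lemma weak_derivative_integral:
  fixes c v :: "real \<Rightarrow> real"
  assumes c: "continuous_on {0..T} c" and v: "v \<in> borel_measurable (lebesgue_on {0..T})"
    and V: "AE t in lebesgue_on {0..T}. \<bar>v t\<bar> \<le> V"
    and weak: "\<And>\<phi>. test_function {0<..<T} \<phi> \<Longrightarrow>
      (LINT t|lebesgue_on {0..T}. deriv \<phi> t * c t) = - (LINT t|lebesgue_on {0..T}. \<phi> t * v t)"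
    and ab: "0 < a" "a < b" "b < T"
  shows "(v has_integral c b - c a) {a..b}"
proof -
  let ?M = "lebesgue_on {0..T}"
  obtain B m where step: "0 < m \<and> (\<forall>y. (B has_real_derivative bump y / m) (at y)) \<and>
    (\<forall>y\<le>-1. B y = 0) \<and> (\<forall>y\<ge>1. B y = 1) \<and> mono B"
    using smooth_step_exists by (elim exE) (rule that)
  then have B: "0 < m" "\<And>y. (B has_real_derivative bump y / m) (at y)"
    "\<And>y. y \<le> -1 \<Longrightarrow> B y = 0" "\<And>y. 1 \<le> y \<Longrightarrow> B y = 1" "\<And>y z. y \<le> z \<Longrightarrow> B y \<le> B z"
    by (simp_all add: monoD)
  have dB: "((\<lambda>t. B (k * (t - d))) has_real_derivative bump (k * (t - d)) * (k / m)) (at t)" for k d t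
  proof -
    have "((\<lambda>t. k * (t - d)) has_real_derivative k) (at t)" by (auto intro!: derivative_eq_intros)
    from DERIV_chain2[OF B(2) this] show ?thesis by simp
  qed
  have B01: "0 \<le> B y" "B y \<le> 1" for y
    using B(5)[of y "max y 1"] B(4)[of "max y 1"] B(5)[of "min y (-1)" y] B(3)[of "min y (-1)"] by auto
  have bcont: "continuous_on S (\<lambda>t. bump (k * (t - d)))" for S k d
    using smooth_continuous[OF smooth_bump_affine] continuous_on_subset by blast
  \<comment> \<open>for \<open>k \<ge> R\<close> bumps of radius \<open>1 / k\<close> at \<open>a\<close> and \<open>b\<close> stay away from \<open>0\<close> and \<open>T\<close>\<close>
  define R where "R = 2 / min a (T - b)"
  have R: "0 < R" using ab by (simp add: R_def)
  have inR: "1 / k \<le> a / 2" "1 / k \<le> (T - b) / 2" "0 < k" if "R \<le> k" for k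
  proof -
    show k: "0 < k" using R that by simp
    have "1 / k \<le> 1 / R" using R that by (intro divide_left_mono) auto
    then have "1 / k \<le> min a (T - b) / 2" by (simp add: R_def)
    then show "1 / k \<le> a / 2" "1 / k \<le> (T - b) / 2" by auto
  qed
  define k where "k n = R + real n" for n
  have kR: "R \<le> k n" for n by (simp add: k_def)
  note kpos = inR(3)[OF kR]
  have k_top: "filterlim k at_top sequentially"
    unfolding k_def by (intro filterlim_tendsto_add_at_top[OF tendsto_const] filterlim_real_sequentially)
  have conc: "(\<lambda>n. LINT t|?M. (bump (k n * (t - d)) * (k n / m)) * c t) \<longlonglongrightarrow> c d"
    if d: "a \<le> d" "d \<le> b" for d
  proof (rule LIMSEQ_I)
    fix \<epsilon> :: real assume "\<epsilon> > 0"
    have "d \<in> {0..T}" using d ab by auto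
    then obtain \<eta> where \<eta>: "\<eta> > 0" "\<And>t. t \<in> {0..T} \<Longrightarrow> dist t d < \<eta> \<Longrightarrow> dist (c t) (c d) < \<epsilon> / 2"
      using c \<open>\<epsilon> > 0\<close> unfolding continuous_on_iff by (metis half_gt_zero)
    obtain N :: nat where N: "1 / \<eta> < real N" using reals_Archimedean2 by blast
    show "\<exists>N. \<forall>n\<ge>N. norm ((LINT t|?M. (bump (k n * (t - d)) * (k n / m)) * c t) - c d) < \<epsilon>"
    proof (intro exI[of _ N] allI impI)
      fix n assume n: "N \<le> n"
      have kn: "1 / k n < \<eta>"
      proof -
        have "1 / \<eta> < k n" using N n R by (simp add: k_def)
        then show ?thesis using \<eta>(1) kpos[of n] by (simp add: field_simps)
      qed
      let ?\<rho> = "\<lambda>t. bump (k n * (t - d)) * (k n / m)"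
      have \<rho>0: "0 \<le> ?\<rho> t" for t using bump_nonneg kpos[of n] B(1) by simp
      have \<rho>i: "integrable ?M ?\<rho>"
        by (intro continuous_imp_integrable_real continuous_intros bcont)
      have \<rho>ci: "integrable ?M (\<lambda>t. ?\<rho> t * c t)"
        by (intro continuous_imp_integrable_real continuous_intros bcont c)
      have \<rho>1: "(LINT t|?M. ?\<rho> t) = 1"
      proof -
        have "(?\<rho> has_integral (B (k n * (T - d)) - B (k n * (0 - d)))) {0..T}"
          using ab dB by (intro fundamental_theorem_of_calculus)
            (auto simp: has_real_derivative_iff_has_vector_derivative[symmetric] intro: DERIV_subset)
        moreover have "B (k n * (T - d)) = 1"
        proof (rule B(4))
          have "k n * (1 / k n) \<le> k n * (T - d)"
            using inR(2)[OF kR[of n]] d ab kpos[of n] by (intro mult_left_mono) auto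
          then show "1 \<le> k n * (T - d)" using kpos[of n] by simp
        qed
        moreover have "B (k n * (0 - d)) = 0"
        proof (rule B(3))
          have "k n * (1 / k n) \<le> k n * d"
            using inR(1)[OF kR[of n]] d ab kpos[of n] by (intro mult_left_mono) auto
          then show "k n * (0 - d) \<le> -1" using kpos[of n] by simp
        qed
        ultimately have "(?\<rho> has_integral 1) {0..T}" by simp
        then have "integral {0..T} ?\<rho> = 1" by (rule integral_unique)
        moreover have "(LINT t|?M. ?\<rho> t) = integral {0..T} ?\<rho>"
          by (rule lebesgue_integral_eq_integral[OF \<rho>i]) simp
        ultimately show ?thesis by (simp only:)
      qed
      have "(LINT t|?M. ?\<rho> t * c t) - c d = (LINT t|?M. ?\<rho> t * c t) - (LINT t|?M. ?\<rho> t) * c d"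
        by (simp only: \<rho>1 mult_1)
      also have "\<dots> = (LINT t|?M. ?\<rho> t * c t) - (LINT t|?M. ?\<rho> t * c d)"
        by (simp only: integral_mult_left_zero)
      also have "\<dots> = (LINT t|?M. ?\<rho> t * c t - ?\<rho> t * c d)"
        by (rule Bochner_Integration.integral_diff[symmetric]) (intro \<rho>ci integrable_mult_left \<rho>i)+
      finally have eq: "(LINT t|?M. ?\<rho> t * c t) - c d = (LINT t|?M. ?\<rho> t * c t - ?\<rho> t * c d)" .
      have "norm (LINT t|?M. ?\<rho> t * c t - ?\<rho> t * c d) \<le> (LINT t|?M. ?\<rho> t * (\<epsilon> / 2))"
      proof (rule Bochner_Integration.integral_norm_bound_integral)
        show "integrable ?M (\<lambda>t. ?\<rho> t * c t - ?\<rho> t * c d)"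
          by (intro Bochner_Integration.integrable_diff integrable_mult_left \<rho>i \<rho>ci)
        show "integrable ?M (\<lambda>t. ?\<rho> t * (\<epsilon> / 2))" by (intro integrable_mult_left \<rho>i)
        fix t assume "t \<in> space ?M"
        then have t: "t \<in> {0..T}" by simp
        show "norm (?\<rho> t * c t - ?\<rho> t * c d) \<le> ?\<rho> t * (\<epsilon> / 2)"
        proof (cases "\<bar>k n * (t - d)\<bar> < 1")
          case True
          then have "\<bar>t - d\<bar> * k n < 1" using kpos[of n] by (simp add: abs_mult mult.commute)
          then have "\<bar>t - d\<bar> < 1 / k n" using kpos[of n] by (simp add: field_simps)
          then have "\<bar>c t - c d\<bar> \<le> \<epsilon> / 2" using \<eta>(2)[OF t] kn by (simp add: dist_real_def less_imp_le)
          then have "?\<rho> t * \<bar>c t - c d\<bar> \<le> ?\<rho> t * (\<epsilon> / 2)" using \<rho>0 by (rule mult_left_mono)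
          moreover have "norm (?\<rho> t * c t - ?\<rho> t * c d) = ?\<rho> t * \<bar>c t - c d\<bar>"
            unfolding right_diff_distrib[symmetric] real_norm_def abs_mult[of "?\<rho> t"]
            by (simp only: abs_of_nonneg[OF \<rho>0])
          ultimately show ?thesis by simp
        next
          case False
          then show ?thesis by (simp add: bump_zero)
        qed
      qed
      also have "\<dots> = (LINT t|?M. ?\<rho> t) * (\<epsilon> / 2)" by (rule integral_mult_left_zero)
      also have "\<dots> = \<epsilon> / 2" by (simp only: \<rho>1 mult_1)
      also have "\<dots> < \<epsilon>" using \<open>\<epsilon> > 0\<close> by simp
      finally show "norm ((LINT t|?M. ?\<rho> t * c t) - c d) < \<epsilon>" unfolding eq .
    qed
  qed
  define \<phi> where "\<phi> n t = B (k n * (t - a)) - B (k n * (t - b))" for n t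
  have d\<phi>: "(\<phi> n has_real_derivative bump (k n * (t - a)) * (k n / m) - bump (k n * (t - b)) * (k n / m)) (at t)" for n t
    unfolding \<phi>_def by (intro DERIV_diff dB)
  have \<phi>01: "\<bar>\<phi> n t\<bar> \<le> 1" for n t
    using B01[of "k n * (t - a)"] B01[of "k n * (t - b)"] by (simp add: \<phi>_def abs_le_iff)
  have \<phi>test: "test_function {0<..<T} (\<phi> n)" for n
  proof (rule test_functionI[of _ "{a / 2..(b + T) / 2}"])
    show "smooth (\<phi> n)"
      by (rule smooth_of_real_derivative[OF d\<phi>])
        (intro smooth_diff smooth_mult smooth_bump_affine smooth_const)
    show "\<phi> n t = 0" if "t \<notin> {a / 2..(b + T) / 2}" for t
    proof -
      have big: "1 \<le> k n * x" if "1 / k n \<le> x" for x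
        using that kpos[of n] by (simp add: field_simps)
      consider "t < a / 2" | "t > (b + T) / 2" using \<open>t \<notin> {a / 2..(b + T) / 2}\<close> by fastforce
      then show ?thesis
      proof cases
        case 1
        have "1 \<le> k n * (a - t)" "1 \<le> k n * (b - t)"
          using inR(1)[OF kR[of n]] 1 ab by (intro big; linarith)+
        then have "k n * (t - a) \<le> -1" "k n * (t - b) \<le> -1" by (simp_all add: algebra_simps)
        then show ?thesis by (simp add: \<phi>_def B(3))
      next
        case 2
        have "1 \<le> k n * (t - a)" "1 \<le> k n * (t - b)"
          using inR(2)[OF kR[of n]] 2 ab by (intro big; argo)+
        then show ?thesis by (simp add: \<phi>_def B(4))
      qed
    qed
    show "{a / 2..(b + T) / 2} \<subseteq> {0<..<T}" using ab by auto
  qed auto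
  have i\<rho>: "integrable ?M (\<lambda>t. (bump (k n * (t - d)) * (k n / m)) * c t)" for n d
    by (intro continuous_imp_integrable_real continuous_intros bcont c)
  have lhs: "(\<lambda>n. LINT t|?M. deriv (\<phi> n) t * c t) \<longlonglongrightarrow> c a - c b"
  proof -
    have "(LINT t|?M. deriv (\<phi> n) t * c t)
        = (LINT t|?M. (bump (k n * (t - a)) * (k n / m)) * c t) - (LINT t|?M. (bump (k n * (t - b)) * (k n / m)) * c t)" for n
      using i\<rho>[of n a] i\<rho>[of n b] by (simp add: DERIV_imp_deriv[OF d\<phi>] left_diff_distrib)
    then show ?thesis using tendsto_diff[OF conc[of a] conc[of b]] ab by simp
  qed
  \<comment> \<open>the pointwise limit of \<open>\<phi>\<^sub>n\<close>, with the exact values at the two jumps\<close>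
  define \<zeta> where "\<zeta> t = (if t = a then B 0 else if t = b then 1 - B 0 else if t \<in> {a..b} then 1 else 0)" for t
  have up: "\<forall>\<^sub>F n in sequentially. B (k n * x) = 1" if "0 < x" for x
  proof -
    have "filterlim (\<lambda>n. k n * x) at_top sequentially"
      by (rule filterlim_at_top_mult_tendsto_pos[OF tendsto_const that k_top])
    then have "\<forall>\<^sub>F n in sequentially. 1 \<le> k n * x" by (simp add: filterlim_at_top)
    then show ?thesis by eventually_elim (rule B(4))
  qed
  have down: "\<forall>\<^sub>F n in sequentially. B (k n * x) = 0" if "x < 0" for x
  proof -
    have "filterlim (\<lambda>n. k n * (- x)) at_top sequentially"
      using that by (intro filterlim_at_top_mult_tendsto_pos[OF tendsto_const _ k_top]) simp
    then have "\<forall>\<^sub>F n in sequentially. 1 \<le> k n * (- x)" unfolding filterlim_at_top by blast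
    then show ?thesis by eventually_elim (rule B(3), simp)
  qed
  have \<phi>lim: "(\<lambda>n. \<phi> n t) \<longlonglongrightarrow> \<zeta> t" for t
  proof -
    consider "t < a" | "t = a" | "a < t" "t < b" | "t = b" | "b < t" by linarith
    then have "\<forall>\<^sub>F n in sequentially. \<phi> n t = \<zeta> t"
    proof cases
      case 1
      then show ?thesis using down[of "t - a"] down[of "t - b"] ab
        by (auto simp: \<phi>_def \<zeta>_def elim: eventually_elim2)
    next
      case 2
      then show ?thesis using down[of "t - b"] ab
        by (auto simp: \<phi>_def \<zeta>_def elim: eventually_mono)
    next
      case 3
      then show ?thesis using up[of "t - a"] down[of "t - b"] ab
        by (auto simp: \<phi>_def \<zeta>_def elim: eventually_elim2)
    next
      case 4
      then show ?thesis using up[of "t - a"] ab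
        by (auto simp: \<phi>_def \<zeta>_def elim: eventually_mono)
    next
      case 5
      then show ?thesis using up[of "t - a"] up[of "t - b"] ab
        by (auto simp: \<phi>_def \<zeta>_def elim: eventually_elim2)
    qed
    then show ?thesis by (rule tendsto_eventually)
  qed
  have fin: "finite_measure ?M" by (rule finite_measure_lebesgue_on) auto
  have \<phi>m: "\<phi> n \<in> borel_measurable ?M" for n
    using smooth_continuous[OF test_function_smooth[OF \<phi>test]]
    by (intro continuous_imp_measurable_on_sets_lebesgue) (auto intro: continuous_on_subset)
  have \<zeta>m: "\<zeta> \<in> borel_measurable ?M"
    by (rule borel_measurable_LIMSEQ_real[OF \<phi>lim \<phi>m])
  have iV: "integrable ?M (\<lambda>t. V)" using fin finite_measure.integrable_const by blast
  have ae1: "AE t in ?M. (\<lambda>n. \<phi> n t * v t) \<longlonglongrightarrow> \<zeta> t * v t"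
    by (intro AE_I2 tendsto_mult tendsto_const \<phi>lim)
  have ae2: "AE t in ?M. norm (\<phi> n t * v t) \<le> V" for n
    using V
  proof eventually_elim
    case (elim t)
    have "\<bar>\<phi> n t\<bar> * \<bar>v t\<bar> \<le> 1 * \<bar>v t\<bar>" using \<phi>01 by (rule mult_right_mono) simp
    then show ?case using elim by (simp add: abs_mult)
  qed
  have m1: "(\<lambda>t. \<zeta> t * v t) \<in> borel_measurable ?M" "(\<lambda>t. \<phi> n t * v t) \<in> borel_measurable ?M" for n
    using \<zeta>m \<phi>m v by measurable
  have rhs: "(\<lambda>n. LINT t|?M. \<phi> n t * v t) \<longlonglongrightarrow> (LINT t|?M. \<zeta> t * v t)"
    by (rule integral_dominated_convergence[OF m1 iV ae1 ae2])
  have int: "integrable ?M (\<lambda>t. \<zeta> t * v t)"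
    by (rule integrable_dominated_convergence[OF m1 iV ae1 ae2])
  have "(\<lambda>n. - (LINT t|?M. \<phi> n t * v t)) \<longlonglongrightarrow> c a - c b"
    using lhs weak[OF \<phi>test] by simp
  then have "- (LINT t|?M. \<zeta> t * v t) = c a - c b"
    using LIMSEQ_unique tendsto_minus[OF rhs] by blast
  then have "(LINT t|?M. \<zeta> t * v t) = c b - c a" by linarith
  then have "((\<lambda>t. \<zeta> t * v t) has_integral c b - c a) {0..T}"
    using has_integral_integral_lebesgue_on[OF int] by simp
  then have "((\<lambda>t. if t \<in> {a..b} then v t else 0) has_integral c b - c a) {0..T}"
    by (rule has_integral_spike_finite[of "{a, b}", rotated 2]) (auto simp: \<zeta>_def)
  then show ?thesis using ab by (subst (asm) has_integral_restrict) auto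
qed

context bounded_open begin

lemma strong_solution_continuous:
  assumes sol: "strong_solution \<Omega> p u0 T u" and g: "g \<in> L2 \<Omega>"
  shows "continuous_on {0..T} (\<lambda>t. ip (u t) g)"
  unfolding continuous_on_def
proof
  fix t assume t: "t \<in> {0..T}"
  have uA: "u s \<in> dom_A \<Omega>" if "s \<in> {0..T}" for s
    using sol that by (auto simp: strong_solution_def time_C_def)
  have lim: "((\<lambda>s. nrm (opA (\<lambda>x. u s x - u t x))) \<longlongrightarrow> 0) (at t within {0..T})"
    using sol t by (auto simp: strong_solution_def time_C_def)
  obtain C where C: "0 \<le> C" "\<And>f. f \<in> dom_A \<Omega> \<Longrightarrow> nrm f \<le> C * nrm (opA f)"
    using L2_norm_le_op_A by blast
  show "((\<lambda>t. ip (u t) g) \<longlongrightarrow> ip (u t) g) (at t within {0..T})"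
  proof (rule LIM_zero_cancel, rule Lim_null_comparison)
    show "\<forall>\<^sub>F s in at t within {0..T}. norm (ip (u s) g - ip (u t) g)
        \<le> C * nrm (opA (\<lambda>x. u s x - u t x)) * nrm g"
      unfolding eventually_at_filter
    proof (intro always_eventually allI impI)
      fix s assume "s \<noteq> t" and s: "s \<in> {0..T}"
      note d = dom_A_diff[OF uA[OF s] uA[OF t]]
      have "norm (ip (u s) g - ip (u t) g) \<le> nrm (\<lambda>x. u s x - u t x) * nrm g"
        using L2_Cauchy_Schwarz[OF dom_A_L2[OF d] g]
        by (simp add: L2_inner_diff dom_A_L2[OF uA[OF s]] dom_A_L2[OF uA[OF t]] g)
      also have "\<dots> \<le> C * nrm (opA (\<lambda>x. u s x - u t x)) * nrm g"
        using C(2)[OF d] by (intro mult_right_mono) auto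
      finally show "norm (ip (u s) g - ip (u t) g)
        \<le> C * nrm (opA (\<lambda>x. u s x - u t x)) * nrm g" .
    qed
    show "((\<lambda>s. C * nrm (opA (\<lambda>x. u s x - u t x)) * nrm g) \<longlongrightarrow> 0) (at t within {0..T})"
      using tendsto_mult_left_zero[OF tendsto_mult_right_zero[OF lim, of C], of "nrm g"] by simp
  qed
qed

text \<open>
  The time derivative \<open>u'\<close> belongs to one interval \<open>{0..T}\<close>. Expressing everything through the
  right-hand side of the equation, which does not refer to \<open>T\<close>, makes the statements for different
  \<open>T\<close> compatible.
\<close>

lemma strong_solution_time_identity:
  assumes sol: "strong_solution \<Omega> p u0 T u"
  obtains L where "0 \<le> L"
    "AE t in lebesgue_on {0..T}. rhs \<Omega> p (u t) \<in> L2 \<Omega> \<and> nrm (rhs \<Omega> p (u t)) \<le> L"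
    "\<And>g a b. g \<in> L2 \<Omega> \<Longrightarrow> 0 < a \<Longrightarrow> a < b \<Longrightarrow> b < T \<Longrightarrow>
      ((\<lambda>t. ip (rhs \<Omega> p (u t)) g) has_integral ip (u b) g - ip (u a) g) {a..b}"
proof -
  let ?M = "lebesgue_on {0..T}"
  obtain u' where u': "u' \<in> time_Linf {0..T} (L2 \<Omega>) (nrm)"
    "has_weak_time_derivative T (L2 \<Omega>) (nrm) u u'"
    and rL: "(\<lambda>t. rhs \<Omega> p (u t)) \<in> time_L2 {0..T} (L2 \<Omega>) (nrm)"
    and eq: "AE t in ?M. AE x in leb. u' t x = rhs \<Omega> p (u t) x"
    using sol unfolding strong_solution_def by blast
  have sm': "strongly_measurable {0..T} (L2 \<Omega>) (nrm) u'"
    and smr: "strongly_measurable {0..T} (L2 \<Omega>) (nrm) (\<lambda>t. rhs \<Omega> p (u t))"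
    using u'(1) rL by (auto simp: time_Linf_def time_L2_def)
  obtain C where C: "AE t in ?M. nrm (u' t) \<le> C" using u'(1) by (auto simp: time_Linf_def)
  have L': "AE t in ?M. u' t \<in> L2 \<Omega>" and Lr: "AE t in ?M. rhs \<Omega> p (u t) \<in> L2 \<Omega>"
    using sm' smr by (auto simp: strongly_measurable_def)
  define L where "L = max 0 C"
  have bound: "AE t in ?M. rhs \<Omega> p (u t) \<in> L2 \<Omega> \<and> nrm (rhs \<Omega> p (u t)) \<le> L"
    using C L' Lr eq
  proof eventually_elim
    case (elim t)
    then show ?case using L2_norm_cong_AE[OF elim(4,2,3)] by (simp add: L_def)
  qed
  have inner_eq: "AE t in ?M. ip (u' t) g = ip (rhs \<Omega> p (u t)) g" if g: "g \<in> L2 \<Omega>" for g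
    using L' Lr eq
  proof eventually_elim
    case (elim t)
    then show ?case using L2_inner_cong_AE[OF elim(3,1,2) g] by simp
  qed
  have int: "((\<lambda>t. ip (rhs \<Omega> p (u t)) g) has_integral ip (u b) g - ip (u a) g) {a..b}"
    if g: "g \<in> L2 \<Omega>" and ab: "0 < a" "a < b" "b < T" for g a b
  proof (rule weak_derivative_integral[OF strong_solution_continuous[OF sol g] strongly_measurable_pairing[OF smr g] _ _ ab])
    show "AE t in ?M. \<bar>ip (rhs \<Omega> p (u t)) g\<bar> \<le> L * nrm g"
      using bound
    proof eventually_elim
      case (elim t)
      then show ?case using L2_Cauchy_Schwarz[of "rhs \<Omega> p (u t)" g] g
        by (meson L2_norm_nonneg mult_right_mono order_trans)
    qed
    fix \<phi> assume "test_function {0<..<T} \<phi>"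
    then obtain I where I: "has_Bochner_integral {0..T} (L2 \<Omega>) (nrm) (\<lambda>t x. deriv \<phi> t * u t x) I"
      "has_Bochner_integral {0..T} (L2 \<Omega>) (nrm) (\<lambda>t x. \<phi> t * u' t x) (\<lambda>x. - I x)"
      using u'(2) unfolding has_weak_time_derivative_def by blast
    note p1 = Bochner_pairing[OF I(1) g, unfolded L2_inner_cmult] and p2 = Bochner_pairing[OF I(2) g, unfolded L2_inner_cmult]
    have \<phi>m: "\<phi> \<in> borel_measurable ?M"
      using smooth_continuous[OF test_function_smooth[OF \<open>test_function {0<..<T} \<phi>\<close>]]
      by (intro continuous_imp_measurable_on_sets_lebesgue) (auto intro: continuous_on_subset)
    have "(LINT t|?M. \<phi> t * ip (u' t) g) = (LINT t|?M. \<phi> t * ip (rhs \<Omega> p (u t)) g)"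
      using inner_eq[OF g] \<phi>m strongly_measurable_pairing[OF sm' g] strongly_measurable_pairing[OF smr g]
      by (intro integral_cong_AE) (auto elim: eventually_mono)
    then show "(LINT t|?M. deriv \<phi> t * ip (u t) g) = - (LINT t|?M. \<phi> t * ip (rhs \<Omega> p (u t)) g)"
      using p1(2) p2(2) by (simp add: L2_inner_uminus)
  qed
  have "0 \<le> L" by (simp add: L_def)
  then show ?thesis using bound int by (rule that)
qed

end

section \<open>The projected gradient flow\<close>

lemma abs_powr_mult_self:
  fixes x p :: real
  shows "\<bar>x\<bar> powr (p - 2) * x * x = \<bar>x\<bar> powr p"
proof (cases "x = 0")
  case False
  have "x * x = \<bar>x\<bar> powr 2" using False by (simp add: power2_eq_square)
  then have "\<bar>x\<bar> powr (p - 2) * x * x = \<bar>x\<bar> powr (p - 2) * \<bar>x\<bar> powr 2"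
    by (simp only: mult.assoc)
  also have "\<dots> = \<bar>x\<bar> powr (p - 2 + 2)" by (simp only: powr_add)
  also have "\<dots> = \<bar>x\<bar> powr p" by simp
  finally show ?thesis .
qed simp

text \<open>
  The subgradient inequality of \<open>|x|\<^sup>p / p\<close>, by Young's inequality with exponents
  \<open>p / (p - 1)\<close> and \<open>p\<close>.
\<close>

lemma power_convex_subgradient:
  fixes x y p :: real
  assumes p: "1 < p"
  shows "\<bar>x\<bar> powr (p - 2) * x * (y - x) \<le> \<bar>y\<bar> powr p / p - \<bar>x\<bar> powr p / p"
proof -
  have base: "\<bar>x\<bar> powr (p - 2) * \<bar>x\<bar> = \<bar>x\<bar> powr (p - 1)"
  proof -
    have "\<bar>x\<bar> * \<bar>x\<bar> powr (p - 2) = \<bar>x\<bar> powr (1 + (p - 2))" by (intro powr_mult_base) simp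
    then show ?thesis by (simp add: mult.commute)
  qed
  have "\<bar>x\<bar> powr (p - 2) * x * y \<le> \<bar>\<bar>x\<bar> powr (p - 2) * x * y\<bar>" by (rule abs_ge_self)
  also have "\<dots> = \<bar>x\<bar> powr (p - 1) * \<bar>y\<bar>" by (simp add: abs_mult base)
  also have "\<dots> \<le> (\<bar>x\<bar> powr (p - 1)) powr (p / (p - 1)) / (p / (p - 1)) + \<bar>y\<bar> powr p / p"
    using p by (intro Youngs_inequality) (auto simp: field_simps)
  also have "(\<bar>x\<bar> powr (p - 1)) powr (p / (p - 1)) = \<bar>x\<bar> powr p"
    using p by (simp add: powr_powr)
  also have "\<bar>x\<bar> powr p / (p / (p - 1)) = \<bar>x\<bar> powr p - \<bar>x\<bar> powr p / p"
    using p by (simp add: field_simps)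
  finally show ?thesis using abs_powr_mult_self[of x p] by (simp add: right_diff_distrib)
qed

locale gradient_flow_state = bounded_open \<Omega> for \<Omega> :: "'a::euclidean_space set" +
  fixes p :: real
  assumes p: "2 \<le> p"
begin

text \<open>
  The states at which the equation can be tested. Membership of the right-hand side in \<open>L\<^sup>2\<close> forces
  the nonlinear term into \<open>L\<^sup>2\<close>, and then \<open>|f|\<^sup>p\<close> is integrable; this matters because \<open>Lp_norm\<close> is zero
  when the integral diverges.
\<close>

definition good :: "('a \<Rightarrow> real) \<Rightarrow> bool" where
  "good f \<longleftrightarrow> f \<in> dom_A \<Omega> \<and> nrm f = 1 \<and> rhs \<Omega> p f \<in> L2 \<Omega>"

definition nonlin :: "('a \<Rightarrow> real) \<Rightarrow> 'a \<Rightarrow> real" where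
  "nonlin f x = \<bar>f x\<bar> powr (p - 2) * f x"

definition pmass :: "('a \<Rightarrow> real) \<Rightarrow> real" where
  "pmass f = (LINT x|leb. \<bar>f x\<bar> powr p)"

definition lam :: "('a \<Rightarrow> real) \<Rightarrow> real" where
  "lam f = (grad_norm \<Omega> f)\<^sup>2 + pmass f"

definition energy :: "('a \<Rightarrow> real) \<Rightarrow> real" where
  "energy f = (grad_norm \<Omega> f)\<^sup>2 / 2 + pmass f / p"

lemma pmass_nonneg: "0 \<le> pmass f"
  by (simp add: pmass_def)

lemma lam_nonneg: "0 \<le> lam f"
  by (simp add: lam_def pmass_nonneg)

lemma energy_nonneg: "0 \<le> energy f"
  using p by (simp add: energy_def pmass_nonneg)

lemma lam_le_energy: "lam f \<le> p * energy f"
proof -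
  have "2 * ((grad_norm \<Omega> f)\<^sup>2 / 2) \<le> p * ((grad_norm \<Omega> f)\<^sup>2 / 2)" using p by (intro mult_right_mono) auto
  then show ?thesis using p by (simp add: lam_def energy_def distrib_left)
qed

lemma rhs_eq: "rhs \<Omega> p f = (\<lambda>x. lam f * f x - (opA f x + nonlin f x))"
proof
  fix x
  have "Lp_norm \<Omega> p f powr p = pmass f"
    using p pmass_nonneg[of f] by (simp add: Lp_norm_def pmass_def powr_powr)
  then show "rhs \<Omega> p f x = lam f * f x - (opA f x + nonlin f x)"
    by (simp add: rhs_def lam_def op_A_def nonlin_def)
qed

lemma goodD:
  assumes "good f"
  shows "f \<in> dom_A \<Omega>" "f \<in> L2 \<Omega>" "nrm f = 1" "rhs \<Omega> p f \<in> L2 \<Omega>" "opA f \<in> L2 \<Omega>"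
    "nonlin f \<in> L2 \<Omega>" "ip f f = 1"
proof -
  show f: "f \<in> dom_A \<Omega>" "nrm f = 1" "rhs \<Omega> p f \<in> L2 \<Omega>" using assms by (auto simp: good_def)
  show fL: "f \<in> L2 \<Omega>" by (rule dom_A_L2[OF f(1)])
  show A: "opA f \<in> L2 \<Omega>" by (rule op_A_L2[OF f(1)])
  have "(\<lambda>x. (lam f * f x - opA f x) - rhs \<Omega> p f x) \<in> L2 \<Omega>"
    by (intro L2_diff L2_cmult fL A f(3))
  moreover have "(\<lambda>x. (lam f * f x - opA f x) - rhs \<Omega> p f x) = nonlin f"
    by (simp add: rhs_eq fun_eq_iff)
  ultimately show "nonlin f \<in> L2 \<Omega>" by simp
  show "ip f f = 1" using f(2) L2_norm_sq[of f] by simp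
qed

lemma pmass_inner:
  assumes "good f"
  shows "pmass f = ip (nonlin f) f" "integrable (leb) (\<lambda>x. \<bar>f x\<bar> powr p)"
  using L2_mult_integrable[OF goodD(6)[OF assms] goodD(2)[OF assms]]
  by (simp_all add: pmass_def L2_inner_def nonlin_def abs_powr_mult_self)

lemma rhs_inner:
  assumes "good f" "g \<in> L2 \<Omega>"
  shows "ip (rhs \<Omega> p f) g = lam f * ip f g - (ip (opA f) g + ip (nonlin f) g)"
  unfolding rhs_eq using goodD[OF assms(1)] assms(2)
  by (simp add: L2_inner_diff L2_inner_add L2_inner_cmult L2_cmult L2_add)

text \<open>
  The multiplier \<open>lam\<close> is the one that keeps the flow on the unit sphere.
\<close>

lemma rhs_tangent: "good f \<Longrightarrow> ip (rhs \<Omega> p f) f = 0"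
  by (simp add: rhs_inner goodD op_A_grad flip: pmass_inner(1)) (simp add: lam_def)

text \<open>
  Convexity of the Dirichlet integral, through the Green formula, and of the power, pointwise.
\<close>

lemma energy_subgradient:
  assumes f: "good f" and g: "good g"
  shows "ip (opA f) (\<lambda>x. g x - f x) + ip (nonlin f) (\<lambda>x. g x - f x) \<le> energy g - energy f"
proof -
  note F = goodD[OF f] and G = goodD[OF g]
  have "ip (opA f) g \<le> ((grad_norm \<Omega> f)\<^sup>2 + (grad_norm \<Omega> g)\<^sup>2) / 2"
  proof -
    have "ip (opA f) g = (\<Sum>b\<in>Basis. ip (wp b f) (wp b g))"
      by (rule Green[OF F(1) dom_A_H10[OF G(1)]])
    also have "\<dots> \<le> (\<Sum>b\<in>Basis. (ip (wp b f) (wp b f)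
        + ip (wp b g) (wp b g)) / 2)"
    proof (rule sum_mono)
      fix b :: 'a assume b: "b \<in> Basis"
      have "0 \<le> (nrm (\<lambda>x. wp b f x - wp b g x))\<^sup>2" by simp
      then show "ip (wp b f) (wp b g)
          \<le> (ip (wp b f) (wp b f) + ip (wp b g) (wp b g)) / 2"
        unfolding L2_norm_diff_sq[OF H1_weak_partial(1)[OF dom_A_H1[OF F(1)] b] H1_weak_partial(1)[OF dom_A_H1[OF G(1)] b]]
        by (simp add: L2_norm_sq)
    qed
    also have "\<dots> = ((grad_norm \<Omega> f)\<^sup>2 + (grad_norm \<Omega> g)\<^sup>2) / 2"
      by (simp add: grad_norm_sq sum.distrib flip: sum_divide_distrib)
    finally show ?thesis .
  qed
  moreover have "ip (opA f) (\<lambda>x. g x - f x) = ip (opA f) g - (grad_norm \<Omega> f)\<^sup>2"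
    by (simp add: L2_inner_diff_right F G op_A_grad)
  moreover have "ip (nonlin f) (\<lambda>x. g x - f x) \<le> pmass g / p - pmass f / p"
  proof -
    have "ip (nonlin f) (\<lambda>x. g x - f x) \<le> (LINT x|leb. \<bar>g x\<bar> powr p / p - \<bar>f x\<bar> powr p / p)"
      unfolding L2_inner_def
    proof (rule integral_mono)
      show "integrable (leb) (\<lambda>x. nonlin f x * (g x - f x))"
        by (intro L2_mult_integrable L2_diff F G)
      show "integrable (leb) (\<lambda>x. \<bar>g x\<bar> powr p / p - \<bar>f x\<bar> powr p / p)"
        using pmass_inner(2)[OF f] pmass_inner(2)[OF g] by simp
      show "nonlin f x * (g x - f x) \<le> \<bar>g x\<bar> powr p / p - \<bar>f x\<bar> powr p / p" for x
        unfolding nonlin_def using p by (intro power_convex_subgradient) simp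
    qed
    also have "\<dots> = pmass g / p - pmass f / p"
      using pmass_inner(2)[OF f] pmass_inner(2)[OF g] by (simp add: pmass_def)
    finally show ?thesis .
  qed
  ultimately show ?thesis by (simp add: energy_def field_simps)
qed

lemma rhs_evi:
  assumes f: "good f" and g: "good g"
  shows "- ip (rhs \<Omega> p f) g
    \<le> energy g - energy f + p / 2 * energy f * (nrm (\<lambda>x. f x - g x))\<^sup>2"
proof -
  note F = goodD[OF f] and G = goodD[OF g]
  have d: "(\<lambda>x. g x - f x) \<in> L2 \<Omega>" by (intro L2_diff F G)
  have \<Phi>: "(nrm (\<lambda>x. f x - g x))\<^sup>2 = 2 - 2 * ip f g"
    by (simp add: L2_norm_diff_sq F G)
  have "- ip (rhs \<Omega> p f) g = - ip (rhs \<Omega> p f) (\<lambda>x. g x - f x)"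
    by (simp add: L2_inner_diff_right F G rhs_tangent[OF f])
  also have "\<dots> = ip (opA f) (\<lambda>x. g x - f x) + ip (nonlin f) (\<lambda>x. g x - f x)
      - lam f * ip f (\<lambda>x. g x - f x)"
    by (simp add: rhs_inner[OF f d])
  also have "\<dots> \<le> energy g - energy f - lam f * ip f (\<lambda>x. g x - f x)"
    using energy_subgradient[OF f g] by simp
  also have "ip f (\<lambda>x. g x - f x) = - ((nrm (\<lambda>x. f x - g x))\<^sup>2 / 2)"
    unfolding \<Phi> by (simp add: L2_inner_diff_right F G diff_divide_distrib)
  also have "energy g - energy f - lam f * - ((nrm (\<lambda>x. f x - g x))\<^sup>2 / 2)
      = energy g - energy f + lam f * ((nrm (\<lambda>x. f x - g x))\<^sup>2 / 2)" by simp
  also have "lam f * ((nrm (\<lambda>x. f x - g x))\<^sup>2 / 2) \<le> p * energy f * ((nrm (\<lambda>x. f x - g x))\<^sup>2 / 2)"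
    by (intro mult_right_mono lam_le_energy) simp
  finally show ?thesis by simp
qed

text \<open>
  The nonlinear term has a favourable sign against \<open>A f\<close>, so that \<open>|A f|\<^sup>2\<close> is bounded by
  \<open>\<langle>A f + |f|\<^sup>p\<^sup>-\<^sup>2 f, A f\<rangle>\<close>, which the equation expresses through the right-hand side.
\<close>

lemma op_A_norm_sq_le:
  assumes f: "good f"
  shows "(nrm (opA f))\<^sup>2 \<le> - ip (rhs \<Omega> p f) (opA f) + lam f * nrm (opA f)"
proof -
  note F = goodD[OF f]
  have "0 \<le> ip (opA f) (nonlin f)"
    using op_A_power_nonneg[OF F(1), of p] F(6) p by (simp add: nonlin_def[abs_def])
  then have "(nrm (opA f))\<^sup>2 \<le> ip (opA f) (opA f) + ip (nonlin f) (opA f)"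
    by (simp add: L2_norm_sq L2_inner_commute)
  also have "\<dots> = - ip (rhs \<Omega> p f) (opA f) + lam f * ip f (opA f)"
    by (simp add: rhs_inner[OF f F(5)])
  also have "lam f * ip f (opA f) \<le> lam f * (nrm f * nrm (opA f))"
    using L2_Cauchy_Schwarz[OF F(2,5)] lam_nonneg by (intro mult_left_mono) auto
  finally show ?thesis by (simp add: F(3))
qed

end

locale global_flow = gradient_flow_state +
  fixes u0 :: "'a \<Rightarrow> real" and u :: "real \<Rightarrow> 'a \<Rightarrow> real"
  assumes global: "global_strong_solution \<Omega> p u0 u"
begin

lemma sol: "0 < T \<Longrightarrow> strong_solution \<Omega> p u0 T u"
  using global by (simp add: global_strong_solution_def)

lemma u_dom_A: "0 \<le> t \<Longrightarrow> u t \<in> dom_A \<Omega>"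
  using sol[of "t + 1"] by (auto simp: strong_solution_def time_C_def)

lemma u_sphere: "0 \<le> t \<Longrightarrow> nrm (u t) = 1"
  using sol[of "t + 1"] by (auto simp: strong_solution_def unit_sphere_def)

lemma u_L2: "0 \<le> t \<Longrightarrow> u t \<in> L2 \<Omega>"
  using u_dom_A dom_A_L2 by blast

lemma Au_tendsto:
  assumes "0 < T" "t \<in> {0..T}"
  shows "((\<lambda>s. nrm (\<lambda>x. opA (u s) x - opA (u t) x)) \<longlongrightarrow> 0) (at t within {0..T})"
proof -
  have lim: "((\<lambda>s. nrm (opA (\<lambda>x. u s x - u t x))) \<longlongrightarrow> 0) (at t within {0..T})"
    using sol[OF assms(1)] assms(2) by (auto simp: strong_solution_def time_C_def)
  have ev: "\<forall>\<^sub>F s in at t within {0..T}. nrm (opA (\<lambda>x. u s x - u t x))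
      = nrm (\<lambda>x. opA (u s) x - opA (u t) x)"
    unfolding eventually_at_filter
    using assms(2) by (intro always_eventually) (auto intro!: op_A_diff_norm u_dom_A)
  show ?thesis using lim tendsto_cong[OF ev] by simp
qed

definition dist2 :: "real \<Rightarrow> real \<Rightarrow> real" where
  "dist2 t s = (nrm (\<lambda>x. u t x - u s x))\<^sup>2"

lemma dist2_eq: "0 \<le> t \<Longrightarrow> 0 \<le> s \<Longrightarrow> dist2 t s = 2 - 2 * ip (u t) (u s)"
  by (simp add: dist2_def L2_norm_diff_sq u_L2 u_sphere)

text \<open>
  A bound on the speed that may depend on \<open>T\<close>; it only serves to start the argument.
\<close>

lemma local_speed:
  assumes "0 < T"
  obtains L where "0 \<le> L" "AE t in lebesgue_on {0..T}. good (u t) \<and> nrm (rhs \<Omega> p (u t)) \<le> L"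
    "\<And>g a b. g \<in> L2 \<Omega> \<Longrightarrow> 0 < a \<Longrightarrow> a < b \<Longrightarrow> b < T \<Longrightarrow>
      ((\<lambda>t. ip (rhs \<Omega> p (u t)) g) has_integral ip (u b) g - ip (u a) g) {a..b}"
proof -
  obtain L where L: "0 \<le> L"
    "AE t in lebesgue_on {0..T}. rhs \<Omega> p (u t) \<in> L2 \<Omega> \<and> nrm (rhs \<Omega> p (u t)) \<le> L"
    "\<And>g a b. g \<in> L2 \<Omega> \<Longrightarrow> 0 < a \<Longrightarrow> a < b \<Longrightarrow> b < T \<Longrightarrow>
      ((\<lambda>t. ip (rhs \<Omega> p (u t)) g) has_integral ip (u b) g - ip (u a) g) {a..b}"
    using strong_solution_time_identity[OF sol[OF assms]] by blast
  have "AE t in lebesgue_on {0..T}. good (u t) \<and> nrm (rhs \<Omega> p (u t)) \<le> L"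
    using L(2) AE_space
    by eventually_elim (auto simp: good_def u_dom_A u_sphere)
  then show ?thesis using L(1,3) that by blast
qed

definition good_times :: "real \<Rightarrow> real \<Rightarrow> real \<Rightarrow> real set" where
  "good_times a T L = {t \<in> {a..T}. good (u t) \<and> nrm (rhs \<Omega> p (u t)) \<le> L}"

text \<open>
  The bound \<open>L\<close> is enlarged to include the speed at \<open>a\<close>, so that \<open>a\<close> itself is a good time: its energy
  is the constant from which all uniform bounds are computed.
\<close>

lemma evi_interpretation:
  assumes a: "0 < a" "a < T" and ga: "good (u a)"
  obtains L where "0 \<le> L" "evi a T L p (good_times a T L) dist2 (\<lambda>s t. - ip (rhs \<Omega> p (u t)) (u s)) (\<lambda>t. energy (u t))"
proof -
  obtain L0 where L0: "0 \<le> L0" "AE t in lebesgue_on {0..T+1}. good (u t) \<and> nrm (rhs \<Omega> p (u t)) \<le> L0"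
    "\<And>g a b. g \<in> L2 \<Omega> \<Longrightarrow> 0 < a \<Longrightarrow> a < b \<Longrightarrow> b < T + 1 \<Longrightarrow>
      ((\<lambda>t. ip (rhs \<Omega> p (u t)) g) has_integral ip (u b) g - ip (u a) g) {a..b}"
    using local_speed[of "T + 1"] a by (smt (verit))
  define L where "L = max L0 (nrm (rhs \<Omega> p (u a)))"
  have L: "0 \<le> L" "L0 \<le> L" using L0(1) by (auto simp: L_def)
  let ?G = "good_times a T L"
  have GD: "t \<in> {a..T}" "good (u t)" "nrm (rhs \<Omega> p (u t)) \<le> L" if "t \<in> ?G" for t
    using that by (auto simp: good_times_def)
  have null: "negligible ({a..T} - ?G)"
  proof -
    have "AE t in lebesgue. t \<in> {0..T+1} \<longrightarrow> good (u t) \<and> nrm (rhs \<Omega> p (u t)) \<le> L0"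
      using L0(2) by (subst (asm) AE_restrict_space_iff) auto
    then obtain N where N: "N \<in> null_sets lebesgue"
        "{t. \<not> (t \<in> {0..T+1} \<longrightarrow> good (u t) \<and> nrm (rhs \<Omega> p (u t)) \<le> L0)} \<subseteq> N"
      by (auto simp: eventually_ae_filter)
    have "{a..T} - ?G \<subseteq> N"
      using N(2) a L(2) by (force simp: good_times_def)
    then show ?thesis using N(1) negligible_iff_null_sets negligible_subset by blast
  qed
  have int: "((\<lambda>t. ip (rhs \<Omega> p (u t)) g) has_integral ip (u y) g - ip (u x) g) {x..y}"
    if "g \<in> L2 \<Omega>" "a \<le> x" "x \<le> y" "y \<le> T" for g x y
  proof (cases "x = y")
    case False
    then show ?thesis using L0(3)[OF that(1), of x y] that a by auto
  qed (simp add: has_integral_refl)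
  have lip: "\<bar>ip (\<lambda>z. u y z - u x z) g\<bar> \<le> L * nrm g * \<bar>y - x\<bar>"
    if g: "g \<in> L2 \<Omega>" and xy: "x \<in> {a..T}" "y \<in> {a..T}" for g x y
  proof -
    have one: "\<bar>ip (u y) g - ip (u x) g\<bar> \<le> L * nrm g * (y - x)"
      if "a \<le> x" "x \<le> y" "y \<le> T" for x y
    proof -
      define q where "q t = (if t \<in> ?G then ip (rhs \<Omega> p (u t)) g else 0)" for t
      have "(q has_integral ip (u y) g - ip (u x) g) (cbox x y)"
        unfolding interval_cbox[symmetric]
        by (rule has_integral_spike[OF null _ int[OF g that]]) (use that in \<open>auto simp: q_def\<close>)
      moreover have "norm (q t) \<le> L * nrm g" for t
      proof (cases "t \<in> ?G")
        case True
        have "\<bar>ip (rhs \<Omega> p (u t)) g\<bar> \<le> nrm (rhs \<Omega> p (u t)) * nrm g"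
          by (rule L2_Cauchy_Schwarz[OF goodD(4)[OF GD(2)[OF True]] g])
        also have "\<dots> \<le> L * nrm g" using GD(3)[OF True] by (intro mult_right_mono) auto
        finally show ?thesis using True by (simp add: q_def)
      qed (simp add: q_def L)
      ultimately have "norm (ip (u y) g - ip (u x) g) \<le> L * nrm g * measure lborel (cbox x y)"
        using L(1) by (intro has_integral_bound) auto
      then show ?thesis using that by simp
    qed
    have "\<bar>ip (u y) g - ip (u x) g\<bar> \<le> L * nrm g * \<bar>y - x\<bar>"
      using one[of x y] one[of y x] xy by (cases "x \<le> y") (auto simp: abs_minus_commute)
    then show ?thesis using xy a g by (simp add: L2_inner_diff u_L2)
  qed
  have speed: "nrm (\<lambda>z. u y z - u x z) \<le> L * \<bar>y - x\<bar>" if xy: "x \<in> {a..T}" "y \<in> {a..T}" for x y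
  proof -
    let ?d = "\<lambda>z. u y z - u x z"
    have d: "?d \<in> L2 \<Omega>" using xy a by (intro L2_diff u_L2) auto
    have "nrm ?d * nrm ?d \<le> nrm ?d * (L * \<bar>y - x\<bar>)"
      using lip[OF d xy] L2_norm_sq[of ?d] by (simp add: power2_eq_square mult_ac)
    then show ?thesis using L(1) L2_norm_nonneg[of ?d] by (cases "nrm ?d = 0") auto
  qed
  have dist2_2: "\<bar>dist2 t' s' - dist2 t' s - dist2 t s' + dist2 t s\<bar> \<le> 2 * L\<^sup>2 * \<bar>t' - t\<bar> * \<bar>s' - s\<bar>"
    if m: "t \<in> {a..T}" "t' \<in> {a..T}" "s \<in> {a..T}" "s' \<in> {a..T}" for t t' s s'
  proof -
    have pos: "0 \<le> t" "0 \<le> t'" "0 \<le> s" "0 \<le> s'" using m a by auto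
    let ?d = "\<lambda>z. u s' z - u s z"
    have d: "?d \<in> L2 \<Omega>" using pos by (intro L2_diff u_L2)
    have "dist2 t' s' - dist2 t' s - dist2 t s' + dist2 t s = - 2 * ip (\<lambda>z. u t' z - u t z) ?d"
      using pos d by (simp add: dist2_eq L2_inner_diff L2_inner_diff_right u_L2)
    then have "\<bar>dist2 t' s' - dist2 t' s - dist2 t s' + dist2 t s\<bar> = 2 * \<bar>ip (\<lambda>z. u t' z - u t z) ?d\<bar>"
      by (simp add: abs_mult)
    also have "\<dots> \<le> 2 * (L * nrm ?d * \<bar>t' - t\<bar>)" using lip[OF d m(1,2)] by simp
    also have "\<dots> \<le> 2 * (L * (L * \<bar>s' - s\<bar>) * \<bar>t' - t\<bar>)"
      using speed[OF m(3,4)] L(1) by (intro mult_left_mono mult_right_mono) auto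
    finally show ?thesis by (simp add: power2_eq_square mult_ac)
  qed
  have r_lip: "\<bar>- ip (rhs \<Omega> p (u t)) (u s) - - ip (rhs \<Omega> p (u t)) (u s')\<bar> \<le> L\<^sup>2 * \<bar>s - s'\<bar>"
    if t: "t \<in> ?G" and m: "s \<in> {a..T}" "s' \<in> {a..T}" for t s s'
  proof -
    have pos: "0 \<le> s" "0 \<le> s'" using m a by auto
    let ?d = "\<lambda>z. u s' z - u s z"
    have "\<bar>ip (rhs \<Omega> p (u t)) ?d\<bar> \<le> nrm (rhs \<Omega> p (u t)) * nrm ?d"
      using pos by (intro L2_Cauchy_Schwarz goodD(4)[OF GD(2)[OF t]] L2_diff u_L2)
    also have "\<dots> \<le> L * (L * \<bar>s' - s\<bar>)" using GD(3)[OF t] speed[OF m] L(1) by (intro mult_mono) auto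
    finally show ?thesis using pos goodD(4)[OF GD(2)[OF t]]
      by (simp add: L2_inner_diff_right u_L2 power2_eq_square abs_minus_commute mult.assoc)
  qed
  have "evi a T L p ?G dist2 (\<lambda>s t. - ip (rhs \<Omega> p (u t)) (u s)) (\<lambda>t. energy (u t))"
  proof
    show "a < T" "0 \<le> p" using a p by auto
    show "?G \<subseteq> {a..T}" by (auto simp: good_times_def)
    show "a \<in> ?G" using ga a by (simp add: good_times_def L_def)
    show "negligible ({a..T} - ?G)" by (rule null)
    show "dist2 t s = dist2 s t" for t s unfolding dist2_def by (subst L2_norm_minus_commute) (rule refl)
    show "dist2 t t = 0" for t by (simp add: dist2_def L2_norm_def)
    show "0 \<le> dist2 t s" for t s by (simp add: dist2_def)
    show "dist2 t s \<le> L\<^sup>2 * (t - s)\<^sup>2" if "t \<in> {a..T}" "s \<in> {a..T}" for t s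
    proof -
      have "dist2 t s \<le> (L * \<bar>t - s\<bar>)\<^sup>2" unfolding dist2_def using speed[OF that(2,1)] by (intro power_mono) auto
      then show ?thesis by (simp add: power_mult_distrib)
    qed
    show "\<bar>dist2 t' s' - dist2 t' s - dist2 t s' + dist2 t s\<bar> \<le> 2 * L\<^sup>2 * \<bar>t' - t\<bar> * \<bar>s' - s\<bar>"
      if "t \<in> {a..T}" "t' \<in> {a..T}" "s \<in> {a..T}" "s' \<in> {a..T}" for t t' s s'
      by (rule dist2_2[OF that])
    show "((\<lambda>t. - ip (rhs \<Omega> p (u t)) (u s)) has_integral (dist2 y s - dist2 x s) / 2) {x..y}"
      if "s \<in> {a..T}" "a \<le> x" "x \<le> y" "y \<le> T" for s x y
      using has_integral_neg[OF int[OF u_L2 that(2-4), of s]] that a by (simp add: dist2_eq diff_divide_distrib)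
    show "\<bar>- ip (rhs \<Omega> p (u t)) (u s)\<bar> \<le> L\<^sup>2 * \<bar>t - s\<bar>" if "t \<in> ?G" "s \<in> {a..T}" for t s
      using r_lip[OF that GD(1)[OF that(1)]] rhs_tangent[OF GD(2)[OF that(1)]] by (simp add: abs_minus_commute)
    show "\<bar>- ip (rhs \<Omega> p (u t)) (u s) - - ip (rhs \<Omega> p (u t)) (u s')\<bar> \<le> L\<^sup>2 * \<bar>s - s'\<bar>"
      if "t \<in> ?G" "s \<in> {a..T}" "s' \<in> {a..T}" for t s s' by (rule r_lip[OF that])
    show "0 \<le> energy (u t)" if "t \<in> ?G" for t by (rule energy_nonneg)
    show "- ip (rhs \<Omega> p (u t)) (u s) \<le> energy (u s) - energy (u t) + p / 2 * energy (u t) * dist2 t s"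
      if "s \<in> ?G" "t \<in> ?G" for s t
      unfolding dist2_def by (rule rhs_evi[OF GD(2)[OF that(2)] GD(2)[OF that(1)]])
  qed
  then show ?thesis using that L(1) by blast
qed

lemma good_time_exists: obtains a where "0 < a" "a < 1" "good (u a)"
proof -
  obtain L where "AE t in lebesgue_on {0..1}. good (u t) \<and> nrm (rhs \<Omega> p (u t)) \<le> L"
    using local_speed[of 1] by (metis zero_less_one)
  then have "AE t in lebesgue. t \<in> {0..1} \<longrightarrow> good (u t)"
    by (subst (asm) AE_restrict_space_iff) (auto elim: eventually_mono)
  then obtain N where N: "N \<in> null_sets lebesgue" "{t. \<not> (t \<in> {0..1} \<longrightarrow> good (u t))} \<subseteq> N"
    by (auto simp: eventually_ae_filter)
  have "\<not> {0<..<1::real} \<subseteq> N"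
  proof
    assume "{0<..<1} \<subseteq> N"
    then have "negligible {0<..<1::real}" using N(1) negligible_iff_null_sets negligible_subset by blast
    then show False using open_not_negligible[of "{0<..<1::real}"] by simp
  qed
  then obtain a where a: "a \<in> {0<..<1}" "a \<notin> N" by blast
  have "good (u a)"
  proof (rule ccontr)
    assume "\<not> good (u a)"
    then have "a \<in> {t. \<not> (t \<in> {0..1} \<longrightarrow> good (u t))}" using a(1) by simp
    then show False using N(2) a(2) by blast
  qed
  then show ?thesis using a that[of a] by auto
qed

text \<open>
  For each final time the locale is interpreted anew, with the same starting point \<open>a\<close>, on which
  alone the constants depend.
\<close>

lemma uniform_estimates:
  obtains \<Lambda> V h0 where "0 \<le> \<Lambda>" "0 \<le> V" "0 < h0"
    "\<And>T. 2 \<le> T \<Longrightarrow> AE t in lebesgue_on {1..T}. lam (u t) \<le> \<Lambda>"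
    "\<And>b h. 2 \<le> b \<Longrightarrow> 0 < h \<Longrightarrow> h \<le> h0 \<Longrightarrow> nrm (\<lambda>x. u (b + h) x - u b x) \<le> V * h"
proof -
  obtain a where a: "0 < a" "a < 1" "good (u a)" using good_time_exists by blast
  define \<Lambda> where "\<Lambda> = p * energy (u a)"
  have \<Lambda>0: "0 \<le> \<Lambda>" using p energy_nonneg by (simp add: \<Lambda>_def)
  define V where "V = sqrt (4 * exp (2 * \<Lambda>) * energy (u a))"
  \<comment> \<open>gives both \<open>h0 \<le> 1\<close> and the condition \<open>h \<Lambda> \<le> 1/2\<close> of the speed bound\<close>
  define h0 where "h0 = 1 / (2 * \<Lambda> + 1)"
  have h0: "0 < h0" "h0 \<le> 1" "h0 * \<Lambda> \<le> 1 / 2" using \<Lambda>0 by (auto simp: h0_def field_simps)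
  have lam: "AE t in lebesgue_on {1..T}. lam (u t) \<le> \<Lambda>" if T: "2 \<le> T" for T
  proof -
    have "a < T" using a T by simp
    obtain L where "evi a T L p (good_times a T L) dist2 (\<lambda>s t. - ip (rhs \<Omega> p (u t)) (u s)) (\<lambda>t. energy (u t))"
      using evi_interpretation[OF a(1) \<open>a < T\<close> a(3)] by blast
    then interpret E: evi a T L p "good_times a T L" dist2 "\<lambda>s t. - ip (rhs \<Omega> p (u t)) (u s)" "\<lambda>t. energy (u t)" .
    have le: "lam (u t) \<le> \<Lambda>" if "t \<in> good_times a T L" for t
    proof -
      have "p * energy (u t) \<le> p * energy (u a)" using E.energy_nonincreasing[OF that] p by (intro mult_left_mono) auto
      then show ?thesis using lam_le_energy[of "u t"] by (simp add: \<Lambda>_def)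
    qed
    have "AE t in lebesgue. t \<notin> {a..T} - good_times a T L"
      using AE_not_in E.G_null unfolding negligible_iff_null_sets by blast
    then have "AE t in lebesgue. t \<in> {1..T} \<longrightarrow> lam (u t) \<le> \<Lambda>"
      by eventually_elim (use a le in auto)
    then show ?thesis by (subst AE_restrict_space_iff) auto
  qed
  have speed: "nrm (\<lambda>x. u (b + h) x - u b x) \<le> V * h" if b: "2 \<le> b" and h: "0 < h" "h \<le> h0" for b h
  proof -
    have "a < b + h" using a b h by simp
    obtain L where "evi a (b + h) L p (good_times a (b + h) L) dist2 (\<lambda>s t. - ip (rhs \<Omega> p (u t)) (u s)) (\<lambda>t. energy (u t))"
      using evi_interpretation[OF a(1) \<open>a < b + h\<close> a(3)] by blast
    then interpret E: evi a "b + h" L p "good_times a (b + h) L" dist2 "\<lambda>s t. - ip (rhs \<Omega> p (u t)) (u s)" "\<lambda>t. energy (u t)" .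
    have "h * \<Lambda> \<le> h0 * \<Lambda>" using h \<Lambda>0 by (intro mult_right_mono) auto
    then have "h * (p * energy (u a)) \<le> 1 / 2" using h0(3) by (simp add: \<Lambda>_def)
    then have "dist2 (b + h) b \<le> 4 * exp (2 * (p * energy (u a))) * energy (u a) * h\<^sup>2"
      using a b h h0(2) by (intro E.speed_bound) auto
    then have "(nrm (\<lambda>x. u (b + h) x - u b x))\<^sup>2 \<le> (V * h)\<^sup>2"
      using energy_nonneg by (simp add: dist2_def V_def power_mult_distrib \<Lambda>_def)
    then show ?thesis
      by (rule power2_le_imp_le) (use h energy_nonneg in \<open>auto simp: V_def\<close>)
  qed
  have "0 \<le> V" using energy_nonneg by (simp add: V_def)
  then show ?thesis using that[OF \<Lambda>0 _ h0(1) lam speed] by blast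
qed

text \<open>
  Average the estimate of \<open>op_A_norm_sq_le\<close> over \<open>{s..s+h}\<close>, with \<open>A u(t)\<close> frozen at \<open>t = s\<close> in the
  pairing with \<open>u'\<close>. The frozen pairing integrates to a displacement, which the uniform speed bounds
  by \<open>V h\<close>; freezing costs an arbitrarily small \<open>\<epsilon>\<close>, by continuity of \<open>u\<close> into \<open>D(A)\<close>, times
  constants that may depend on \<open>s\<close>.
\<close>

lemma Au_bounded_late:
  obtains C where "\<And>t. 2 \<le> t \<Longrightarrow> nrm (opA (u t)) \<le> C"
proof -
  obtain \<Lambda> V h0 where E: "0 \<le> \<Lambda>" "0 \<le> V" "0 < h0"
    "\<And>T. 2 \<le> T \<Longrightarrow> AE t in lebesgue_on {1..T}. lam (u t) \<le> \<Lambda>"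
    "\<And>b h. 2 \<le> b \<Longrightarrow> 0 < h \<Longrightarrow> h \<le> h0 \<Longrightarrow> nrm (\<lambda>x. u (b + h) x - u b x) \<le> V * h"
    using uniform_estimates by blast
  have "nrm (opA (u s)) \<le> V + \<Lambda>" if s: "2 \<le> s" for s
  proof -
    let ?A = "\<lambda>t. opA (u t)" let ?m = "nrm (?A s)"
    have AL: "?A t \<in> L2 \<Omega>" if "0 \<le> t" for t using op_A_L2[OF u_dom_A[OF that]] .
    obtain L where L: "0 \<le> L" "AE t in lebesgue_on {0..s+2}. good (u t) \<and> nrm (rhs \<Omega> p (u t)) \<le> L"
      "\<And>g a b. g \<in> L2 \<Omega> \<Longrightarrow> 0 < a \<Longrightarrow> a < b \<Longrightarrow> b < s + 2 \<Longrightarrow>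
        ((\<lambda>t. ip (rhs \<Omega> p (u t)) g) has_integral ip (u b) g - ip (u a) g) {a..b}"
      using local_speed[of "s + 2"] s by (smt (verit))
    have main: "?m\<^sup>2 \<le> (V + \<Lambda>) * ?m + \<epsilon> * (2 * ?m + L + \<Lambda>)" if \<epsilon>: "0 < \<epsilon>" for \<epsilon>
    proof -
      have s2: "s \<in> {0..s + 2}" using s by simp
      have "\<forall>\<^sub>F t in at s within {0..s+2}. nrm (\<lambda>x. ?A t x - ?A s x) < \<epsilon>"
        using order_tendstoD(2)[OF Au_tendsto[OF _ s2] \<epsilon>] s by simp
      then obtain \<eta> where \<eta>: "0 < \<eta>" "\<And>t. t \<in> {0..s+2} \<Longrightarrow> t \<noteq> s \<Longrightarrow> dist t s < \<eta> \<Longrightarrow> nrm (\<lambda>x. ?A t x - ?A s x) < \<epsilon>"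
        unfolding eventually_at by blast
      define h where "h = min (min (\<eta> / 2) h0) 1"
      have h: "0 < h" "h \<le> h0" "h \<le> 1" "h < \<eta>" using \<eta>(1) E(3) by (auto simp: h_def)
      have near: "nrm (\<lambda>x. ?A t x - ?A s x) \<le> \<epsilon>" if "t \<in> {s..s+h}" for t
      proof (cases "t = s")
        case True
        then show ?thesis using \<epsilon> by (simp add: L2_norm_def)
      next
        case False
        then show ?thesis using \<eta>(2)[of t] that h s by (force simp: dist_real_def)
      qed
      define D where "D = ?m\<^sup>2 - 2 * \<epsilon> * ?m - L * \<epsilon> - \<Lambda> * (?m + \<epsilon>)"
      have pt: "D \<le> - ip (rhs \<Omega> p (u t)) (?A s)"
        if t: "t \<in> {s..s+h}" and g: "good (u t)" "nrm (rhs \<Omega> p (u t)) \<le> L" "lam (u t) \<le> \<Lambda>" for t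
      proof -
        note G = goodD[OF g(1)]
        have As: "?A s \<in> L2 \<Omega>" using s by (intro AL) simp
        have tri: "\<bar>nrm (?A t) - ?m\<bar> \<le> \<epsilon>"
          using L2_norm_triangle_diff[OF G(5) As] near[OF t] by linarith
        have sq: "?m\<^sup>2 - 2 * \<epsilon> * ?m \<le> (nrm (?A t))\<^sup>2"
        proof (cases "\<epsilon> \<le> ?m")
          case True
          have "(?m - \<epsilon>)\<^sup>2 \<le> (nrm (?A t))\<^sup>2" using tri True by (intro power_mono) auto
          moreover have "(?m - \<epsilon>)\<^sup>2 = ?m\<^sup>2 - 2 * \<epsilon> * ?m + \<epsilon>\<^sup>2" by (simp add: power2_diff)
          ultimately show ?thesis using zero_le_power2[of \<epsilon>] by linarith
        next
          case False
          then have "?m\<^sup>2 \<le> \<epsilon> * ?m" unfolding power2_eq_square by (intro mult_right_mono) auto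
          moreover have "0 \<le> \<epsilon> * ?m" using \<epsilon> by simp
          ultimately show ?thesis using zero_le_power2[of "nrm (?A t)"] by linarith
        qed
        have d: "(\<lambda>x. ?A t x - ?A s x) \<in> L2 \<Omega>" by (intro L2_diff G As)
        have "\<bar>ip (rhs \<Omega> p (u t)) (\<lambda>x. ?A t x - ?A s x)\<bar> \<le> L * \<epsilon>"
          using L2_Cauchy_Schwarz[OF G(4) d] mult_mono[OF g(2) near[OF t] L(1) L2_norm_nonneg] by linarith
        then have "- ip (rhs \<Omega> p (u t)) (?A t) \<le> - ip (rhs \<Omega> p (u t)) (?A s) + L * \<epsilon>"
          by (simp add: L2_inner_diff_right G As abs_le_iff)
        moreover have "lam (u t) * nrm (?A t) \<le> \<Lambda> * (?m + \<epsilon>)"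
          using g(3) tri E(1) by (intro mult_mono) auto
        ultimately show ?thesis unfolding D_def using op_A_norm_sq_le[OF g(1)] sq by linarith
      qed
      have As: "?A s \<in> L2 \<Omega>" using s by (intro AL) simp
      have int: "((\<lambda>t. - ip (rhs \<Omega> p (u t)) (?A s)) has_integral
          - (ip (u (s + h)) (?A s) - ip (u s) (?A s))) {s..s+h}"
        by (intro has_integral_neg L(3)) (use s h As in auto)
      have "AE t in lebesgue. t \<in> {0..s+2} \<longrightarrow> good (u t) \<and> nrm (rhs \<Omega> p (u t)) \<le> L"
        using L(2) by (subst (asm) AE_restrict_space_iff) auto
      moreover have "AE t in lebesgue_on {1..s+2}. lam (u t) \<le> \<Lambda>" using s by (intro E(4)) simp
      then have "AE t in lebesgue. t \<in> {1..s+2} \<longrightarrow> lam (u t) \<le> \<Lambda>"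
        by (subst (asm) AE_restrict_space_iff) auto
      ultimately have "AE t in lebesgue. t \<in> {s..s+h} \<longrightarrow> D \<le> - ip (rhs \<Omega> p (u t)) (?A s)"
      proof eventually_elim
        case (elim t)
        show ?case using elim pt[of t] s h by auto
      qed
      then obtain N where N: "N \<in> null_sets lebesgue"
          "{t. \<not> (t \<in> {s..s+h} \<longrightarrow> D \<le> - ip (rhs \<Omega> p (u t)) (?A s))} \<subseteq> N"
        by (auto simp: eventually_ae_filter)
      define q where "q t = (if t \<in> N then D else - ip (rhs \<Omega> p (u t)) (?A s))" for t
      have qi: "(q has_integral - (ip (u (s + h)) (?A s) - ip (u s) (?A s))) {s..s+h}"
        by (rule has_integral_spike[OF _ _ int, of N]) (use N(1) in \<open>auto simp: q_def negligible_iff_null_sets\<close>)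
      have Di: "((\<lambda>t. D) has_integral D * h) {s..s+h}"
        using has_integral_const_real[of D s "s + h"] h by (simp add: mult.commute)
      have Dq: "D \<le> q t" if "t \<in> {s..s+h}" for t
      proof (cases "t \<in> N")
        case False
        from contra_subsetD[OF N(2) False] that False show ?thesis by (simp add: q_def)
      qed (simp add: q_def)
      have "D * h \<le> - (ip (u (s + h)) (?A s) - ip (u s) (?A s))"
        by (rule has_integral_le[OF Di qi Dq])
      also have "\<dots> = - ip (\<lambda>x. u (s + h) x - u s x) (?A s)"
        using s h As by (simp add: L2_inner_diff u_L2)
      also have "\<dots> \<le> nrm (\<lambda>x. u (s + h) x - u s x) * ?m"
      proof -
        have "(\<lambda>x. u (s + h) x - u s x) \<in> L2 \<Omega>" using s h by (intro L2_diff u_L2) auto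
        from L2_Cauchy_Schwarz[OF this As] show ?thesis by linarith
      qed
      also have "\<dots> \<le> V * h * ?m" using E(5)[OF s h(1,2)] by (intro mult_right_mono) auto
      finally have "D * h \<le> (V * ?m) * h" by (simp add: mult_ac)
      then have "D \<le> V * ?m" using h(1) by simp
      then show ?thesis by (simp add: D_def algebra_simps)
    qed
    have "(\<lambda>n. (V + \<Lambda>) * ?m + inverse (real (Suc n)) * (2 * ?m + L + \<Lambda>)) \<longlonglongrightarrow> (V + \<Lambda>) * ?m + 0 * (2 * ?m + L + \<Lambda>)"
      by (intro tendsto_intros LIMSEQ_inverse_real_of_nat)
    then have "?m\<^sup>2 \<le> (V + \<Lambda>) * ?m + 0 * (2 * ?m + L + \<Lambda>)"
      by (rule LIMSEQ_le_const) (use main in auto)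
    then have "?m * ?m \<le> ?m * (V + \<Lambda>)" by (simp add: power2_eq_square mult.commute)
    then show ?thesis using E(1,2) L2_norm_nonneg[of "?A s"] by (cases "?m = 0") auto
  qed
  then show ?thesis using that by blast
qed

lemma Au_bounded:
  obtains C where "\<And>t. 0 \<le> t \<Longrightarrow> nrm (opA (u t)) \<le> C"
proof -
  obtain C1 where C1: "\<And>t. 2 \<le> t \<Longrightarrow> nrm (opA (u t)) \<le> C1" using Au_bounded_late by blast
  have "continuous_on {0..2} (\<lambda>t. nrm (opA (u t)))"
    unfolding continuous_on_def
  proof
    fix t :: real assume t: "t \<in> {0..2}"
    show "((\<lambda>t. nrm (opA (u t))) \<longlongrightarrow> nrm (opA (u t))) (at t within {0..2})"
    proof (rule LIM_zero_cancel, rule Lim_null_comparison[OF _ Au_tendsto[OF _ t]])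
      show "\<forall>\<^sub>F s in at t within {0..2}. norm (nrm (opA (u s)) - nrm (opA (u t)))
          \<le> nrm (\<lambda>x. opA (u s) x - opA (u t) x)"
        unfolding eventually_at_filter real_norm_def
        using t by (intro always_eventually) (auto intro!: L2_norm_triangle_diff op_A_L2 u_dom_A)
    qed simp
  qed
  then have "compact ((\<lambda>t. nrm (opA (u t))) ` {0..2})" by (rule compact_continuous_image) simp
  then obtain C2 where C2: "\<And>t. t \<in> {0..2} \<Longrightarrow> nrm (opA (u t)) \<le> C2"
    using compact_imp_bounded bounded_real by (metis (no_types, lifting) abs_le_D1 imageI)
  have "nrm (opA (u t)) \<le> max C1 C2" if "0 \<le> t" for t
    using C1[of t] C2[of t] that by (cases "t \<le> 2") (auto simp: le_max_iff_disj)
  then show ?thesis using that by blast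
qed

end

theorem proposition4p1:
  fixes \<Omega> :: "'a::euclidean_space set"
    and p \<alpha> :: real
    and u\<^sub>0 :: "'a \<Rightarrow> real"
    and u :: "real \<Rightarrow> 'a \<Rightarrow> real"
  assumes "open \<Omega>" "connected \<Omega>" "\<Omega> \<noteq> {}" "bounded \<Omega>" "C2_boundary \<Omega>"
    and "2 \<le> p"
    and "DIM('a) \<ge> 5 \<Longrightarrow> p < (2 * real DIM('a) - 4) / (real DIM('a) - 4)"
    and "1/2 < \<alpha>" "\<alpha> < 1"
    and "u\<^sub>0 \<in> dom_frac_A \<Omega> \<alpha> \<inter> unit_sphere \<Omega>"
    and "global_strong_solution \<Omega> p u\<^sub>0 u"
  shows "\<exists>C. \<forall>t\<ge>0. u t \<in> dom_frac_A \<Omega> \<alpha> \<and> norm_frac_A \<Omega> \<alpha> (u t) \<le> C"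
proof -
  interpret global_flow \<Omega> p u\<^sub>0 u
    using assms by unfold_locales
  obtain C where C: "\<And>t. 0 \<le> t \<Longrightarrow> L2_norm \<Omega> (op_A \<Omega> (u t)) \<le> C" using Au_bounded by blast
  have eb: "\<exists>e \<mu>. eigenbasis_A \<Omega> e \<mu>"
    using assms(10) by (auto simp: dom_frac_A_def is_frac_A_def)
  have "u t \<in> dom_frac_A \<Omega> \<alpha> \<and> norm_frac_A \<Omega> \<alpha> (u t) \<le> sqrt (1 + C\<^sup>2)" if t: "0 \<le> t" for t
  proof -
    have \<alpha>: "0 \<le> \<alpha>" "\<alpha> \<le> 1" using assms by auto
    note f = frac_A_bound[OF eb u_dom_A[OF t] \<alpha>]
    have "(L2_norm \<Omega> (op_A \<Omega> (u t)))\<^sup>2 \<le> C\<^sup>2" by (intro power_mono C t) simp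
    then have "sqrt ((L2_norm \<Omega> (u t))\<^sup>2 + (L2_norm \<Omega> (op_A \<Omega> (u t)))\<^sup>2) \<le> sqrt (1 + C\<^sup>2)"
      by (simp add: u_sphere[OF t])
    then show ?thesis using f by linarith
  qed
  then show ?thesis by blast
qed

end
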